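(* Let $p=3$, $0<a<1/\Lambda$ and suppose that $\|\psi_1\|_4^4-a\|\nabla\psi_1\|_2^4<0$. Then there exists $\delta>0$ such that for any $\lambda\in(b\lambda_1,\,b\lambda_1+\delta)$ with $$(L^+\cap N_3)\cap H^2(\Omega)\ne\emptyset,$$ the following holds: if $u\in H(T_{\max})$ is a solution of the Kirchhoff problem (K) of the context with $u_0\in H^2(\Omega)\cap H_0^1(\Omega)$, $u_1\in H_0^1(\Omega)$, $u_0\in N_3^-$ and $E(0)<d_3^-$, where $d_3^-=\inf_{u\in N_3\cap L^-}J(u)$, then the maximal existence time $T_{\max}$ of $u$ is finite.
   Context: $\Omega\subset\mathbb{R}^3$ is a bounded open set with smooth boundary; $b>0$. $\|\cdot\|_q$ is the $L^q(\Omega)$ norm. Problem (K), with $p=3$: $$u_{tt}-\Big(a\int_\Omega|\nabla u|^2dx+b\Big)\Delta u=\lambda u+|u|^{2}u\ (t>0,\ x\in\Omega),\quad u(0,x)=u_0(x),\ u_t(0,x)=u_1(x)\ (x\in\Omega),\quad u=0\ (t\ge0,\ x\in\partial\Omega).$$ $H(T)=C([0,T);H_0^1(\Omega)\cap H^2(\Omega))\cap C^1([0,T);H_0^1(\Omega))\cap C^2([0,T);L^2(\Omega))$. For $u_0\in H^2(\Omega)\cap H_0^1(\Omega)$, $u_1\in H_0^1(\Omega)$, problem (K) has a unique solution in $H(T)$ for some $T>0$ (known local existence result); $T_{\max}\in(0,\infty]$ is its maximal existence time. $\lambda_1>0$ is the principal Dirichlet eigenvalue of $-\Delta$ on $\Omega$,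 with positive eigenfunction $\psi_1$. $\Lambda=\inf\{\|\nabla u\|_2^4:\ u\in H_0^1(\Omega),\ \|u\|_4=1\}>0$. $$J(u)=\frac a4\|\nabla u\|_2^4+\frac b2\|\nabla u\|_2^2-\frac\lambda2\|u\|_2^2-\frac14\|u\|_4^4,\qquad I(u)=a\|\nabla u\|_2^4+b\|\nabla u\|_2^2-\lambda\|u\|_2^2-\|u\|_4^4,$$ $E(0)=\frac12\|u_1\|_2^2+J(u_0)$, $N_3=\{u\in H_0^1(\Omega)\setminus\{0\}: I(u)=0\}$, $N_3^-=\{u\in H_0^1(\Omega): I(u)<0\}$, $L^{+}=\{u\in H_0^1(\Omega): b\|\nabla u\|_2^2-\lambda\|u\|_2^2>0\}$, $L^{-}=\{u\in H_0^1(\Omega): b\|\nabla u\|_2^2-\lambda\|u\|_2^2<0\}$. *)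

theory Defs
  imports "HOL-Analysis.Analysis"
begin

text \<open>
  Elements of Lebesgue and Sobolev spaces over \<open>\<Omega>\<close> are represented by functions on the whole
  space, of which only the values on \<open>\<Omega>\<close> up to null sets matter.  Equality of classes is equality
  almost everywhere in \<^term>\<open>lebesgue_on \<Omega>\<close>, and the norms are seminorms on representatives.
\<close>

section \<open>Smooth functions and domains with smooth boundary\<close>

fun Ck_on :: "nat \<Rightarrow> 'a::euclidean_space set \<Rightarrow> ('a \<Rightarrow> real) \<Rightarrow> bool" where
  "Ck_on 0 S f \<longleftrightarrow> continuous_on S f"
| "Ck_on (Suc k) S f \<longleftrightarrow> (\<forall>x\<in>S. f differentiable (at x)) \<and>
     (\<forall>i\<in>Basis. Ck_on k S (\<lambda>x. frechet_derivative f (at x) i))"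

definition Cinf_on :: "'a::euclidean_space set \<Rightarrow> ('a \<Rightarrow> real) \<Rightarrow> bool" where
  "Cinf_on S f \<longleftrightarrow> (\<forall>k. Ck_on k S f)"

text \<open>Near each boundary point, \<open>\<Omega>\<close> is the negativity set of a smooth function without
  critical points, so \<open>\<Omega>\<close> lies locally on one side of a smooth hypersurface.\<close>

definition smooth_boundary :: "'a::euclidean_space set \<Rightarrow> bool" where
  "smooth_boundary \<Omega> \<longleftrightarrow> (\<forall>x\<in>frontier \<Omega>. \<exists>U \<rho>. open U \<and> x \<in> U \<and> Cinf_on U \<rho> \<and>
     (\<forall>y\<in>U. frechet_derivative \<rho> (at y) \<noteq> (\<lambda>_. 0)) \<and> \<Omega> \<inter> U = {y\<in>U. \<rho> y < 0})"

definition test_functions :: "'a::euclidean_space set \<Rightarrow> ('a \<Rightarrow> real) set" where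
  "test_functions \<Omega> = {\<phi>. Cinf_on UNIV \<phi> \<and> (\<exists>K. compact K \<and> K \<subseteq> \<Omega> \<and> (\<forall>x. x \<notin> K \<longrightarrow> \<phi> x = 0))}"

section \<open>Lebesgue and Sobolev spaces\<close>

definition Lnorm :: "nat \<Rightarrow> 'a::euclidean_space set \<Rightarrow> ('a \<Rightarrow> 'b::real_normed_vector) \<Rightarrow> real" where
  "Lnorm q \<Omega> f = root q (LINT x|lebesgue_on \<Omega>. norm (f x) ^ q)"

definition L2 :: "'a::euclidean_space set \<Rightarrow> ('a \<Rightarrow> real) set" where
  "L2 \<Omega> = {f \<in> borel_measurable (lebesgue_on \<Omega>). integrable (lebesgue_on \<Omega>) (\<lambda>x. norm (f x) ^ 2)}"

definition L1_loc :: "'a::euclidean_space set \<Rightarrow> ('a \<Rightarrow> real) set" where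
  "L1_loc \<Omega> = {f. \<forall>K. compact K \<longrightarrow> K \<subseteq> \<Omega> \<longrightarrow> set_integrable lebesgue K f}"

definition has_weak_pderiv ::
  "'a::euclidean_space set \<Rightarrow> 'a \<Rightarrow> ('a \<Rightarrow> real) \<Rightarrow> ('a \<Rightarrow> real) \<Rightarrow> bool" where
  "has_weak_pderiv \<Omega> i u v \<longleftrightarrow> u \<in> L1_loc \<Omega> \<and> v \<in> L1_loc \<Omega> \<and>
     (\<forall>\<phi>\<in>test_functions \<Omega>. (LINT x|lebesgue_on \<Omega>. u x * frechet_derivative \<phi> (at x) i) =
        - (LINT x|lebesgue_on \<Omega>. v x * \<phi> x))"

text \<open>The choice is harmless: weak derivatives are unique up to null sets.\<close>

definition weak_pderiv :: "'a::euclidean_space set \<Rightarrow> 'a \<Rightarrow> ('a \<Rightarrow> real) \<Rightarrow> 'a \<Rightarrow> real" where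
  "weak_pderiv \<Omega> i u = (SOME v. has_weak_pderiv \<Omega> i u v)"

definition weak_grad :: "'a::euclidean_space set \<Rightarrow> ('a \<Rightarrow> real) \<Rightarrow> 'a \<Rightarrow> 'a" where
  "weak_grad \<Omega> u x = (\<Sum>i\<in>Basis. weak_pderiv \<Omega> i u x *\<^sub>R i)"

definition weak_laplacian :: "'a::euclidean_space set \<Rightarrow> ('a \<Rightarrow> real) \<Rightarrow> 'a \<Rightarrow> real" where
  "weak_laplacian \<Omega> u x = (\<Sum>i\<in>Basis. weak_pderiv \<Omega> i (weak_pderiv \<Omega> i u) x)"

definition H1 :: "'a::euclidean_space set \<Rightarrow> ('a \<Rightarrow> real) set" where
  "H1 \<Omega> = {u \<in> L2 \<Omega>. \<forall>i\<in>Basis. \<exists>v\<in>L2 \<Omega>. has_weak_pderiv \<Omega> i u v}"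

definition H1_norm :: "'a::euclidean_space set \<Rightarrow> ('a \<Rightarrow> real) \<Rightarrow> real" where
  "H1_norm \<Omega> u = sqrt ((Lnorm 2 \<Omega> u)\<^sup>2 + (Lnorm 2 \<Omega> (weak_grad \<Omega> u))\<^sup>2)"

definition H10 :: "'a::euclidean_space set \<Rightarrow> ('a \<Rightarrow> real) set" where
  "H10 \<Omega> = {u \<in> H1 \<Omega>. \<forall>\<epsilon>>0. \<exists>\<phi>\<in>test_functions \<Omega>. H1_norm \<Omega> (\<lambda>x. u x - \<phi> x) < \<epsilon>}"

definition H2 :: "'a::euclidean_space set \<Rightarrow> ('a \<Rightarrow> real) set" where
  "H2 \<Omega> = {u \<in> H1 \<Omega>. \<forall>i\<in>Basis. weak_pderiv \<Omega> i u \<in> H1 \<Omega>}"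

definition H2_norm :: "'a::euclidean_space set \<Rightarrow> ('a \<Rightarrow> real) \<Rightarrow> real" where
  "H2_norm \<Omega> u = sqrt ((H1_norm \<Omega> u)\<^sup>2 +
     (\<Sum>i\<in>Basis. \<Sum>j\<in>Basis. (Lnorm 2 \<Omega> (weak_pderiv \<Omega> j (weak_pderiv \<Omega> i u)))\<^sup>2))"

section \<open>The principal Dirichlet eigenvalue\<close>

definition dirichlet_eigenfunction ::
  "'a::euclidean_space set \<Rightarrow> real \<Rightarrow> ('a \<Rightarrow> real) \<Rightarrow> bool" where
  "dirichlet_eigenfunction \<Omega> \<mu> \<psi> \<longleftrightarrow> \<psi> \<in> H10 \<Omega> \<and> \<not> (AE x in lebesgue_on \<Omega>. \<psi> x = 0) \<and>
     (\<forall>\<phi>\<in>H10 \<Omega>. (LINT x|lebesgue_on \<Omega>. weak_grad \<Omega> \<psi> x \<bullet> weak_grad \<Omega> \<phi> x) =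
        \<mu> * (LINT x|lebesgue_on \<Omega>. \<psi> x * \<phi> x))"

definition principal_eigenvalue :: "'a::euclidean_space set \<Rightarrow> real" where
  "principal_eigenvalue \<Omega> = Inf {\<mu>. \<exists>\<psi>. dirichlet_eigenfunction \<Omega> \<mu> \<psi>}"

section \<open>Continuously differentiable functions of time with values in a seminormed space\<close>

text \<open>The target space is given by a carrier \<open>X\<close> and a seminorm \<open>N\<close>.  The end time is an
  extended real in order to include \<open>T = \<infinity>\<close>.\<close>

definition time_interval :: "ereal \<Rightarrow> real set" where
  "time_interval T = {t. 0 \<le> t \<and> ereal t < T}"

definition time_continuous ::
  "ereal \<Rightarrow> ('a \<Rightarrow> real) set \<Rightarrow> (('a \<Rightarrow> real) \<Rightarrow> real) \<Rightarrow> (real \<Rightarrow> 'a \<Rightarrow> real) \<Rightarrow> bool" where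
  "time_continuous T X N u \<longleftrightarrow> (\<forall>t\<in>time_interval T. u t \<in> X \<and>
     ((\<lambda>s. N (\<lambda>x. u s x - u t x)) \<longlongrightarrow> 0) (at t within time_interval T))"

definition has_time_derivative ::
  "ereal \<Rightarrow> ('a \<Rightarrow> real) set \<Rightarrow> (('a \<Rightarrow> real) \<Rightarrow> real) \<Rightarrow> (real \<Rightarrow> 'a \<Rightarrow> real) \<Rightarrow>
     (real \<Rightarrow> 'a \<Rightarrow> real) \<Rightarrow> bool" where
  "has_time_derivative T X N u v \<longleftrightarrow> (\<forall>t\<in>time_interval T. u t \<in> X \<and> v t \<in> X \<and>
     ((\<lambda>s. N (\<lambda>x. (u s x - u t x) / (s - t) - v t x)) \<longlongrightarrow> 0) (at t within time_interval T))"

fun time_Ck ::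
  "nat \<Rightarrow> ereal \<Rightarrow> ('a \<Rightarrow> real) set \<Rightarrow> (('a \<Rightarrow> real) \<Rightarrow> real) \<Rightarrow> (real \<Rightarrow> 'a \<Rightarrow> real) \<Rightarrow> bool" where
  "time_Ck 0 T X N u \<longleftrightarrow> time_continuous T X N u"
| "time_Ck (Suc k) T X N u \<longleftrightarrow> (\<exists>v. has_time_derivative T X N u v \<and> time_Ck k T X N v)"

definition Hspace :: "'a::euclidean_space set \<Rightarrow> ereal \<Rightarrow> (real \<Rightarrow> 'a \<Rightarrow> real) set" where
  "Hspace \<Omega> T = {u. time_Ck 0 T (H10 \<Omega> \<inter> H2 \<Omega>) (H2_norm \<Omega>) u \<and>
     time_Ck 1 T (H10 \<Omega>) (H1_norm \<Omega>) u \<and> time_Ck 2 T (L2 \<Omega>) (Lnorm 2 \<Omega>) u}"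

section \<open>The Kirchhoff problem with cubic nonlinearity\<close>

text \<open>The boundary condition is part of the space \<^const>\<open>Hspace\<close>; the equation is an identity
  in \<^const>\<open>L2\<close> at every positive time.\<close>

definition kirchhoff_solution ::
  "'a::euclidean_space set \<Rightarrow> real \<Rightarrow> real \<Rightarrow> real \<Rightarrow> ('a \<Rightarrow> real) \<Rightarrow> ('a \<Rightarrow> real) \<Rightarrow> ereal \<Rightarrow>
     (real \<Rightarrow> 'a \<Rightarrow> real) \<Rightarrow> bool" where
  "kirchhoff_solution \<Omega> a b l u0 u1 T u \<longleftrightarrow> u \<in> Hspace \<Omega> T \<and>
     (\<exists>ut utt. has_time_derivative T (L2 \<Omega>) (Lnorm 2 \<Omega>) u ut \<and>
        has_time_derivative T (L2 \<Omega>) (Lnorm 2 \<Omega>) ut utt \<and>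
        (\<forall>t\<in>time_interval T. 0 < t \<longrightarrow> (AE x in lebesgue_on \<Omega>.
           utt t x - (a * (Lnorm 2 \<Omega> (weak_grad \<Omega> (u t)))\<^sup>2 + b) * weak_laplacian \<Omega> (u t) x =
             l * u t x + \<bar>u t x\<bar>\<^sup>2 * u t x)) \<and>
        (AE x in lebesgue_on \<Omega>. u 0 x = u0 x) \<and>
        (AE x in lebesgue_on \<Omega>. ut 0 x = u1 x))"

definition max_existence_time ::
  "'a::euclidean_space set \<Rightarrow> real \<Rightarrow> real \<Rightarrow> real \<Rightarrow> ('a \<Rightarrow> real) \<Rightarrow> ('a \<Rightarrow> real) \<Rightarrow> ereal" where
  "max_existence_time \<Omega> a b l u0 u1 = Sup {T. 0 < T \<and> (\<exists>u. kirchhoff_solution \<Omega> a b l u0 u1 T u)}"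

section \<open>Variational quantities\<close>

definition Lambda :: "'a::euclidean_space set \<Rightarrow> real" where
  "Lambda \<Omega> = Inf {Lnorm 2 \<Omega> (weak_grad \<Omega> u) ^ 4 | u. u \<in> H10 \<Omega> \<and> Lnorm 4 \<Omega> u = 1}"

definition J :: "'a::euclidean_space set \<Rightarrow> real \<Rightarrow> real \<Rightarrow> real \<Rightarrow> ('a \<Rightarrow> real) \<Rightarrow> real" where
  "J \<Omega> a b l u = a / 4 * Lnorm 2 \<Omega> (weak_grad \<Omega> u) ^ 4 + b / 2 * (Lnorm 2 \<Omega> (weak_grad \<Omega> u))\<^sup>2
     - l / 2 * (Lnorm 2 \<Omega> u)\<^sup>2 - 1 / 4 * Lnorm 4 \<Omega> u ^ 4"

definition I :: "'a::euclidean_space set \<Rightarrow> real \<Rightarrow> real \<Rightarrow> real \<Rightarrow> ('a \<Rightarrow> real) \<Rightarrow> real" where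
  "I \<Omega> a b l u = a * Lnorm 2 \<Omega> (weak_grad \<Omega> u) ^ 4 + b * (Lnorm 2 \<Omega> (weak_grad \<Omega> u))\<^sup>2
     - l * (Lnorm 2 \<Omega> u)\<^sup>2 - Lnorm 4 \<Omega> u ^ 4"

definition E0 ::
  "'a::euclidean_space set \<Rightarrow> real \<Rightarrow> real \<Rightarrow> real \<Rightarrow> ('a \<Rightarrow> real) \<Rightarrow> ('a \<Rightarrow> real) \<Rightarrow> real" where
  "E0 \<Omega> a b l u0 u1 = 1 / 2 * (Lnorm 2 \<Omega> u1)\<^sup>2 + J \<Omega> a b l u0"

definition N3 :: "'a::euclidean_space set \<Rightarrow> real \<Rightarrow> real \<Rightarrow> real \<Rightarrow> ('a \<Rightarrow> real) set" where
  "N3 \<Omega> a b l = {u \<in> H10 \<Omega>. \<not> (AE x in lebesgue_on \<Omega>. u x = 0) \<and> I \<Omega> a b l u = 0}"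

definition N3_minus :: "'a::euclidean_space set \<Rightarrow> real \<Rightarrow> real \<Rightarrow> real \<Rightarrow> ('a \<Rightarrow> real) set" where
  "N3_minus \<Omega> a b l = {u \<in> H10 \<Omega>. I \<Omega> a b l u < 0}"

definition L_plus :: "'a::euclidean_space set \<Rightarrow> real \<Rightarrow> real \<Rightarrow> ('a \<Rightarrow> real) set" where
  "L_plus \<Omega> b l =
     {u \<in> H10 \<Omega>. b * (Lnorm 2 \<Omega> (weak_grad \<Omega> u))\<^sup>2 - l * (Lnorm 2 \<Omega> u)\<^sup>2 > 0}"

definition L_minus :: "'a::euclidean_space set \<Rightarrow> real \<Rightarrow> real \<Rightarrow> ('a \<Rightarrow> real) set" where
  "L_minus \<Omega> b l =
     {u \<in> H10 \<Omega>. b * (Lnorm 2 \<Omega> (weak_grad \<Omega> u))\<^sup>2 - l * (Lnorm 2 \<Omega> u)\<^sup>2 < 0}"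

text \<open>The infimum is taken in the extended reals, since the real-valued \<^const>\<open>Inf\<close> is
  unspecified on sets that are empty or unbounded below.\<close>

definition d3_minus :: "'a::euclidean_space set \<Rightarrow> real \<Rightarrow> real \<Rightarrow> real \<Rightarrow> ereal" where
  "d3_minus \<Omega> a b l = (INF u\<in>N3 \<Omega> a b l \<inter> L_minus \<Omega> b l. ereal (J \<Omega> a b l u))"

end

theory Submission
  imports Defs
begin

text \<open>
  Write \<open>I = P + B\<close> with the quartic part \<open>P(u) = a \<parallel>\<nabla>u\<parallel>\<^sub>2\<^sup>4 - \<parallel>u\<parallel>\<^sub>4\<^sup>4\<close> and the quadratic part
  \<open>B(u) = b \<parallel>\<nabla>u\<parallel>\<^sub>2\<^sup>2 - \<lambda> \<parallel>u\<parallel>\<^sub>2\<^sup>2\<close>; then \<open>J = P/4 + B/2\<close>.  For \<open>\<lambda> > b \<lambda>\<^sub>1\<close> a multiple of \<open>\<psi>\<^sub>1\<close> lies in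
  \<open>N\<^sub>3 \<inter> L\<^sup>-\<close>, so that \<open>d\<^sub>3\<^sup>- < 0\<close>, and \<open>J \<ge> d\<^sub>3\<^sup>-\<close> on all of \<open>N\<^sub>3\<close>.  By conservation of energy the
  solution never meets \<open>N\<^sub>3\<close>, hence \<open>I(u(t)) < 0\<close> throughout.  The virial identity reads
  \<open>(u, u\<^sub>t)' = 3 \<parallel>u\<^sub>t\<parallel>\<^sub>2\<^sup>2 + B(u) - 4 E(0)\<close>, and Levine's concavity argument rules out global existence as
  soon as \<open>B(u) \<ge> 4 d\<^sub>3\<^sup>-\<close> whenever \<open>I(u) < 0\<close>.  This is clear by scaling \<open>u\<close> into \<open>N\<^sub>3\<close> if \<open>B(u) < 0 < P(u)\<close>.
  If \<open>B(u) < 0\<close> and \<open>P(u) \<le> 0\<close>, a segment inside \<open>L\<^sup>-\<close> joins \<open>u\<close> to \<open>\<psi>\<^sub>1\<close> or \<open>- \<psi>\<^sub>1\<close>, where \<open>P\<close> is positive;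
  at the last zero of \<open>P\<close> on it the values \<open>- B\<^sup>2 / (4 P)\<close> of \<open>J\<close> on \<open>N\<^sub>3 \<inter> L\<^sup>-\<close> tend to \<open>-\<infinity>\<close>, which contradicts
  \<open>E(0) < d\<^sub>3\<^sup>-\<close>.  No spectral gap enters, so any \<open>\<delta>\<close> will do.
\<close>

section \<open>Square integrable functions\<close>

text \<open>The analytic obstacle is the quartic term. The Lebesgue integral of a function that is
  not integrable is 0 by convention, so the expansions and derivatives of \<open>LINT\<close> over a
  fourth power need integrability first. Along the solution it is read off the equation, which
  exhibits \<open>u^3\<close> as a combination in L2 of \<open>u\<close>, its Laplacian and its
  second time derivative. For the eigenfunction it comes from Ladyzhenskaya's inequality, extended
  from test functions by density and Fatou's lemma. All time derivatives are taken in L2. Green's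
  formula moves the gradients onto the Laplacian, which is continuous in time, so that the energy
  can be differentiated. On the Nehari set \<open>P = - B\<close>, hence \<open>J = B / 4\<close>;
  this is why \<open>B\<close> is compared with four times the level. The coefficient 3 is
  \<open>1 + 2\<close>, from \<open>I = 4 J - B\<close> and from the kinetic energy in the
  conservation law. It is exactly the weight for which the Cauchy-Schwarz inequality makes the
  reciprocal of the L2 norm of the solution concave once that norm increases.\<close>

definition sq_int :: "'a measure \<Rightarrow> ('a \<Rightarrow> real) set" where
  "sq_int M = {f \<in> borel_measurable M. integrable M (\<lambda>x. (f x)\<^sup>2)}"

definition l2_inner :: "'a measure \<Rightarrow> ('a \<Rightarrow> real) \<Rightarrow> ('a \<Rightarrow> real) \<Rightarrow> real" where
  "l2_inner M f g = (LINT x|M. f x * g x)"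

definition l2_norm :: "'a measure \<Rightarrow> ('a \<Rightarrow> real) \<Rightarrow> real" where
  "l2_norm M f = sqrt (l2_inner M f f)"

lemma sq_int_measurable [measurable_dest]: "f \<in> sq_int M \<Longrightarrow> f \<in> borel_measurable M"
  by (simp add: sq_int_def)

lemma sq_int_mult_integrable:
  assumes "f \<in> sq_int M" "g \<in> sq_int M"
  shows "integrable M (\<lambda>x. f x * g x)"
proof (rule Bochner_Integration.integrable_bound)
  show "integrable M (\<lambda>x. (f x)\<^sup>2 + (g x)\<^sup>2)"
    using assms by (auto simp: sq_int_def)
  show "(\<lambda>x. f x * g x) \<in> borel_measurable M"
    using assms by (auto simp: sq_int_def)
  have "\<bar>p * q\<bar> \<le> \<bar>p\<^sup>2 + q\<^sup>2\<bar>" for p q :: real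
  proof -
    have "0 \<le> (\<bar>p\<bar> - \<bar>q\<bar>)\<^sup>2" by simp
    then have "2 * (\<bar>p\<bar> * \<bar>q\<bar>) \<le> p\<^sup>2 + q\<^sup>2" by (simp add: power2_diff)
    moreover have "\<bar>p\<bar> * \<bar>q\<bar> \<le> 2 * (\<bar>p\<bar> * \<bar>q\<bar>)" by simp
    ultimately have "\<bar>p\<bar> * \<bar>q\<bar> \<le> p\<^sup>2 + q\<^sup>2" by (rule order_trans[rotated])
    then show ?thesis by (simp add: abs_mult)
  qed
  then show "AE x in M. norm (f x * g x) \<le> norm ((f x)\<^sup>2 + (g x)\<^sup>2)" by simp
qed

lemma sq_int_scale: "f \<in> sq_int M \<Longrightarrow> (\<lambda>x. c * f x) \<in> sq_int M"
  by (auto simp: sq_int_def power_mult_distrib)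

lemma sq_int_add:
  assumes "f \<in> sq_int M" "g \<in> sq_int M"
  shows "(\<lambda>x. f x + g x) \<in> sq_int M"
proof -
  have "(\<lambda>x. (f x + g x)\<^sup>2) = (\<lambda>x. (f x)\<^sup>2 + (g x)\<^sup>2 + 2 * (f x * g x))"
    by (auto simp: power2_sum)
  then show ?thesis
    using assms sq_int_mult_integrable[OF assms] by (auto simp: sq_int_def)
qed

lemma sq_int_diff:
  assumes "f \<in> sq_int M" "g \<in> sq_int M"
  shows "(\<lambda>x. f x - g x) \<in> sq_int M"
  using sq_int_add[OF assms(1) sq_int_scale[OF assms(2), of "-1"]] by simp

lemma sq_int_sum:
  "(\<And>i. i \<in> B \<Longrightarrow> f i \<in> sq_int M) \<Longrightarrow> (\<lambda>x. \<Sum>i\<in>B. f i x) \<in> sq_int M"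
proof (induction B rule: infinite_finite_induct)
  case (insert i B)
  then show ?case using sq_int_add[of "f i" M "\<lambda>x. \<Sum>i\<in>B. f i x"] by simp
qed (auto simp: sq_int_def)

lemma l2_inner_commute: "l2_inner M f g = l2_inner M g f"
  by (simp add: l2_inner_def mult.commute)

lemma l2_inner_add_left:
  assumes "f \<in> sq_int M" "g \<in> sq_int M" "h \<in> sq_int M"
  shows "l2_inner M (\<lambda>x. f x + g x) h = l2_inner M f h + l2_inner M g h"
  using assms by (simp add: l2_inner_def distrib_right sq_int_mult_integrable)

lemma l2_inner_diff_left:
  assumes "f \<in> sq_int M" "g \<in> sq_int M" "h \<in> sq_int M"
  shows "l2_inner M (\<lambda>x. f x - g x) h = l2_inner M f h - l2_inner M g h"
  using assms by (simp add: l2_inner_def left_diff_distrib sq_int_mult_integrable)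

lemma l2_inner_diff_right:
  assumes "f \<in> sq_int M" "g \<in> sq_int M" "h \<in> sq_int M"
  shows "l2_inner M h (\<lambda>x. f x - g x) = l2_inner M h f - l2_inner M h g"
  using l2_inner_diff_left[OF assms] by (simp add: l2_inner_commute)

lemma l2_inner_add_right:
  assumes "f \<in> sq_int M" "g \<in> sq_int M" "h \<in> sq_int M"
  shows "l2_inner M h (\<lambda>x. f x + g x) = l2_inner M h f + l2_inner M h g"
  using l2_inner_add_left[OF assms] by (simp add: l2_inner_commute)

lemma l2_inner_scale_left: "l2_inner M (\<lambda>x. c * f x) g = c * l2_inner M f g"
  by (simp add: l2_inner_def mult.assoc)

lemma l2_inner_scale_right: "l2_inner M g (\<lambda>x. c * f x) = c * l2_inner M g f"
  by (metis l2_inner_commute l2_inner_scale_left)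

lemma l2_inner_sum_left:
  "(\<And>i. i \<in> B \<Longrightarrow> f i \<in> sq_int M) \<Longrightarrow> h \<in> sq_int M \<Longrightarrow>
     l2_inner M (\<lambda>x. \<Sum>i\<in>B. f i x) h = (\<Sum>i\<in>B. l2_inner M (f i) h)"
  by (simp add: l2_inner_def sum_distrib_right sq_int_mult_integrable)

lemma l2_inner_cong_AE:
  assumes "f \<in> borel_measurable M" "f' \<in> borel_measurable M"
    "g \<in> borel_measurable M" "g' \<in> borel_measurable M"
    "AE x in M. f x = f' x" "AE x in M. g x = g' x"
  shows "l2_inner M f g = l2_inner M f' g'"
  unfolding l2_inner_def
proof (rule integral_cong_AE)
  show "AE x in M. f x * g x = f' x * g' x"
    using assms(5,6) by eventually_elim simp
qed (use assms in auto)

lemma l2_inner_self_nonneg: "0 \<le> l2_inner M f f"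
  by (simp add: l2_inner_def)

lemma l2_norm_nonneg [simp]: "0 \<le> l2_norm M f"
  by (simp add: l2_norm_def l2_inner_self_nonneg)

lemma l2_norm_power2: "(l2_norm M f)\<^sup>2 = l2_inner M f f"
  by (simp add: l2_norm_def l2_inner_self_nonneg)

lemma l2_norm_scale: "l2_norm M (\<lambda>x. c * f x) = \<bar>c\<bar> * l2_norm M f"
  by (simp add: l2_norm_def l2_inner_scale_left l2_inner_scale_right real_sqrt_mult flip: mult.assoc)

lemma l2_norm_minus_commute: "l2_norm M (\<lambda>x. f x - g x) = l2_norm M (\<lambda>x. g x - f x)"
proof -
  have "(\<lambda>x. f x - g x) = (\<lambda>x. (-1) * (g x - f x))" by auto
  then show ?thesis by (metis abs_minus abs_1 l2_norm_scale mult_1)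
qed

lemma l2_norm_eq_0_iff:
  assumes "f \<in> sq_int M"
  shows "l2_norm M f = 0 \<longleftrightarrow> (AE x in M. f x = 0)"
proof -
  have "l2_norm M f = 0 \<longleftrightarrow> (LINT x|M. (f x)\<^sup>2) = 0"
    by (simp add: l2_norm_def l2_inner_def power2_eq_square)
  also have "\<dots> \<longleftrightarrow> (AE x in M. (f x)\<^sup>2 = 0)"
    using assms by (intro integral_nonneg_eq_0_iff_AE) (auto simp: sq_int_def)
  finally show ?thesis by simp
qed

text \<open>If \<open>g\<close> vanishes a.e., both sides are 0; otherwise the norm of
  \<open>f\<close> minus its projection onto \<open>g\<close> is nonnegative. The squared form is
  the one that the concavity argument consumes.\<close>

lemma l2_Cauchy_Schwarz_power2:
  assumes f: "f \<in> sq_int M" and g: "g \<in> sq_int M"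
  shows "(l2_inner M f g)\<^sup>2 \<le> l2_inner M f f * l2_inner M g g"
proof (cases "l2_inner M g g = 0")
  case True
  then have "AE x in M. g x = 0"
    using l2_norm_eq_0_iff[OF g] by (simp add: l2_norm_def)
  then have "l2_inner M f g = l2_inner M f (\<lambda>_. 0)"
    using f g by (intro l2_inner_cong_AE) (auto simp: sq_int_def)
  then show ?thesis using True by (simp add: l2_inner_def)
next
  case False
  then have pos: "l2_inner M g g > 0" using l2_inner_self_nonneg[of M g] by simp
  define c where "c = l2_inner M f g / l2_inner M g g"
  have cg: "(\<lambda>x. c * g x) \<in> sq_int M" using g by (rule sq_int_scale)
  have "0 \<le> l2_inner M (\<lambda>x. f x - c * g x) (\<lambda>x. f x - c * g x)"
    by (rule l2_inner_self_nonneg)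
  also have "\<dots> = l2_inner M f f - 2 * c * l2_inner M f g + c\<^sup>2 * l2_inner M g g"
    using f g cg by (simp add: l2_inner_diff_left l2_inner_diff_right sq_int_diff
        l2_inner_scale_left l2_inner_scale_right l2_inner_commute[of M g f]
        power2_eq_square algebra_simps)
  also have "\<dots> = l2_inner M f f - (l2_inner M f g)\<^sup>2 / l2_inner M g g"
    using pos by (simp add: c_def field_simps power2_eq_square)
  finally show ?thesis using pos by (simp add: field_simps)
qed

lemma l2_Cauchy_Schwarz:
  assumes "f \<in> sq_int M" "g \<in> sq_int M"
  shows "\<bar>l2_inner M f g\<bar> \<le> l2_norm M f * l2_norm M g"
proof -
  have "sqrt ((l2_inner M f g)\<^sup>2) \<le> sqrt (l2_inner M f f * l2_inner M g g)"
    using l2_Cauchy_Schwarz_power2[OF assms] by (rule real_sqrt_le_mono)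
  then show ?thesis by (simp add: l2_norm_def real_sqrt_mult)
qed

lemma l2_norm_triangle:
  assumes f: "f \<in> sq_int M" and g: "g \<in> sq_int M"
  shows "l2_norm M (\<lambda>x. f x + g x) \<le> l2_norm M f + l2_norm M g"
proof (rule power2_le_imp_le)
  have "(l2_norm M (\<lambda>x. f x + g x))\<^sup>2 = l2_inner M f f + 2 * l2_inner M f g + l2_inner M g g"
    using f g by (simp add: l2_norm_power2 l2_inner_add_left l2_inner_add_right sq_int_add
        l2_inner_commute[of M g f])
  also have "\<dots> \<le> (l2_norm M f)\<^sup>2 + 2 * (l2_norm M f * l2_norm M g) + (l2_norm M g)\<^sup>2"
    using l2_Cauchy_Schwarz[OF f g] by (simp add: l2_norm_power2)
  finally show "(l2_norm M (\<lambda>x. f x + g x))\<^sup>2 \<le> (l2_norm M f + l2_norm M g)\<^sup>2"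
    by (simp add: power2_sum algebra_simps)
qed simp

lemma l2_norm_triangle_diff:
  assumes "f \<in> sq_int M" "g \<in> sq_int M"
  shows "l2_norm M f \<le> l2_norm M (\<lambda>x. f x - g x) + l2_norm M g"
  using l2_norm_triangle[OF sq_int_diff[OF assms] assms(2)] by simp

lemma l2_norm_cong_AE:
  assumes "f \<in> borel_measurable M" "g \<in> borel_measurable M" "AE x in M. f x = g x"
  shows "l2_norm M f = l2_norm M g"
  unfolding l2_norm_def using assms by (subst l2_inner_cong_AE[of f M g f g]) auto

text \<open>Membership is part of the predicate because \<^const>\<open>l2_norm\<close> takes the junk value 0 on functions
  that are not square integrable.\<close>

definition l2_tendsto :: "'a measure \<Rightarrow> ('b \<Rightarrow> 'a \<Rightarrow> real) \<Rightarrow> ('a \<Rightarrow> real) \<Rightarrow> 'b filter \<Rightarrow> bool" where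
  "l2_tendsto M f g F \<longleftrightarrow> (\<forall>\<^sub>F s in F. f s \<in> sq_int M) \<and> g \<in> sq_int M \<and>
     ((\<lambda>s. l2_norm M (\<lambda>x. f s x - g x)) \<longlongrightarrow> 0) F"

lemma l2_tendstoI:
  assumes "\<forall>\<^sub>F s in F. f s \<in> sq_int M" "g \<in> sq_int M" "(e \<longlongrightarrow> 0) F"
    "\<forall>\<^sub>F s in F. l2_norm M (\<lambda>x. f s x - g x) \<le> e s"
  shows "l2_tendsto M f g F"
  using assms unfolding l2_tendsto_def
  by (intro conjI) (assumption | rule tendsto_sandwich[of "\<lambda>_. 0" _ F e] tendsto_const
      always_eventually allI l2_norm_nonneg)+

text \<open>Split the increment into the inner products of \<open>f s - f'\<close> with
  \<open>g s\<close> and of \<open>f'\<close> with \<open>g s - g'\<close>. The norm of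
  \<open>g s\<close> is controlled by that of \<open>g'\<close> plus the error.\<close>

lemma l2_tendsto_inner:
  assumes "l2_tendsto M f f' F" "l2_tendsto M g g' F"
  shows "((\<lambda>s. l2_inner M (f s) (g s)) \<longlongrightarrow> l2_inner M f' g') F"
proof -
  let ?a = "\<lambda>s. l2_norm M (\<lambda>x. f s x - f' x)" and ?b = "\<lambda>s. l2_norm M (\<lambda>x. g s x - g' x)"
  have a: "(?a \<longlongrightarrow> 0) F" and b: "(?b \<longlongrightarrow> 0) F"
    using assms by (auto simp: l2_tendsto_def)
  have lim: "((\<lambda>s. ?a s * (?b s + l2_norm M g') + l2_norm M f' * ?b s) \<longlongrightarrow>
      0 * (0 + l2_norm M g') + l2_norm M f' * 0) F"
    by (intro tendsto_intros a b)
  have "\<forall>\<^sub>F s in F. \<bar>l2_inner M (f s) (g s) - l2_inner M f' g'\<bar> \<le>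
      ?a s * (?b s + l2_norm M g') + l2_norm M f' * ?b s"
  proof -
    have "\<forall>\<^sub>F s in F. f s \<in> sq_int M" "\<forall>\<^sub>F s in F. g s \<in> sq_int M"
      using assms by (auto simp: l2_tendsto_def)
    then show ?thesis
    proof eventually_elim
      case (elim s)
      have f': "f' \<in> sq_int M" and g': "g' \<in> sq_int M" using assms by (auto simp: l2_tendsto_def)
      have "l2_inner M (f s) (g s) - l2_inner M f' g' =
          l2_inner M (\<lambda>x. f s x - f' x) (g s) + l2_inner M f' (\<lambda>x. g s x - g' x)"
        using elim f' g' by (simp add: l2_inner_diff_left l2_inner_diff_right)
      also have "\<bar>\<dots>\<bar> \<le> ?a s * l2_norm M (g s) + l2_norm M f' * ?b s"
        using l2_Cauchy_Schwarz[OF sq_int_diff[OF elim(1) f'] elim(2)]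
          l2_Cauchy_Schwarz[OF f' sq_int_diff[OF elim(2) g']] by linarith
      also have "\<dots> \<le> ?a s * (?b s + l2_norm M g') + l2_norm M f' * ?b s"
        using l2_norm_triangle_diff[OF elim(2) g'] by (simp add: mult_left_mono)
      finally show ?case .
    qed
  qed
  then have "((\<lambda>s. l2_inner M (f s) (g s) - l2_inner M f' g') \<longlongrightarrow> 0) F"
    using lim unfolding mult_zero_left mult_zero_right add_0_right real_norm_def[symmetric]
    by (rule Lim_null_comparison)
  then show ?thesis by (simp add: LIM_zero_iff)
qed

lemma l2_tendsto_const: "f \<in> sq_int M \<Longrightarrow> l2_tendsto M (\<lambda>_. f) f F"
  by (simp add: l2_tendsto_def l2_norm_def l2_inner_def)

lemma l2_tendsto_add:
  assumes "l2_tendsto M f f' F" "l2_tendsto M g g' F"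
  shows "l2_tendsto M (\<lambda>s x. f s x + g s x) (\<lambda>x. f' x + g' x) F"
proof (rule l2_tendstoI)
  have ev: "\<forall>\<^sub>F s in F. f s \<in> sq_int M" "\<forall>\<^sub>F s in F. g s \<in> sq_int M"
    and lim: "f' \<in> sq_int M" "g' \<in> sq_int M"
    using assms by (auto simp: l2_tendsto_def)
  show "\<forall>\<^sub>F s in F. (\<lambda>x. f s x + g s x) \<in> sq_int M"
    using ev by eventually_elim (rule sq_int_add)
  show "(\<lambda>x. f' x + g' x) \<in> sq_int M" using lim by (rule sq_int_add)
  show "((\<lambda>s. l2_norm M (\<lambda>x. f s x - f' x) + l2_norm M (\<lambda>x. g s x - g' x)) \<longlongrightarrow> 0) F"
    using assms by (auto simp: l2_tendsto_def intro!: tendsto_add_zero)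
  show "\<forall>\<^sub>F s in F. l2_norm M (\<lambda>x. (f s x + g s x) - (f' x + g' x)) \<le>
      l2_norm M (\<lambda>x. f s x - f' x) + l2_norm M (\<lambda>x. g s x - g' x)"
    using ev
  proof eventually_elim
    case (elim s)
    then show ?case
      using l2_norm_triangle[OF sq_int_diff[OF elim(1) lim(1)] sq_int_diff[OF elim(2) lim(2)]]
      by (simp add: algebra_simps)
  qed
qed

text \<open>The scalar may move as well: this is needed for the Kirchhoff coefficient
  \<open>a * D s + b\<close>, which depends on time, and for the factor \<open>s - t\<close> in
  front of difference quotients.\<close>

lemma l2_tendsto_scale_fun:
  assumes f: "l2_tendsto M f f' F" and c: "(c \<longlongrightarrow> d) F"
  shows "l2_tendsto M (\<lambda>s x. c s * f s x) (\<lambda>x. d * f' x) F"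
proof (rule l2_tendstoI)
  have ev: "\<forall>\<^sub>F s in F. f s \<in> sq_int M" and f': "f' \<in> sq_int M"
    using f by (auto simp: l2_tendsto_def)
  show "\<forall>\<^sub>F s in F. (\<lambda>x. c s * f s x) \<in> sq_int M"
    using ev by eventually_elim (rule sq_int_scale)
  show "(\<lambda>x. d * f' x) \<in> sq_int M" using f' by (rule sq_int_scale)
  have "((\<lambda>s. \<bar>c s\<bar> * l2_norm M (\<lambda>x. f s x - f' x) + \<bar>c s - d\<bar> * l2_norm M f') \<longlongrightarrow>
      \<bar>d\<bar> * 0 + \<bar>d - d\<bar> * l2_norm M f') F"
    using f by (intro tendsto_intros c) (simp add: l2_tendsto_def)
  then show "((\<lambda>s. \<bar>c s\<bar> * l2_norm M (\<lambda>x. f s x - f' x) + \<bar>c s - d\<bar> * l2_norm M f') \<longlongrightarrow> 0) F"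
    by simp
  show "\<forall>\<^sub>F s in F. l2_norm M (\<lambda>x. c s * f s x - d * f' x) \<le>
      \<bar>c s\<bar> * l2_norm M (\<lambda>x. f s x - f' x) + \<bar>c s - d\<bar> * l2_norm M f'"
    using ev
  proof eventually_elim
    case (elim s)
    have "(\<lambda>x. c s * f s x - d * f' x) = (\<lambda>x. c s * (f s x - f' x) + (c s - d) * f' x)"
      by (auto simp: algebra_simps)
    then show ?case
      using l2_norm_triangle[OF sq_int_scale[OF sq_int_diff[OF elim f']] sq_int_scale[OF f'],
          of "c s" "c s - d"]
      by (simp add: l2_norm_scale)
  qed
qed

lemma l2_tendsto_scale: "l2_tendsto M f f' F \<Longrightarrow> l2_tendsto M (\<lambda>s x. c * f s x) (\<lambda>x. c * f' x) F"
  by (rule l2_tendsto_scale_fun) auto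

lemma l2_tendsto_diff:
  assumes "l2_tendsto M f f' F" "l2_tendsto M g g' F"
  shows "l2_tendsto M (\<lambda>s x. f s x - g s x) (\<lambda>x. f' x - g' x) F"
  using l2_tendsto_add[OF assms(1) l2_tendsto_scale[OF assms(2), of "-1"]] by simp

lemma l2_tendsto_sum:
  "(\<And>i. i \<in> B \<Longrightarrow> l2_tendsto M (f i) (g i) F) \<Longrightarrow>
     l2_tendsto M (\<lambda>s x. \<Sum>i\<in>B. f i s x) (\<lambda>x. \<Sum>i\<in>B. g i x) F"
proof (induction B rule: infinite_finite_induct)
  case (insert i B)
  then show ?case
    using l2_tendsto_add[of M "f i" "g i" F "\<lambda>s x. \<Sum>i\<in>B. f i s x" "\<lambda>x. \<Sum>i\<in>B. g i x"] by simp
qed (auto intro!: l2_tendsto_const simp: sq_int_def)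

text \<open>The constant family \<open>f s - f s = 0\<close> converges to \<open>g - h\<close>, so
  the norm of \<open>g - h\<close> is 0.\<close>

lemma l2_tendsto_unique:
  assumes "l2_tendsto M f g F" "l2_tendsto M f h F" "F \<noteq> bot"
  shows "AE x in M. g x = h x"
proof -
  have gh: "(\<lambda>x. g x - h x) \<in> sq_int M"
    using assms by (auto simp: l2_tendsto_def intro: sq_int_diff)
  have "l2_tendsto M (\<lambda>s x. f s x - f s x) (\<lambda>x. g x - h x) F"
    using assms(1,2) by (rule l2_tendsto_diff)
  then have "((\<lambda>s. l2_norm M (\<lambda>x. g x - h x)) \<longlongrightarrow> 0) F"
    using l2_norm_minus_commute[of M "\<lambda>_. 0" "\<lambda>x. g x - h x"] by (simp add: l2_tendsto_def)
  then have "l2_norm M (\<lambda>x. g x - h x) = 0"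
    using \<open>F \<noteq> bot\<close> tendsto_unique tendsto_const by blast
  then show ?thesis using l2_norm_eq_0_iff[OF gh] by simp
qed

text \<open>The squared errors tend to 0 in L1, so a subsequence of them does so pointwise a.e. This
  serves Fatou's lemma and the passage to time zero, where nonlinear functions of the limit have to
  be identified.\<close>

lemma l2_tendsto_AE_subseq:
  fixes f :: "nat \<Rightarrow> 'a \<Rightarrow> real"
  assumes "l2_tendsto M f g sequentially"
  shows "\<exists>r. strict_mono r \<and> (AE x in M. (\<lambda>n. f (r n) x) \<longlonglongrightarrow> g x)"
proof -
  \<comment> \<open>Square integrability holds only eventually, so the sequence is shifted by
    \<open>N\<close>; the shift is absorbed into the subsequence at the end.\<close>
  obtain N where N: "\<And>n. n \<ge> N \<Longrightarrow> f n \<in> sq_int M"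
    using assms by (auto simp: l2_tendsto_def eventually_sequentially)
  have g: "g \<in> sq_int M" using assms by (simp add: l2_tendsto_def)
  define h where "h n x = (f (n + N) x - g x)\<^sup>2" for n x
  have "(\<lambda>x. f (n + N) x - g x) \<in> sq_int M" for n using N g by (intro sq_int_diff) auto
  then have h_int: "integrable M (h n)" for n by (simp add: sq_int_def h_def[abs_def])
  have "(\<lambda>n. (l2_norm M (\<lambda>x. f (n + N) x - g x))\<^sup>2) \<longlonglongrightarrow> 0\<^sup>2"
    using assms by (intro tendsto_power LIMSEQ_ignore_initial_segment) (simp add: l2_tendsto_def)
  then have "(\<lambda>n. LINT x|M. norm (h n x)) \<longlonglongrightarrow> 0"
    unfolding l2_norm_power2 l2_inner_def by (simp add: h_def power2_eq_square)
  then obtain r where r: "strict_mono r" "AE x in M. (\<lambda>n. h (r n) x) \<longlonglongrightarrow> 0"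
    using tendsto_L1_AE_subseq[of M h] h_int by blast
  have "AE x in M. (\<lambda>n. f (r n + N) x) \<longlonglongrightarrow> g x"
    using r(2)
  proof eventually_elim
    case (elim x)
    then have "(\<lambda>n. sqrt (h (r n) x)) \<longlonglongrightarrow> sqrt 0" by (rule tendsto_real_sqrt)
    then have "(\<lambda>n. f (r n + N) x - g x) \<longlonglongrightarrow> 0" by (simp add: h_def tendsto_rabs_zero_iff)
    then show ?case by (simp add: LIM_zero_iff)
  qed
  moreover have "strict_mono (\<lambda>n. r n + N)" using r(1) by (auto simp: strict_mono_def)
  ultimately show ?thesis by blast
qed

text \<open>Membership of \<open>f t\<close> is stated separately because a difference of two
  functions can be square integrable although neither of them is.\<close>

definition l2_deriv :: "'a measure \<Rightarrow> (real \<Rightarrow> 'a \<Rightarrow> real) \<Rightarrow> ('a \<Rightarrow> real) \<Rightarrow> real \<Rightarrow> real set \<Rightarrow> bool"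
  where "l2_deriv M f g t S \<longleftrightarrow> f t \<in> sq_int M \<and>
     l2_tendsto M (\<lambda>s x. (f s x - f t x) / (s - t)) g (at t within S)"

lemma l2_deriv_tendsto:
  assumes "l2_deriv M f g t S" "\<And>s. s \<in> S \<Longrightarrow> f s \<in> sq_int M"
  shows "l2_tendsto M f (f t) (at t within S)"
proof -
  have t: "f t \<in> sq_int M" using assms by (simp add: l2_deriv_def)
  have "((\<lambda>s. s - t) \<longlongrightarrow> t - t) (at t within S)" by (intro tendsto_intros)
  then have "l2_tendsto M (\<lambda>s x. (s - t) * ((f s x - f t x) / (s - t)) + f t x) (\<lambda>x. (t - t) * g x + f t x)
      (at t within S)"
    using assms t by (intro l2_tendsto_add l2_tendsto_scale_fun l2_tendsto_const)
      (auto simp: l2_deriv_def)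
  \<comment> \<open>At \<open>s = t\<close> the factor \<open>s - t\<close> is 0 whatever the
    quotient means, so this is an identity for every \<open>s\<close>.\<close>
  moreover have "(\<lambda>s x. (s - t) * ((f s x - f t x) / (s - t)) + f t x) = f"
    by (intro ext) auto
  ultimately show ?thesis by simp
qed

text \<open>In the Leibniz splitting the quotient of \<open>f\<close> is paired with
  \<open>g s\<close>, not with \<open>g t\<close>, so the continuity that follows from
  differentiability of \<open>g\<close> is used too.\<close>

lemma l2_deriv_inner:
  assumes f: "l2_deriv M f f' t S" and g: "l2_deriv M g g' t S"
    and f_sq: "\<And>s. s \<in> S \<Longrightarrow> f s \<in> sq_int M" and g_sq: "\<And>s. s \<in> S \<Longrightarrow> g s \<in> sq_int M"
  shows "((\<lambda>s. l2_inner M (f s) (g s)) has_real_derivative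
     (l2_inner M f' (g t) + l2_inner M (f t) g')) (at t within S)"
proof -
  have ft: "f t \<in> sq_int M" and gt: "g t \<in> sq_int M" using f g by (auto simp: l2_deriv_def)
  have "((\<lambda>s. l2_inner M (\<lambda>x. (f s x - f t x) / (s - t)) (g s) +
          l2_inner M (f t) (\<lambda>x. (g s x - g t x) / (s - t))) \<longlongrightarrow>
      l2_inner M f' (g t) + l2_inner M (f t) g') (at t within S)"
    using f g ft by (intro tendsto_add l2_tendsto_inner l2_tendsto_const
        l2_deriv_tendsto[OF g] g_sq) (auto simp: l2_deriv_def)
  moreover have "\<forall>\<^sub>F s in at t within S.
      l2_inner M (\<lambda>x. (f s x - f t x) / (s - t)) (g s) +
        l2_inner M (f t) (\<lambda>x. (g s x - g t x) / (s - t)) =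
      (l2_inner M (f s) (g s) - l2_inner M (f t) (g t)) / (s - t)"
    unfolding eventually_at_filter
  proof (intro always_eventually allI impI)
    fix s assume "s \<noteq> t" "s \<in> S"
    then have fs: "f s \<in> sq_int M" and gs: "g s \<in> sq_int M" using f_sq g_sq by auto
    have "l2_inner M (\<lambda>x. (f s x - f t x) / (s - t)) (g s) =
        (l2_inner M (f s) (g s) - l2_inner M (f t) (g s)) / (s - t)"
      using l2_inner_scale_left[of M "1 / (s - t)" "\<lambda>x. f s x - f t x" "g s"] fs ft gs
      by (simp add: l2_inner_diff_left)
    moreover have "l2_inner M (f t) (\<lambda>x. (g s x - g t x) / (s - t)) =
        (l2_inner M (f t) (g s) - l2_inner M (f t) (g t)) / (s - t)"
      using l2_inner_scale_right[of M "f t" "1 / (s - t)" "\<lambda>x. g s x - g t x"] gt ft gs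
      by (simp add: l2_inner_diff_right)
    ultimately show "l2_inner M (\<lambda>x. (f s x - f t x) / (s - t)) (g s) +
        l2_inner M (f t) (\<lambda>x. (g s x - g t x) / (s - t)) =
      (l2_inner M (f s) (g s) - l2_inner M (f t) (g t)) / (s - t)"
      by (simp add: diff_divide_distrib)
  qed
  ultimately show ?thesis
    unfolding has_field_derivative_iff by (rule Lim_transform_eventually)
qed

lemma sq_int_cong_AE:
  assumes "f \<in> sq_int M" "g \<in> borel_measurable M" "AE x in M. g x = f x"
  shows "g \<in> sq_int M"
proof -
  have "AE x in M. (g x)\<^sup>2 = (f x)\<^sup>2" using assms(3) by eventually_elim simp
  then have "integrable M (\<lambda>x. (g x)\<^sup>2) \<longleftrightarrow> integrable M (\<lambda>x. (f x)\<^sup>2)"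
    using assms by (intro integrable_cong_AE) (auto simp: sq_int_def)
  then show ?thesis using assms by (simp add: sq_int_def)
qed

lemma l2_tendsto_cong_AE:
  assumes "l2_tendsto M f g F" "h \<in> borel_measurable M" "AE x in M. h x = g x"
  shows "l2_tendsto M f h F"
proof -
  have g: "g \<in> sq_int M" and f: "\<forall>\<^sub>F s in F. f s \<in> sq_int M"
    using assms by (auto simp: l2_tendsto_def)
  have h: "h \<in> sq_int M" using sq_int_cong_AE[OF g assms(2,3)] .
  have "\<forall>\<^sub>F s in F. l2_norm M (\<lambda>x. f s x - g x) = l2_norm M (\<lambda>x. f s x - h x)"
    using f
  proof eventually_elim
    case (elim s)
    have "AE x in M. f s x - g x = f s x - h x" using assms(3) by eventually_elim simp
    then show ?case
      using sq_int_diff[OF elim g] sq_int_diff[OF elim h]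
      by (intro l2_norm_cong_AE) (auto dest: sq_int_measurable)
  qed
  then show ?thesis
    using assms(1) f h unfolding l2_tendsto_def by (auto elim: Lim_transform_eventually)
qed

lemma l2_tendsto_compose:
  "l2_tendsto M f g F \<Longrightarrow> filterlim h F G \<Longrightarrow> l2_tendsto M (\<lambda>s. f (h s)) g G"
  unfolding l2_tendsto_def
  by (auto elim: filterlim_compose eventually_compose_filterlim)

lemma l2_tendsto_cong_AE_eventually:
  assumes "l2_tendsto M f g F" "\<forall>\<^sub>F s in F. h s \<in> sq_int M \<and> (AE x in M. f s x = h s x)"
  shows "l2_tendsto M h g F"
proof -
  have g: "g \<in> sq_int M" and f: "\<forall>\<^sub>F s in F. f s \<in> sq_int M"
    using assms by (auto simp: l2_tendsto_def)
  have "\<forall>\<^sub>F s in F. l2_norm M (\<lambda>x. f s x - g x) = l2_norm M (\<lambda>x. h s x - g x)"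
    using f assms(2)
  proof eventually_elim
    case (elim s)
    have "AE x in M. f s x - g x = h s x - g x" using elim(2) by auto
    then show ?case
      using sq_int_diff[OF elim(1) g] sq_int_diff[of "h s" M g] elim(2) g
      by (intro l2_norm_cong_AE) (auto dest: sq_int_measurable)
  qed
  moreover have "\<forall>\<^sub>F s in F. h s \<in> sq_int M" using assms(2) by eventually_elim simp
  ultimately show ?thesis
    using assms(1) g unfolding l2_tendsto_def by (auto elim: Lim_transform_eventually)
qed

lemma eventually_at_withinI: "(\<And>s. s \<in> S \<Longrightarrow> s \<noteq> t \<Longrightarrow> P s) \<Longrightarrow> eventually P (at t within S)"
  unfolding eventually_at_filter by (intro always_eventually) blast

text \<open>A solution carries two pairs of time derivatives, one from its function space and one
  from the equation. This identifies them; it allows the differentiated curves to agree only a.e.,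
  as is the case when second derivatives are compared.\<close>

lemma l2_deriv_unique_AE:
  assumes "l2_deriv M f g t S" "l2_deriv M f' g' t S" "at t within S \<noteq> bot" "t \<in> S"
    "\<And>s. s \<in> S \<Longrightarrow> AE x in M. f s x = f' s x"
    "\<And>s. s \<in> S \<Longrightarrow> f' s \<in> sq_int M"
  shows "AE x in M. g x = g' x"
proof -
  have "l2_tendsto M (\<lambda>s x. (f' s x - f' t x) / (s - t)) g (at t within S)"
  proof (rule l2_tendsto_cong_AE_eventually)
    show "l2_tendsto M (\<lambda>s x. (f s x - f t x) / (s - t)) g (at t within S)"
      using assms(1) by (simp add: l2_deriv_def)
    show "\<forall>\<^sub>F s in at t within S. (\<lambda>x. (f' s x - f' t x) / (s - t)) \<in> sq_int M \<and>
        (AE x in M. (f s x - f t x) / (s - t) = (f' s x - f' t x) / (s - t))"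
    proof (rule eventually_at_withinI, rule conjI)
      fix s assume s: "s \<in> S"
      show "(\<lambda>x. (f' s x - f' t x) / (s - t)) \<in> sq_int M"
        using sq_int_scale[OF sq_int_diff[OF assms(6)[OF s] assms(6)[OF assms(4)]], of "1 / (s - t)"] by simp
      show "AE x in M. (f s x - f t x) / (s - t) = (f' s x - f' t x) / (s - t)"
        using assms(5)[OF s] assms(5)[OF assms(4)] by eventually_elim simp
    qed
  qed
  then show ?thesis
    using assms(2,3) by (auto simp: l2_deriv_def intro: l2_tendsto_unique)
qed

section \<open>Test functions and the fundamental lemma of the calculus of variations\<close>

lemma Ck_on_SucI:
  assumes "\<And>x. (f has_derivative f' x) (at x)"
    and "\<And>i. i \<in> Basis \<Longrightarrow> Ck_on k UNIV (\<lambda>x. f' x i)"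
  shows "Ck_on (Suc k) UNIV f"
proof -
  have "frechet_derivative f (at x) = f' x" for x
    using frechet_derivative_at[OF assms(1)] by simp
  then show ?thesis using assms by (auto simp: differentiable_def)
qed

lemma Ck_on_SucD:
  assumes "Ck_on (Suc k) UNIV f"
  shows "(f has_derivative frechet_derivative f (at x)) (at x)"
    and "i \<in> Basis \<Longrightarrow> Ck_on k UNIV (\<lambda>x. frechet_derivative f (at x) i)"
  using assms by (auto simp flip: frechet_derivative_works)

text \<open>The product rule pairs a derivative with an undifferentiated factor, which must then be
  read at the lower order.\<close>

lemma Ck_on_decrease: "Ck_on (Suc k) UNIV f \<Longrightarrow> Ck_on k UNIV f"
proof (induction k arbitrary: f)
  case 0
  then show ?case
    by (auto intro!: continuous_at_imp_continuous_on differentiable_imp_continuous_within)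
next
  case (Suc k)
  then show ?case
    using Ck_on.simps(2)[of "Suc k" UNIV f] Ck_on.simps(2)[of k UNIV f] by blast
qed

lemma Ck_on_const: "Ck_on k UNIV (\<lambda>_. c)"
proof (induction k arbitrary: c)
  case (Suc k)
  show ?case by (rule Ck_on_SucI[where f' = "\<lambda>_ _. 0"]) (use Suc in auto)
qed auto

lemma Ck_on_add: "Ck_on k UNIV f \<Longrightarrow> Ck_on k UNIV g \<Longrightarrow> Ck_on k UNIV (\<lambda>x. f x + g x)"
proof (induction k arbitrary: f g)
  case (Suc k)
  show ?case
  proof (rule Ck_on_SucI)
    show "((\<lambda>x. f x + g x) has_derivative
        (\<lambda>i. frechet_derivative f (at x) i + frechet_derivative g (at x) i)) (at x)" for x
      by (intro has_derivative_add Ck_on_SucD(1)[OF Suc.prems(1)] Ck_on_SucD(1)[OF Suc.prems(2)])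
  qed (use Suc Ck_on_SucD(2) in blast)
qed (auto intro: continuous_intros)

lemma Ck_on_mult: "Ck_on k UNIV f \<Longrightarrow> Ck_on k UNIV g \<Longrightarrow> Ck_on k UNIV (\<lambda>x. f x * g x)"
proof (induction k arbitrary: f g)
  case (Suc k)
  show ?case
  proof (rule Ck_on_SucI)
    show "((\<lambda>x. f x * g x) has_derivative
        (\<lambda>i. f x * frechet_derivative g (at x) i + frechet_derivative f (at x) i * g x)) (at x)" for x
      by (intro has_derivative_mult Ck_on_SucD(1)[OF Suc.prems(1)] Ck_on_SucD(1)[OF Suc.prems(2)])
    show "Ck_on k UNIV (\<lambda>x. f x * frechet_derivative g (at x) i + frechet_derivative f (at x) i * g x)"
      if "i \<in> Basis" for i
      using Suc.prems that by (intro Ck_on_add Suc.IH Ck_on_decrease[of k f] Ck_on_decrease[of k g])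
        (auto dest: Ck_on_SucD(2))
  qed
qed (auto intro: continuous_intros)

lemma Ck_on_prod: "(\<And>i. i \<in> B \<Longrightarrow> Ck_on k UNIV (f i)) \<Longrightarrow> Ck_on k UNIV (\<lambda>x. \<Prod>i\<in>B. f i x)"
  by (induction B rule: infinite_finite_induct) (auto intro: Ck_on_const Ck_on_mult)

text \<open>Differentiation in direction \<open>j\<close> advances \<open>D\<close> by one index and
  produces the factor \<open>s * (j \<bullet> i)\<close>; hence the induction generalises over
  \<open>c\<close> and \<open>n\<close>.\<close>

lemma Ck_on_real_compose:
  assumes "\<And>n t. (D n has_real_derivative D (Suc n) t) (at t)"
  shows "Ck_on k UNIV (\<lambda>x. c * D n (s * (x \<bullet> i) + r))"
proof (induction k arbitrary: c n)
  case 0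
  have "continuous_on UNIV (D n)" using assms
    by (auto intro!: continuous_at_imp_continuous_on DERIV_isCont)
  then show ?case
    by (auto intro!: continuous_intros continuous_on_compose2[of UNIV "D n"])
next
  case (Suc k)
  show ?case
  proof (rule Ck_on_SucI)
    fix x :: 'a
    have "((\<lambda>x. s * (x \<bullet> i) + r) has_derivative (\<lambda>j. s * (j \<bullet> i))) (at x)"
      by (auto intro!: derivative_eq_intros)
    from has_derivative_compose[OF this assms[of n, unfolded has_field_derivative_def]]
    show "((\<lambda>x. c * D n (s * (x \<bullet> i) + r)) has_derivative
        (\<lambda>j. c * (D (Suc n) (s * (x \<bullet> i) + r) * (s * (j \<bullet> i))))) (at x)"
      by (rule has_derivative_mult_right)
  next
    fix j :: 'a
    show "Ck_on k UNIV (\<lambda>x. c * (D (Suc n) (s * (x \<bullet> i) + r) * (s * (j \<bullet> i))))"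
      using Suc.IH[of "c * (s * (j \<bullet> i))" "Suc n"] by (simp add: ac_simps)
  qed
qed

section \<open>Smooth bumps that approximate the indicator of a box\<close>

lemma poly_div_exp_tendsto_0: "((\<lambda>x::real. poly q x / exp x) \<longlongrightarrow> 0) at_top"
  unfolding poly_altdef sum_divide_distrib
  using tendsto_mult_right_zero[OF tendsto_power_div_exp_0]
  by (intro tendsto_null_sum) (simp flip: times_divide_eq_right)

text \<open>The functions \<open>p (1/t) exp (-1/t)\<close>, extended by zero to \<open>t \<le> 0\<close>, are closed under
  differentiation.\<close>

definition flat_fun :: "real poly \<Rightarrow> real \<Rightarrow> real" where
  "flat_fun p t = (if 0 < t then poly p (1 / t) * exp (- (1 / t)) else 0)"

text \<open>For positive \<open>t\<close> the chain rule turns \<open>p\<close> into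
  \<open>p - pderiv p\<close> and brings out \<open>1 / t^2\<close>, that is, multiplication by the
  polynomial \<open>[:0, 0, 1:]\<close>. At 0 exponential decay beats every polynomial.\<close>

lemma flat_fun_deriv:
  "(flat_fun p has_real_derivative flat_fun ([:0, 0, 1:] * (p - pderiv p)) t) (at t)"
proof -
  consider "t > 0" | "t < 0" | "t = 0" by linarith
  then show ?thesis
  proof cases
    case 1
    have "((\<lambda>t. poly p (1 / t) * exp (- (1 / t))) has_real_derivative
        flat_fun ([:0, 0, 1:] * (p - pderiv p)) t) (at t)"
      using 1 by (auto intro!: derivative_eq_intros DERIV_chain2[OF poly_DERIV]
          simp: flat_fun_def power2_eq_square field_simps)
    then show ?thesis
      by (rule has_field_derivative_transform_within_open[where S = "{0<..}"])
        (use 1 in \<open>auto simp: flat_fun_def\<close>)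
  next
    case 2
    have "((\<lambda>t. 0) has_real_derivative flat_fun ([:0, 0, 1:] * (p - pderiv p)) t) (at t)"
      using 2 by (simp add: flat_fun_def)
    then show ?thesis
      by (rule has_field_derivative_transform_within_open[where S = "{..<0}"])
        (use 2 in \<open>auto simp: flat_fun_def\<close>)
  next
    case 3
    \<comment> \<open>With \<open>x = 1 / s\<close> the quotient \<open>flat_fun p s / s\<close> is
      \<open>x * poly p x / exp x\<close>, and \<open>pCons 0 p\<close> is the polynomial
      \<open>x * p\<close>.\<close>
    have "((\<lambda>s. poly (pCons 0 p) (inverse s) / exp (inverse s)) \<longlongrightarrow> 0) (at_right (0::real))"
      by (rule filterlim_compose[OF poly_div_exp_tendsto_0 filterlim_inverse_at_top_right])
    then have right: "((\<lambda>s. flat_fun p s / s) \<longlongrightarrow> 0) (at_right 0)"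
      by (rule Lim_transform_eventually)
        (auto simp: flat_fun_def eventually_at_filter exp_minus field_simps)
    have "((\<lambda>s. flat_fun p s / s) \<longlongrightarrow> 0) (at_left 0)"
      by (rule tendsto_eventually) (auto simp: flat_fun_def eventually_at_filter)
    with right have "((\<lambda>s. flat_fun p s / s) \<longlongrightarrow> 0) (at 0)" by (simp add: filterlim_split_at)
    then show ?thesis using 3 by (simp add: has_field_derivative_iff flat_fun_def)
  qed
qed

lemma flat_fun_bounds: "0 \<le> flat_fun 1 t" "flat_fun 1 t \<le> 1"
  by (auto simp: flat_fun_def)

lemma flat_fun_seq:
  "(\<lambda>n. flat_fun 1 (real n * t)) \<longlonglongrightarrow> (if 0 < t then 1 else 0)"
proof (cases "0 < t")
  case True
  have "(\<lambda>n. 1 / t * inverse (real n)) \<longlonglongrightarrow> 1 / t * 0"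
    by (intro tendsto_intros lim_inverse_n)
  then have "(\<lambda>n. exp (- (1 / t * inverse (real n)))) \<longlonglongrightarrow> exp (- 0)"
    by (intro tendsto_exp tendsto_minus) simp
  then show ?thesis using True
    by (auto elim!: Lim_transform_eventually intro!: eventually_sequentiallyI[of 1]
        simp: flat_fun_def field_simps)
next
  case False
  then have "\<not> 0 < real n * t" for n by (auto simp: zero_less_mult_iff)
  then show ?thesis using False by (simp add: flat_fun_def)
qed

lemma Cinf_on_flat_fun: "Cinf_on UNIV (\<lambda>x. flat_fun p (s * (x \<bullet> i) + r))"
proof -
  define D where "D n = flat_fun (((\<lambda>p. [:0, 0, 1:] * (p - pderiv p)) ^^ n) p)" for n
  have deriv: "(D n has_real_derivative D (Suc n) t) (at t)" for n t
    using flat_fun_deriv[of "((\<lambda>p. [:0, 0, 1:] * (p - pderiv p)) ^^ n) p" t] by (simp add: D_def)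
  have "Ck_on k UNIV (\<lambda>x. 1 * D 0 (s * (x \<bullet> i) + r))" for k
    by (rule Ck_on_real_compose) (rule deriv)
  then show ?thesis by (simp add: Cinf_on_def D_def)
qed

text \<open>For \<open>n \<ge> 1\<close> the bump is positive exactly on the open box. Increasing
  \<open>n\<close> steepens it without enlarging its support, so the bumps increase towards the
  indicator of the open box while one closed box supports them all.\<close>

definition box_bump :: "'a::euclidean_space \<Rightarrow> 'a \<Rightarrow> nat \<Rightarrow> 'a \<Rightarrow> real" where
  "box_bump l u n x = (\<Prod>i\<in>Basis. flat_fun 1 (real n * (x \<bullet> i - l \<bullet> i)) *
     flat_fun 1 (real n * (u \<bullet> i - x \<bullet> i)))"

lemma box_bump_test_function:
  assumes "cbox l u \<subseteq> \<Omega>"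
  shows "box_bump l u n \<in> test_functions \<Omega>"
proof -
  have "Cinf_on UNIV (\<lambda>x. flat_fun 1 (real n * (x \<bullet> i - l \<bullet> i)))"
    "Cinf_on UNIV (\<lambda>x. flat_fun 1 (real n * (u \<bullet> i - x \<bullet> i)))" for i
    using Cinf_on_flat_fun[of 1 "real n" i "- real n * (l \<bullet> i)"]
      Cinf_on_flat_fun[of 1 "- real n" i "real n * (u \<bullet> i)"] by (simp_all add: algebra_simps)
  then have "Cinf_on UNIV (box_bump l u n)"
    unfolding Cinf_on_def box_bump_def[abs_def] by (intro allI Ck_on_prod Ck_on_mult) auto
  moreover have "box_bump l u n x = 0" if x: "x \<notin> cbox l u" for x
  proof -
    obtain i where i: "i \<in> Basis" "x \<bullet> i < l \<bullet> i \<or> u \<bullet> i < x \<bullet> i"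
      using x by (auto simp: mem_box not_le)
    have "flat_fun 1 (real n * (x \<bullet> i - l \<bullet> i)) * flat_fun 1 (real n * (u \<bullet> i - x \<bullet> i)) = 0"
      using i(2) by (auto simp: flat_fun_def zero_less_mult_iff)
    then show ?thesis unfolding box_bump_def using i(1) by (intro prod_zero) auto
  qed
  ultimately show ?thesis
    unfolding test_functions_def using assms compact_cbox by blast
qed

lemma box_bump_bounds: "\<bar>box_bump l u n x\<bar> \<le> 1"
  unfolding box_bump_def
  by (subst abs_of_nonneg) (auto intro!: prod_nonneg prod_le_1 mult_nonneg_nonneg mult_le_one
      flat_fun_bounds)

lemma box_bump_seq: "(\<lambda>n. box_bump l u n x) \<longlonglongrightarrow> indicator (box l u) x"
proof -
  have "(\<lambda>n. box_bump l u n x) \<longlonglongrightarrow>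
      (\<Prod>i\<in>Basis. (if 0 < x \<bullet> i - l \<bullet> i then 1 else 0) * (if 0 < u \<bullet> i - x \<bullet> i then 1 else 0))"
    unfolding box_bump_def by (intro tendsto_prod tendsto_mult flat_fun_seq)
  also have "(\<Prod>i\<in>Basis. (if 0 < x \<bullet> i - l \<bullet> i then 1 else 0) * (if 0 < u \<bullet> i - x \<bullet> i then 1 else 0)) =
      (indicator (box l u) x :: real)"
  proof (cases "x \<in> box l u")
    case True
    then show ?thesis by (auto simp: mem_box intro!: prod.neutral)
  next
    case False
    then obtain i where "i \<in> Basis" "\<not> (l \<bullet> i < x \<bullet> i \<and> x \<bullet> i < u \<bullet> i)" by (auto simp: mem_box)
    then show ?thesis using False by (auto intro!: prod_zero)
  qed
  finally show ?thesis .
qed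

lemma test_function_continuous: "\<phi> \<in> test_functions \<Omega> \<Longrightarrow> continuous_on UNIV \<phi>"
  by (auto simp: test_functions_def Cinf_on_def dest!: spec[of _ 0])

text \<open>Lebesgue differentiation: for almost every \<open>x\<close> the averages of
  \<open>w\<close> over shrinking cubes with lower corner \<open>x\<close> tend to
  \<open>w x\<close>, and here all of them are 0.\<close>

lemma AE_zero_if_box_integrals_zero:
  fixes w :: "'a::euclidean_space \<Rightarrow> real"
  assumes w: "integrable lebesgue w" and zero: "\<And>l u. (LINT x:cbox l u|lebesgue. w x) = 0"
  shows "AE x in lebesgue. w x = 0"
proof -
  have si: "set_integrable lebesgue (cbox l u) w" for l u
    using w set_integrable_subset[of lebesgue UNIV w "cbox l u"] by (simp add: set_integrable_def)
  have int: "w integrable_on cbox l u" and int0: "integral (cbox l u) w = 0" for l u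
    using set_lebesgue_integral_eq_integral[OF si[of l u]] zero[of l u] by auto
  obtain N where N: "negligible N"
    "\<And>x e. \<lbrakk>x \<notin> N; 0 < e\<rbrakk> \<Longrightarrow> \<exists>d>0. \<forall>h. 0 < h \<and> h < d \<longrightarrow>
        norm (integral (cbox x (x + h *\<^sub>R One)) w /\<^sub>R h ^ DIM('a) - w x) < e"
    using integrable_ccontinuous_explicit[OF int] by blast
  have "w x = 0" if x: "x \<notin> N" for x
  proof (rule ccontr)
    assume "w x \<noteq> 0"
    then obtain d where "d > 0" "\<forall>h. 0 < h \<and> h < d \<longrightarrow>
        norm (integral (cbox x (x + h *\<^sub>R One)) w /\<^sub>R h ^ DIM('a) - w x) < \<bar>w x\<bar>"
      using N(2)[OF x, of "\<bar>w x\<bar>"] by auto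
    then have "norm (integral (cbox x (x + (d/2) *\<^sub>R One)) w /\<^sub>R (d/2) ^ DIM('a) - w x) < \<bar>w x\<bar>"
      by (metis field_sum_of_halves half_gt_zero less_add_same_cancel1)
    then show False by (simp add: int0)
  qed
  then show ?thesis
    using N(1) by (intro AE_I'[of N]) (auto simp: negligible_iff_null_sets)
qed

lemma AE_lebesgue_on_iff:
  "S \<in> sets lebesgue \<Longrightarrow> (AE x in lebesgue_on S. P x) \<longleftrightarrow> (AE x in lebesgue. x \<in> S \<longrightarrow> P x)"
  by (intro AE_restrict_space_iff) auto

lemma integral_lebesgue_on:
  fixes f :: "'a::euclidean_space \<Rightarrow> real"
  shows "S \<in> sets lebesgue \<Longrightarrow> (LINT x|lebesgue_on S. f x) = (LINT x|lebesgue. indicator S x * f x)"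
  by (simp add: integral_restrict_space)

lemma integrable_lebesgue_on:
  fixes f :: "'a::euclidean_space \<Rightarrow> real"
  shows "S \<in> sets lebesgue \<Longrightarrow>
     integrable (lebesgue_on S) f \<longleftrightarrow> integrable lebesgue (\<lambda>x. indicator S x * f x)"
  by (simp add: integrable_restrict_space)

text \<open>Testing with bumps and dominated convergence give vanishing integrals over closed boxes
  inside \<Omega>, whose boundaries are null. As \<open>v\<close> is only locally integrable,
  Lebesgue differentiation is applied to its truncations to the boxes of a countable cover.\<close>

proposition fundamental_lemma_calculus_of_variations:
  fixes \<Omega> :: "'a::euclidean_space set"
  assumes "open \<Omega>" and v: "v \<in> L1_loc \<Omega>"
    and zero: "\<And>\<phi>. \<phi> \<in> test_functions \<Omega> \<Longrightarrow> (LINT x|lebesgue_on \<Omega>. v x * \<phi> x) = 0"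
  shows "AE x in lebesgue_on \<Omega>. v x = 0"
proof -
  have \<Omega>: "\<Omega> \<in> sets lebesgue" using \<open>open \<Omega>\<close> by auto
  have box0: "(LINT x:cbox l u|lebesgue. v x) = 0" if sub: "cbox l u \<subseteq> \<Omega>" for l u
  proof -
    have v_int: "integrable lebesgue (\<lambda>x. indicator (cbox l u) x * v x)"
      using v sub by (auto simp: L1_loc_def set_integrable_def)
    have bump0: "box_bump l u n x = 0" if "x \<notin> cbox l u" for n x
    proof -
      have "box_bump l u n \<in> test_functions (cbox l u)" by (rule box_bump_test_function) simp
      then show ?thesis using that by (auto simp: test_functions_def)
    qed
    have eq: "indicator (cbox l u) x * v x * box_bump l u n x = indicator \<Omega> x * (v x * box_bump l u n x)"
      for n x using sub bump0[of x n] by (auto simp: indicator_def)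
    have "(\<lambda>n. LINT x|lebesgue. indicator (cbox l u) x * v x * box_bump l u n x) \<longlonglongrightarrow>
        (LINT x|lebesgue. indicator (cbox l u) x * v x * indicator (box l u) x)"
    proof (rule integral_dominated_convergence)
      show "integrable lebesgue (\<lambda>x. norm (indicator (cbox l u) x * v x))"
        using v_int by (rule integrable_norm)
      have bump_meas: "box_bump l u n \<in> borel_measurable lebesgue" for n
        using test_function_continuous[OF box_bump_test_function[OF sub, of n]]
        by (intro measurable_completion) (simp add: borel_measurable_continuous_onI)
      show "(\<lambda>x. indicator (cbox l u) x * v x * box_bump l u n x) \<in> borel_measurable lebesgue" for n
        by (rule borel_measurable_times[OF borel_measurable_integrable[OF v_int] bump_meas])
      show "(\<lambda>x. indicator (cbox l u) x * v x * indicator (box l u) x) \<in> borel_measurable lebesgue"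
        by (rule borel_measurable_times[OF borel_measurable_integrable[OF v_int]])
          (simp add: borel_measurable_indicator)
      show "AE x in lebesgue. (\<lambda>n. indicator (cbox l u) x * v x * box_bump l u n x) \<longlonglongrightarrow>
          indicator (cbox l u) x * v x * indicator (box l u) x"
        by (intro always_eventually allI tendsto_mult tendsto_const box_bump_seq)
      show "AE x in lebesgue. norm (indicator (cbox l u) x * v x * box_bump l u n x) \<le>
          norm (indicator (cbox l u) x * v x)" for n
        using box_bump_bounds[of l u n]
        by (auto simp: abs_mult intro!: mult_left_le)
    qed
    moreover have "(LINT x|lebesgue. indicator (cbox l u) x * v x * box_bump l u n x) = 0" for n
      using zero[OF box_bump_test_function[OF sub, of n]] by (simp add: eq integral_lebesgue_on \<Omega>)
    ultimately have "(LINT x|lebesgue. indicator (cbox l u) x * v x * indicator (box l u) x) = 0"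
      by (simp add: LIMSEQ_const_iff)
    moreover have "(LINT x|lebesgue. indicator (cbox l u) x * v x * indicator (box l u) x) =
        (LINT x|lebesgue. indicator (cbox l u) x * v x)"
    proof (rule integral_cong_AE)
      have "negligible (cbox l u - box l u)"
        by (rule negligible_subset[OF negligible_frontier_interval[of l u]]) auto
      then show "AE x in lebesgue. indicator (cbox l u) x * v x * indicator (box l u) x =
          indicator (cbox l u) x * v x"
        by (intro AE_I'[of "cbox l u - box l u"]) (auto simp: negligible_iff_null_sets indicator_def)
      show "(\<lambda>x. indicator (cbox l u) x * v x * indicator (box l u) x) \<in> borel_measurable lebesgue"
        by (rule borel_measurable_times[OF borel_measurable_integrable[OF v_int]])
          (simp add: borel_measurable_indicator)
    qed (rule borel_measurable_integrable[OF v_int])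
    ultimately show ?thesis by (simp add: set_lebesgue_integral_def)
  qed
  obtain \<D> where \<D>: "countable \<D>" "\<D> \<subseteq> Pow \<Omega>" "\<And>X. X \<in> \<D> \<Longrightarrow> \<exists>a b. X = cbox a b" "\<Union>\<D> = \<Omega>"
    using open_countable_Union_open_cbox[OF \<open>open \<Omega>\<close>] by blast
  have "AE x in lebesgue. x \<in> X \<longrightarrow> v x = 0" if XD: "X \<in> \<D>" for X
  proof -
    obtain a b where X: "X = cbox a b" using \<D>(3)[OF XD] by blast
    have "X \<subseteq> \<Omega>" using \<D>(2) XD by blast
    have "AE x in lebesgue. indicator X x * v x = 0"
    proof (rule AE_zero_if_box_integrals_zero)
      show "integrable lebesgue (\<lambda>x. indicator X x * v x)"
        using v \<open>X \<subseteq> \<Omega>\<close> by (auto simp: L1_loc_def set_integrable_def X)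
      fix l u :: 'a
      \<comment> \<open>The box \<open>cbox l u\<close> is arbitrary and may leave \<Omega>, but its
        intersection with \<open>X\<close> is again a box, now inside \<Omega>.\<close>
      have "(LINT x:cbox l u|lebesgue. indicator X x * v x) = (LINT x:(cbox a b \<inter> cbox l u)|lebesgue. v x)"
        by (auto simp: set_lebesgue_integral_def X indicator_inter_arith
            intro!: Bochner_Integration.integral_cong)
      also have "\<dots> = 0"
        using \<open>X \<subseteq> \<Omega>\<close> unfolding Int_interval X by (intro box0) (auto simp flip: Int_interval)
      finally show "(LINT x:cbox l u|lebesgue. indicator X x * v x) = 0" .
    qed
    then show ?thesis by eventually_elim (auto simp: indicator_def)
  qed
  then have "AE x in lebesgue. \<forall>X\<in>\<D>. x \<in> X \<longrightarrow> v x = 0"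
    unfolding AE_ball_countable[OF \<D>(1)] by (rule ballI)
  then show ?thesis
    unfolding AE_lebesgue_on_iff[OF \<Omega>] by eventually_elim (use \<D>(4) in blast)
qed

section \<open>Weak derivatives\<close>

lemma L2_eq_sq_int: "L2 \<Omega> = sq_int (lebesgue_on \<Omega>)"
  by (simp add: L2_def sq_int_def)

lemma L1_loc_integrable:
  "f \<in> L1_loc \<Omega> \<Longrightarrow> compact K \<Longrightarrow> K \<subseteq> \<Omega> \<Longrightarrow> integrable lebesgue (\<lambda>x. indicator K x * f x)"
  by (simp add: L1_loc_def set_integrable_def)

lemma L1_loc_add: "f \<in> L1_loc \<Omega> \<Longrightarrow> g \<in> L1_loc \<Omega> \<Longrightarrow> (\<lambda>x. f x + g x) \<in> L1_loc \<Omega>"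
  by (auto simp: L1_loc_def intro: set_integral_add)

lemma L1_loc_scale: "f \<in> L1_loc \<Omega> \<Longrightarrow> (\<lambda>x. c * f x) \<in> L1_loc \<Omega>"
  by (auto simp: L1_loc_def)

lemma L1_loc_diff: "f \<in> L1_loc \<Omega> \<Longrightarrow> g \<in> L1_loc \<Omega> \<Longrightarrow> (\<lambda>x. f x - g x) \<in> L1_loc \<Omega>"
  by (auto simp: L1_loc_def intro: set_integral_diff)

lemma L1_loc_cong_AE:
  assumes "\<Omega> \<in> sets lebesgue" "f \<in> L1_loc \<Omega>" "AE x in lebesgue_on \<Omega>. g x = f x"
  shows "g \<in> L1_loc \<Omega>"
proof -
  have "AE x in lebesgue. x \<in> \<Omega> \<longrightarrow> g x = f x" using assms by (simp add: AE_lebesgue_on_iff)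
  then obtain N where N: "N \<in> null_sets lebesgue" "{x. \<not> (x \<in> \<Omega> \<longrightarrow> g x = f x)} \<subseteq> N"
    unfolding completion.AE_iff_null_sets by auto
  show ?thesis
    unfolding L1_loc_def
  proof (intro CollectI allI impI)
    fix K assume K: "compact K" "K \<subseteq> \<Omega>"
    have "set_integrable lebesgue K f" using assms(2) K by (simp add: L1_loc_def)
    moreover have "negligible N" using N(1) by (simp add: negligible_iff_null_sets)
    moreover have "g x = f x" if "x \<in> K - N" for x using that K(2) N(2) by auto
    ultimately show "set_integrable lebesgue K g" by (rule absolutely_integrable_spike)
  qed
qed

text \<open>Local integrability yields measurability on compact subsets; countably many closed boxes
  exhaust \<Omega>.\<close>

lemma L1_loc_measurable:
  assumes "open \<Omega>" "f \<in> L1_loc \<Omega>"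
  shows "f \<in> borel_measurable (lebesgue_on \<Omega>)"
proof -
  obtain \<D> where \<D>: "countable \<D>" "\<D> \<subseteq> Pow \<Omega>" "\<And>X. X \<in> \<D> \<Longrightarrow> \<exists>a b. X = cbox a b" "\<Union>\<D> = \<Omega>"
    using open_countable_Union_open_cbox[OF \<open>open \<Omega>\<close>] by blast
  have \<Omega>: "\<Omega> \<in> sets lebesgue" using assms by auto
  have box: "compact X \<and> X \<subseteq> \<Omega>" if "X \<in> \<D>" for X using \<D>(2,3) that by fastforce
  show ?thesis
  proof (rule measurable_piecewise_restrict[OF \<D>(1)])
    show "X \<inter> space (lebesgue_on \<Omega>) \<in> sets (lebesgue_on \<Omega>)" if "X \<in> \<D>" for X
      using box[OF that] \<Omega> by (auto simp: sets_restrict_space lmeasurable_compact fmeasurableD)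
    show "space (lebesgue_on \<Omega>) \<subseteq> \<Union>\<D>" using \<D>(4) by simp
    show "f \<in> borel_measurable (restrict_space (lebesgue_on \<Omega>) X)" if "X \<in> \<D>" for X
    proof -
      have "X \<in> sets lebesgue" using box[OF that] by (simp add: lmeasurable_compact fmeasurableD)
      moreover have "(\<lambda>x. indicator X x *\<^sub>R f x) \<in> borel_measurable lebesgue"
        using L1_loc_integrable[OF assms(2)] box[OF that] by (auto dest: borel_measurable_integrable)
      ultimately have "f \<in> borel_measurable (lebesgue_on X)"
        by (simp add: borel_measurable_restrict_space_iff)
      moreover have "restrict_space (lebesgue_on \<Omega>) X = lebesgue_on X"
        using box[OF that] \<open>X \<in> sets lebesgue\<close> \<Omega>
        by (subst restrict_restrict_space) (auto simp: Int_absorb1)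
      ultimately show ?thesis by simp
    qed
  qed
qed

text \<open>Compact sets have finite measure, and \<open>\<bar>r\<bar> \<le> 1 + r\<^sup>2\<close>
  dominates the function by an integrable one.\<close>

lemma sq_int_L1_loc:
  assumes "open \<Omega>" "f \<in> sq_int (lebesgue_on \<Omega>)"
  shows "f \<in> L1_loc \<Omega>"
  unfolding L1_loc_def
proof (intro CollectI allI impI)
  fix K assume K: "compact K" "K \<subseteq> \<Omega>"
  have \<Omega>: "\<Omega> \<in> sets lebesgue" using assms by auto
  have Km: "K \<in> lmeasurable" using K by (simp add: lmeasurable_compact)
  have f2: "integrable lebesgue (\<lambda>x. indicator \<Omega> x * (f x)\<^sup>2)"
    using assms by (simp add: sq_int_def integrable_lebesgue_on \<Omega>)
  have fm: "(\<lambda>x. indicator \<Omega> x *\<^sub>R f x) \<in> borel_measurable lebesgue"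
    using assms \<Omega> by (simp add: sq_int_def borel_measurable_restrict_space_iff)
  have "(\<lambda>x. indicator K x *\<^sub>R f x) = (\<lambda>x. indicator K x *\<^sub>R (indicator \<Omega> x *\<^sub>R f x))"
    using K by (intro ext) (auto split: split_indicator)
  moreover have "(\<lambda>x. indicator K x *\<^sub>R (indicator \<Omega> x *\<^sub>R f x)) \<in> borel_measurable lebesgue"
    using Km by (intro borel_measurable_scaleR[OF _ fm]) (auto simp: fmeasurableD)
  ultimately have meas: "(\<lambda>x. indicator K x *\<^sub>R f x) \<in> borel_measurable lebesgue" by simp
  have bound: "\<bar>r\<bar> \<le> 1 + r\<^sup>2" for r :: real
  proof -
    have "0 \<le> (\<bar>r\<bar> - 1/2)\<^sup>2" by simp
    then show ?thesis by (simp add: power2_diff power_divide)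
  qed
  show "set_integrable lebesgue K f"
    unfolding set_integrable_def
  proof (rule Bochner_Integration.integrable_bound)
    show "integrable lebesgue (\<lambda>x. indicator K x + indicator \<Omega> x * (f x)\<^sup>2)"
      using Km f2 by (intro Bochner_Integration.integrable_add integrable_real_indicator)
        (auto simp: fmeasurable_def)
    show "AE x in lebesgue. norm (indicator K x *\<^sub>R f x) \<le>
        norm (indicator K x + indicator \<Omega> x * (f x)\<^sup>2)"
      using K bound by (auto simp: indicator_def)
  qed (rule meas)
qed

section \<open>Test functions: closure properties, integrability and vanishing integrals of
  derivatives\<close>

lemma test_function_support:
  assumes "\<phi> \<in> test_functions \<Omega>"
  obtains K where "compact K" "K \<subseteq> \<Omega>" "\<And>x. x \<notin> K \<Longrightarrow> \<phi> x = 0"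
  using assms by (auto simp: test_functions_def)

lemma test_function_has_derivative:
  "\<phi> \<in> test_functions \<Omega> \<Longrightarrow> (\<phi> has_derivative frechet_derivative \<phi> (at x)) (at x)"
  by (auto simp: test_functions_def Cinf_on_def dest!: spec[of _ 1] simp flip: frechet_derivative_works)

lemma test_function_frechet_derivative:
  assumes "\<phi> \<in> test_functions \<Omega>" "i \<in> Basis"
  shows "(\<lambda>x. frechet_derivative \<phi> (at x) i) \<in> test_functions \<Omega>"
proof -
  obtain K where K: "compact K" "K \<subseteq> \<Omega>" "\<And>x. x \<notin> K \<Longrightarrow> \<phi> x = 0"
    using test_function_support[OF assms(1)] by blast
  have "frechet_derivative \<phi> (at x) i = 0" if "x \<notin> K" for x
  proof -
    have "((\<lambda>_. 0) has_derivative (\<lambda>_. 0)) (at x)" by simp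
    then have "(\<phi> has_derivative (\<lambda>_. 0)) (at x)"
      by (rule has_derivative_transform_within_open[where s = "- K"])
        (use K that compact_imp_closed in auto)
    then show ?thesis using frechet_derivative_at by metis
  qed
  moreover have "Ck_on k UNIV (\<lambda>x. frechet_derivative \<phi> (at x) i)" for k
  proof -
    have "Ck_on (Suc k) UNIV \<phi>" using assms(1) by (simp only: test_functions_def Cinf_on_def mem_Collect_eq)
    then show ?thesis using assms(2) by (rule Ck_on_SucD(2))
  qed
  ultimately show ?thesis using K by (auto simp: test_functions_def Cinf_on_def)
qed

lemma test_function_mult:
  assumes "\<phi> \<in> test_functions \<Omega>" "\<eta> \<in> test_functions \<Omega>"
  shows "(\<lambda>x. \<phi> x * \<eta> x) \<in> test_functions \<Omega>"
proof -
  obtain K where K: "compact K" "K \<subseteq> \<Omega>" "\<And>x. x \<notin> K \<Longrightarrow> \<phi> x = 0"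
    using test_function_support[OF assms(1)] by blast
  moreover have "Cinf_on UNIV (\<lambda>x. \<phi> x * \<eta> x)"
    using assms by (auto simp: test_functions_def Cinf_on_def intro: Ck_on_mult)
  ultimately show ?thesis by (auto simp: test_functions_def)
qed

lemma test_function_add:
  assumes "\<phi> \<in> test_functions \<Omega>" "\<eta> \<in> test_functions \<Omega>"
  shows "(\<lambda>x. \<phi> x + \<eta> x) \<in> test_functions \<Omega>"
proof -
  obtain K where K: "compact K" "K \<subseteq> \<Omega>" "\<And>x. x \<notin> K \<Longrightarrow> \<phi> x = 0"
    using test_function_support[OF assms(1)] by blast
  obtain K' where K': "compact K'" "K' \<subseteq> \<Omega>" "\<And>x. x \<notin> K' \<Longrightarrow> \<eta> x = 0"
    using test_function_support[OF assms(2)] by blast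
  have "compact (K \<union> K')" "K \<union> K' \<subseteq> \<Omega>" "\<And>x. x \<notin> K \<union> K' \<Longrightarrow> \<phi> x + \<eta> x = 0"
    using K K' by auto
  moreover have "Cinf_on UNIV (\<lambda>x. \<phi> x + \<eta> x)"
    using assms by (auto simp: test_functions_def Cinf_on_def intro: Ck_on_add)
  ultimately show ?thesis unfolding test_functions_def by blast
qed

lemma test_function_scale: "\<phi> \<in> test_functions \<Omega> \<Longrightarrow> (\<lambda>x. c * \<phi> x) \<in> test_functions \<Omega>"
  unfolding test_functions_def Cinf_on_def
  by (auto intro!: Ck_on_mult Ck_on_const)

lemma test_function_bounded:
  assumes "\<phi> \<in> test_functions \<Omega>"
  obtains B where "0 \<le> B" "\<And>x. \<bar>\<phi> x\<bar> \<le> B"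
proof -
  obtain K where K: "compact K" "K \<subseteq> \<Omega>" "\<And>x. x \<notin> K \<Longrightarrow> \<phi> x = 0"
    using test_function_support[OF assms] by blast
  have "compact (\<phi> ` K)"
    using K(1) test_function_continuous[OF assms]
    by (meson compact_continuous_image continuous_on_subset subset_UNIV)
  then obtain B where B: "\<forall>y\<in>\<phi> ` K. norm y \<le> B" using compact_imp_bounded bounded_iff by metis
  have "\<bar>\<phi> x\<bar> \<le> max 0 B" for x using B K(3)[of x] by (cases "x \<in> K") fastforce+
  then show ?thesis using that[of "max 0 B"] by simp
qed

lemma test_function_borel: "\<phi> \<in> test_functions \<Omega> \<Longrightarrow> \<phi> \<in> borel_measurable borel"
  by (simp add: test_function_continuous borel_measurable_continuous_onI)

lemma test_function_lebesgue:
  "\<phi> \<in> test_functions \<Omega> \<Longrightarrow> \<phi> \<in> borel_measurable lebesgue"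
  by (rule measurable_completion) (simp add: test_function_borel)

lemma test_function_integrable_lborel:
  assumes "\<phi> \<in> test_functions \<Omega>"
  shows "integrable lborel \<phi>"
proof -
  obtain K where K: "compact K" "K \<subseteq> \<Omega>" "\<And>x. x \<notin> K \<Longrightarrow> \<phi> x = 0"
    using test_function_support[OF assms] by blast
  have "integrable lborel (\<lambda>x. indicator K x *\<^sub>R \<phi> x)"
    using K(1) test_function_continuous[OF assms]
    by (intro borel_integrable_compact) (auto intro: continuous_on_subset)
  moreover have "(\<lambda>x. indicator K x *\<^sub>R \<phi> x) = \<phi>"
    using K(3) by (intro ext) (auto split: split_indicator)
  ultimately show ?thesis by simp
qed

lemma test_function_integral:
  assumes "\<phi> \<in> test_functions \<Omega>" "open \<Omega>"
  shows "(LINT x|lebesgue_on \<Omega>. \<phi> x) = (LINT x|lborel. \<phi> x)"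
proof -
  obtain K where K: "compact K" "K \<subseteq> \<Omega>" "\<And>x. x \<notin> K \<Longrightarrow> \<phi> x = 0"
    using test_function_support[OF assms(1)] by blast
  have "(\<lambda>x. indicator \<Omega> x * \<phi> x) = \<phi>"
    using K(2,3) by (intro ext) (auto split: split_indicator)
  then show ?thesis
    using assms by (simp add: integral_lebesgue_on integral_completion test_function_borel)
qed

lemma test_function_integrable:
  assumes "\<phi> \<in> test_functions \<Omega>" "open \<Omega>"
  shows "integrable (lebesgue_on \<Omega>) \<phi>"
proof -
  obtain K where K: "compact K" "K \<subseteq> \<Omega>" "\<And>x. x \<notin> K \<Longrightarrow> \<phi> x = 0"
    using test_function_support[OF assms(1)] by blast
  have "(\<lambda>x. indicator \<Omega> x * \<phi> x) = \<phi>"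
    using K(2,3) by (intro ext) (auto split: split_indicator)
  then show ?thesis
    using assms test_function_integrable_lborel[OF assms(1)]
    by (simp add: integrable_lebesgue_on integrable_completion test_function_borel)
qed

lemma test_function_measurable:
  "\<phi> \<in> test_functions \<Omega> \<Longrightarrow> \<phi> \<in> borel_measurable (lebesgue_on \<Omega>)"
  by (intro measurable_restrict_space1 test_function_lebesgue)

lemma test_function_sq_int:
  assumes "\<phi> \<in> test_functions \<Omega>" "open \<Omega>"
  shows "\<phi> \<in> sq_int (lebesgue_on \<Omega>)"
  using test_function_integrable[OF test_function_mult[OF assms(1) assms(1)] assms(2)]
    test_function_measurable[OF assms(1)]
  by (simp add: sq_int_def power2_eq_square)

lemma L1_loc_test_integrable:
  assumes "open \<Omega>" "v \<in> L1_loc \<Omega>" "\<phi> \<in> test_functions \<Omega>"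
  shows "integrable (lebesgue_on \<Omega>) (\<lambda>x. v x * \<phi> x)"
proof -
  obtain K where K: "compact K" "K \<subseteq> \<Omega>" "\<And>x. x \<notin> K \<Longrightarrow> \<phi> x = 0"
    using test_function_support[OF assms(3)] by blast
  obtain B where B: "0 \<le> B" "\<And>x. \<bar>\<phi> x\<bar> \<le> B" using test_function_bounded[OF assms(3)] by blast
  have v: "integrable lebesgue (\<lambda>x. indicator K x * v x)"
    using L1_loc_integrable[OF assms(2) K(1,2)] .
  have "integrable lebesgue (\<lambda>x. (indicator K x * v x) * \<phi> x)"
  proof (rule Bochner_Integration.integrable_bound)
    show "integrable lebesgue (\<lambda>x. B * (indicator K x * v x))" using v by simp
    show "(\<lambda>x. indicator K x * v x * \<phi> x) \<in> borel_measurable lebesgue"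
      by (rule borel_measurable_times[OF borel_measurable_integrable[OF v] test_function_lebesgue[OF assms(3)]])
    show "AE x in lebesgue. norm (indicator K x * v x * \<phi> x) \<le> norm (B * (indicator K x * v x))"
      using B by (auto simp: abs_mult indicator_def mult.commute intro!: mult_mono)
  qed
  moreover have "indicator K x * v x * \<phi> x = indicator \<Omega> x * (v x * \<phi> x)" for x
    using K(2,3) by (auto simp: indicator_def)
  ultimately show ?thesis using assms(1) by (simp add: integrable_lebesgue_on)
qed

lemma test_function_line_derivative:
  assumes "f \<in> test_functions \<Omega>" "i \<in> Basis"
  shows "((\<lambda>t. f (x + t *\<^sub>R i)) has_real_derivative frechet_derivative f (at (x + t *\<^sub>R i)) i) (at t)"
proof -
  have "((\<lambda>t. x + t *\<^sub>R i) has_derivative (\<lambda>s. s *\<^sub>R i)) (at t)"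
    by (auto intro!: derivative_eq_intros)
  from has_derivative_compose[OF this test_function_has_derivative[OF assms(1)]]
  have "((\<lambda>t. f (x + t *\<^sub>R i)) has_derivative
      (\<lambda>s. frechet_derivative f (at (x + t *\<^sub>R i)) (s *\<^sub>R i))) (at t)" .
  moreover have "frechet_derivative f (at (x + t *\<^sub>R i)) (s *\<^sub>R i) =
      frechet_derivative f (at (x + t *\<^sub>R i)) i * s" for s
    using linear_cmul[OF has_derivative_linear[OF test_function_has_derivative[OF assms(1)]]] by simp
  ultimately show ?thesis by (simp add: has_field_derivative_def)
qed

text \<open>Difference quotients have integral 0 because Lebesgue measure is translation invariant.
  By the mean value theorem they are bounded by the supremum of the derivative, so dominated
  convergence passes to the derivative.\<close>

lemma integral_frechet_derivative_test_function:
  fixes f :: "'a::euclidean_space \<Rightarrow> real"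
  assumes f: "f \<in> test_functions UNIV" and i: "i \<in> Basis"
  shows "(LINT x|lborel. frechet_derivative f (at x) i) = 0"
proof -
  let ?df = "\<lambda>x. frechet_derivative f (at x) i"
  have df: "?df \<in> test_functions UNIV" using test_function_frechet_derivative[OF f i] .
  obtain B where B: "0 \<le> B" "\<And>x. \<bar>?df x\<bar> \<le> B" using test_function_bounded[OF df] by blast
  obtain K where K: "compact K" "K \<subseteq> UNIV" "\<And>x. x \<notin> K \<Longrightarrow> f x = 0"
    by (rule test_function_support[OF f]) (rule that, assumption+)
  obtain R where R: "\<And>x. x \<in> K \<Longrightarrow> norm x \<le> R"
    using compact_imp_bounded[OF K(1)] bounded_iff by metis
  define h where "h n = 1 / real (Suc n)" for n
  have h: "0 < h n" "h n \<le> 1" for n by (auto simp: h_def)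
  have h0: "h \<longlonglongrightarrow> 0" unfolding h_def by (rule LIMSEQ_Suc[OF lim_1_over_n])
  define q where "q n x = (f (x + h n *\<^sub>R i) - f x) / h n" for n x
  note line = test_function_line_derivative[OF f i]
  have q_bound: "\<bar>q n x\<bar> \<le> B" for n x
  proof -
    obtain z where "f (x + h n *\<^sub>R i) - f (x + 0 *\<^sub>R i) = (h n - 0) * ?df (x + z *\<^sub>R i)"
      using MVT2[OF h(1)[of n] line[of x]] by blast
    then have "q n x = ?df (x + z *\<^sub>R i)" using h(1)[of n] by (simp add: q_def)
    then show ?thesis using B(2) by simp
  qed
  \<comment> \<open>The steps \<open>h n\<close> are at most 1, so enlarging the radius by 1 gives
    one ball that contains the supports of all the quotients.\<close>
  have q_supp: "q n x = 0" if "x \<notin> cball 0 (R + 1)" for n x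
  proof -
    have x: "norm x > R + 1" using that by (simp add: dist_norm)
    have "norm (h n *\<^sub>R i) \<le> 1" using h[of n] i by simp
    then have "norm (x + h n *\<^sub>R i) > R" using x norm_triangle_ineq2[of x "- (h n *\<^sub>R i)"] by simp
    then have "x + h n *\<^sub>R i \<notin> K" "x \<notin> K" using R x by force+
    then show ?thesis by (simp add: q_def K(3))
  qed
  have f_int: "integrable lborel f" by (rule test_function_integrable_lborel[OF f])
  have shift: "integrable lborel (\<lambda>x. f (x + c))" "(LINT x|lborel. f (x + c)) = (LINT x|lborel. f x)" for c
  proof -
    have "integrable (distr lborel borel ((+) c)) f" using f_int by (simp add: lborel_distr_plus)
    then show "integrable lborel (\<lambda>x. f (x + c))"
      using test_function_borel[OF f] by (subst (asm) integrable_distr_eq) (auto simp: add.commute)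
    have "(LINT x|distr lborel borel ((+) c). f x) = (LINT x|lborel. f (c + x))"
      using test_function_borel[OF f] by (subst integral_distr) auto
    then show "(LINT x|lborel. f (x + c)) = (LINT x|lborel. f x)"
      by (simp add: lborel_distr_plus add.commute)
  qed
  have "(\<lambda>n. LINT x|lborel. q n x) \<longlonglongrightarrow> (LINT x|lborel. ?df x)"
  proof (rule integral_dominated_convergence)
    show "?df \<in> borel_measurable lborel" using test_function_borel[OF df] by simp
    show "q n \<in> borel_measurable lborel" for n
      using shift(1) f_int unfolding q_def[abs_def]
      by (intro borel_measurable_integrable Bochner_Integration.integrable_diff integrable_divide_zero) auto
    show "integrable lborel (\<lambda>x. B * indicator (cball 0 (R + 1)) x)"
      by (intro integrable_mult_right integrable_real_indicator emeasure_bounded_finite) auto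
    show "AE x in lborel. norm (q n x) \<le> B * indicator (cball 0 (R + 1)) x" for n
      using q_bound q_supp by (auto simp: indicator_def)
    show "AE x in lborel. (\<lambda>n. q n x) \<longlonglongrightarrow> ?df x"
    proof (intro always_eventually allI)
      fix x
      have "((\<lambda>t. (f (x + t *\<^sub>R i) - f x) / t) \<longlongrightarrow> ?df x) (at 0)"
        using line[of x 0] by (simp add: has_field_derivative_iff)
      moreover have "filterlim h (at 0) sequentially"
        using h0 h(1) unfolding filterlim_at by (auto intro!: always_eventually simp: less_imp_neq[symmetric])
      ultimately show "(\<lambda>n. q n x) \<longlonglongrightarrow> ?df x"
        unfolding q_def by (rule filterlim_compose)
    qed
  qed
  moreover have "(LINT x|lborel. q n x) = 0" for n
    using shift f_int by (simp add: q_def)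
  ultimately show ?thesis by (simp add: LIMSEQ_const_iff)
qed

lemma test_functions_mono: "\<Omega> \<subseteq> \<Omega>' \<Longrightarrow> test_functions \<Omega> \<subseteq> test_functions \<Omega>'"
  by (rule subsetI) (auto simp: test_functions_def dest: order_trans[of _ \<Omega> \<Omega>'])

section \<open>Existence, uniqueness and linearity of weak derivatives\<close>

lemma has_weak_pderivD:
  "has_weak_pderiv \<Omega> i u v \<Longrightarrow> \<phi> \<in> test_functions \<Omega> \<Longrightarrow>
     (LINT x|lebesgue_on \<Omega>. u x * frechet_derivative \<phi> (at x) i) = - (LINT x|lebesgue_on \<Omega>. v x * \<phi> x)"
  by (simp add: has_weak_pderiv_def)

text \<open>Integration by parts: the derivative of the product \<open>\<phi> x * \<eta> x\<close>
  has integral 0.\<close>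

lemma test_function_has_weak_pderiv:
  assumes "open \<Omega>" and \<phi>: "\<phi> \<in> test_functions \<Omega>" and i: "i \<in> Basis"
  shows "has_weak_pderiv \<Omega> i \<phi> (\<lambda>x. frechet_derivative \<phi> (at x) i)"
  unfolding has_weak_pderiv_def
proof (intro conjI ballI)
  have d: "(\<lambda>x. frechet_derivative \<phi> (at x) i) \<in> test_functions \<Omega>"
    using test_function_frechet_derivative[OF \<phi> i] .
  show "\<phi> \<in> L1_loc \<Omega>" "(\<lambda>x. frechet_derivative \<phi> (at x) i) \<in> L1_loc \<Omega>"
    using assms d by (auto intro: sq_int_L1_loc test_function_sq_int)
  fix \<eta> assume \<eta>: "\<eta> \<in> test_functions \<Omega>"
  have d': "(\<lambda>x. frechet_derivative \<eta> (at x) i) \<in> test_functions \<Omega>"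
    using test_function_frechet_derivative[OF \<eta> i] .
  have prod: "frechet_derivative (\<lambda>x. \<phi> x * \<eta> x) (at x) i =
      \<phi> x * frechet_derivative \<eta> (at x) i + frechet_derivative \<phi> (at x) i * \<eta> x" for x
    using frechet_derivative_at[OF has_derivative_mult[OF test_function_has_derivative[OF \<phi>]
        test_function_has_derivative[OF \<eta>]]] by metis
  have "0 = (LINT x|lborel. frechet_derivative (\<lambda>x. \<phi> x * \<eta> x) (at x) i)"
    using integral_frechet_derivative_test_function[OF _ i] test_function_mult[OF \<phi> \<eta>]
      test_functions_mono[of \<Omega> UNIV] by auto
  also have "\<dots> = (LINT x|lebesgue_on \<Omega>. frechet_derivative (\<lambda>x. \<phi> x * \<eta> x) (at x) i)"
    using test_function_integral[OF test_function_frechet_derivative[OF test_function_mult[OF \<phi> \<eta>] i]]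
      \<open>open \<Omega>\<close> by simp
  also have "\<dots> = (LINT x|lebesgue_on \<Omega>. \<phi> x * frechet_derivative \<eta> (at x) i) +
      (LINT x|lebesgue_on \<Omega>. frechet_derivative \<phi> (at x) i * \<eta> x)"
    unfolding prod using test_function_integrable[OF test_function_mult[OF \<phi> d'] \<open>open \<Omega>\<close>]
      test_function_integrable[OF test_function_mult[OF d \<eta>] \<open>open \<Omega>\<close>]
    by (rule Bochner_Integration.integral_add)
  finally show "(LINT x|lebesgue_on \<Omega>. \<phi> x * frechet_derivative \<eta> (at x) i) =
      - (LINT x|lebesgue_on \<Omega>. frechet_derivative \<phi> (at x) i * \<eta> x)" by simp
qed

lemma has_weak_pderiv_unique:
  assumes "open \<Omega>" "has_weak_pderiv \<Omega> i u v" "has_weak_pderiv \<Omega> i u w"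
  shows "AE x in lebesgue_on \<Omega>. v x = w x"
proof -
  have v: "v \<in> L1_loc \<Omega>" and w: "w \<in> L1_loc \<Omega>" using assms by (auto simp: has_weak_pderiv_def)
  have "AE x in lebesgue_on \<Omega>. v x - w x = 0"
  proof (rule fundamental_lemma_calculus_of_variations[OF \<open>open \<Omega>\<close> L1_loc_diff[OF v w]])
    fix \<phi> assume \<phi>: "\<phi> \<in> test_functions \<Omega>"
    show "(LINT x|lebesgue_on \<Omega>. (v x - w x) * \<phi> x) = 0"
      using has_weak_pderivD[OF assms(2) \<phi>] has_weak_pderivD[OF assms(3) \<phi>]
        L1_loc_test_integrable[OF \<open>open \<Omega>\<close> v \<phi>] L1_loc_test_integrable[OF \<open>open \<Omega>\<close> w \<phi>]
      by (simp add: left_diff_distrib)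
  qed
  then show ?thesis by simp
qed

lemma has_weak_pderiv_linear:
  assumes "open \<Omega>" "i \<in> Basis" and u: "has_weak_pderiv \<Omega> i u v" and w: "has_weak_pderiv \<Omega> i u' v'"
  shows "has_weak_pderiv \<Omega> i (\<lambda>x. c * u x + d * u' x) (\<lambda>x. c * v x + d * v' x)"
proof -
  have loc: "u \<in> L1_loc \<Omega>" "v \<in> L1_loc \<Omega>" "u' \<in> L1_loc \<Omega>" "v' \<in> L1_loc \<Omega>"
    using u w by (auto simp: has_weak_pderiv_def)
  show ?thesis
    unfolding has_weak_pderiv_def
  proof (intro conjI ballI)
    fix \<phi> assume \<phi>: "\<phi> \<in> test_functions \<Omega>"
    have d: "(\<lambda>x. frechet_derivative \<phi> (at x) i) \<in> test_functions \<Omega>"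
      using test_function_frechet_derivative[OF \<phi> assms(2)] .
    show "(LINT x|lebesgue_on \<Omega>. (c * u x + d * u' x) * frechet_derivative \<phi> (at x) i) =
        - (LINT x|lebesgue_on \<Omega>. (c * v x + d * v' x) * \<phi> x)"
      using has_weak_pderivD[OF u \<phi>] has_weak_pderivD[OF w \<phi>]
        L1_loc_test_integrable[OF \<open>open \<Omega>\<close> loc(1) d] L1_loc_test_integrable[OF \<open>open \<Omega>\<close> loc(2) \<phi>]
        L1_loc_test_integrable[OF \<open>open \<Omega>\<close> loc(3) d] L1_loc_test_integrable[OF \<open>open \<Omega>\<close> loc(4) \<phi>]
      by (simp add: distrib_right mult.assoc)
  qed (use loc in \<open>auto intro: L1_loc_add L1_loc_scale\<close>)
qed

text \<open>Nothing is assumed about the measurability of \<open>u'\<close> and \<open>v'\<close>: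
  Lebesgue measure is complete, so a change on a null set preserves integrability.\<close>

lemma has_weak_pderiv_cong_AE:
  assumes \<Omega>: "\<Omega> \<in> sets lebesgue" and h: "has_weak_pderiv \<Omega> i u v"
    and u: "AE x in lebesgue_on \<Omega>. u' x = u x" and v: "AE x in lebesgue_on \<Omega>. v' x = v x"
  shows "has_weak_pderiv \<Omega> i u' v'"
proof -
  have cong: "(LINT x|lebesgue_on \<Omega>. f' x * g x) = (LINT x|lebesgue_on \<Omega>. f x * g x)"
    if ff: "AE x in lebesgue_on \<Omega>. f' x = f x" for f f' g :: "'a \<Rightarrow> real"
  proof -
    have "AE x in lebesgue. x \<in> \<Omega> \<longrightarrow> f' x = f x" using ff \<Omega> by (simp add: AE_lebesgue_on_iff)
    then obtain N where N: "N \<in> null_sets lebesgue" "{x. \<not> (x \<in> \<Omega> \<longrightarrow> f' x = f x)} \<subseteq> N"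
      unfolding completion.AE_iff_null_sets by auto
    have neg: "negligible N" using N(1) by (simp add: negligible_iff_null_sets)
    have eq: "f' x * g x = f x * g x" if "x \<in> \<Omega> - N" for x using N(2) that by auto
    show ?thesis
    proof (cases "set_integrable lebesgue \<Omega> (\<lambda>x. f x * g x)")
      case True
      then have "set_integrable lebesgue \<Omega> (\<lambda>x. f' x * g x)"
        by (rule absolutely_integrable_spike[OF _ neg eq])
      then have "(LINT x:\<Omega>|lebesgue. f' x * g x) = integral \<Omega> (\<lambda>x. f' x * g x)"
        by (rule set_lebesgue_integral_eq_integral(2))
      also have "\<dots> = integral \<Omega> (\<lambda>x. f x * g x)"
        using neg by (rule integral_spike) (rule eq[symmetric])
      also have "\<dots> = (LINT x:\<Omega>|lebesgue. f x * g x)"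
        using True by (rule set_lebesgue_integral_eq_integral(2)[symmetric])
      finally show ?thesis using \<Omega> by (simp add: set_lebesgue_integral_def integral_lebesgue_on)
    next
      \<comment> \<open>Neither product is integrable, and both integrals take the default value
        0.\<close>
      case False
      then have "\<not> set_integrable lebesgue \<Omega> (\<lambda>x. f' x * g x)"
        using absolutely_integrable_spike_eq[OF neg eq] by auto
      with False show ?thesis using \<Omega>
        by (simp add: set_integrable_def integral_lebesgue_on not_integrable_integral_eq)
    qed
  qed
  show ?thesis
    using h L1_loc_cong_AE[OF \<Omega> _ u] L1_loc_cong_AE[OF \<Omega> _ v]
    unfolding has_weak_pderiv_def by (simp add: cong[OF u] cong[OF v])
qed

text \<open>The conclusion is equality of functions and not only a.e.: the two predicates coincide,
  so \<open>SOME\<close> selects the same representative. Iterated derivatives can therefore be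
  rewritten directly.\<close>

lemma weak_pderiv_cong_AE:
  assumes "\<Omega> \<in> sets lebesgue" "AE x in lebesgue_on \<Omega>. u' x = u x"
  shows "weak_pderiv \<Omega> i u' = weak_pderiv \<Omega> i u"
proof -
  have "AE x in lebesgue_on \<Omega>. u x = u' x" using assms(2) by eventually_elim simp
  then have "has_weak_pderiv \<Omega> i u' v \<longleftrightarrow> has_weak_pderiv \<Omega> i u v" for v
    using has_weak_pderiv_cong_AE[OF assms(1)] assms(2) by blast
  then show ?thesis by (simp add: weak_pderiv_def)
qed

lemma has_weak_pderiv_weak_pderiv:
  "has_weak_pderiv \<Omega> i u v \<Longrightarrow> has_weak_pderiv \<Omega> i u (weak_pderiv \<Omega> i u)"
  unfolding weak_pderiv_def by (rule someI[of "has_weak_pderiv \<Omega> i u"])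

lemma weak_pderiv_eq_AE:
  assumes "open \<Omega>" "has_weak_pderiv \<Omega> i u v"
  shows "AE x in lebesgue_on \<Omega>. weak_pderiv \<Omega> i u x = v x"
  using assms has_weak_pderiv_unique has_weak_pderiv_weak_pderiv by blast

section \<open>The spaces \<open>H\<^sup>1\<close>, \<open>H\<^sup>1\<^sub>0\<close> and Green's formula\<close>

text \<open>The bilinear form behind the squared L2 norm of the weak gradient, kept in components so
  that the scalar L2 calculus applies to each of them.\<close>

definition dirichlet_form :: "'a::euclidean_space set \<Rightarrow> ('a \<Rightarrow> real) \<Rightarrow> ('a \<Rightarrow> real) \<Rightarrow> real" where
  "dirichlet_form \<Omega> u v =
     (\<Sum>i\<in>Basis. l2_inner (lebesgue_on \<Omega>) (weak_pderiv \<Omega> i u) (weak_pderiv \<Omega> i v))"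

lemma Lnorm_2_eq_l2_norm: "Lnorm 2 \<Omega> f = l2_norm (lebesgue_on \<Omega>) f"
  by (simp add: Lnorm_def l2_norm_def l2_inner_def sqrt_def power2_eq_square flip: root_def)

lemma H1_sq_int: "u \<in> H1 \<Omega> \<Longrightarrow> u \<in> sq_int (lebesgue_on \<Omega>)"
  by (simp add: H1_def L2_eq_sq_int)

lemma H1_has_weak_pderiv:
  "u \<in> H1 \<Omega> \<Longrightarrow> i \<in> Basis \<Longrightarrow> has_weak_pderiv \<Omega> i u (weak_pderiv \<Omega> i u)"
  by (auto simp: H1_def intro: has_weak_pderiv_weak_pderiv)

text \<open>The representative that \<open>SOME\<close> selects need not be \<open>v\<close>. It is
  measurable because it is locally integrable, and it agrees with \<open>v\<close> a.e. by
  uniqueness.\<close>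

lemma weak_pderiv_sq_int_eq:
  assumes "open \<Omega>" "has_weak_pderiv \<Omega> i u v" "v \<in> sq_int (lebesgue_on \<Omega>)"
  shows "weak_pderiv \<Omega> i u \<in> sq_int (lebesgue_on \<Omega>)"
proof (rule sq_int_cong_AE[OF assms(3)])
  show "weak_pderiv \<Omega> i u \<in> borel_measurable (lebesgue_on \<Omega>)"
    using has_weak_pderiv_weak_pderiv[OF assms(2)] L1_loc_measurable[OF assms(1)]
    by (simp add: has_weak_pderiv_def)
qed (rule weak_pderiv_eq_AE[OF assms(1,2)])

lemma H1_weak_pderiv_sq_int:
  assumes "open \<Omega>" "u \<in> H1 \<Omega>" "i \<in> Basis"
  shows "weak_pderiv \<Omega> i u \<in> sq_int (lebesgue_on \<Omega>)"
  using assms weak_pderiv_sq_int_eq[OF assms(1)] by (auto simp: H1_def L2_eq_sq_int)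

lemma H1_linear:
  assumes "open \<Omega>" "u \<in> H1 \<Omega>" "v \<in> H1 \<Omega>"
  shows "(\<lambda>x. c * u x + d * v x) \<in> H1 \<Omega>"
    and "i \<in> Basis \<Longrightarrow> AE x in lebesgue_on \<Omega>. weak_pderiv \<Omega> i (\<lambda>x. c * u x + d * v x) x =
       c * weak_pderiv \<Omega> i u x + d * weak_pderiv \<Omega> i v x"
proof -
  have lin: "has_weak_pderiv \<Omega> i (\<lambda>x. c * u x + d * v x)
      (\<lambda>x. c * weak_pderiv \<Omega> i u x + d * weak_pderiv \<Omega> i v x)" if "i \<in> Basis" for i
    using assms that by (intro has_weak_pderiv_linear H1_has_weak_pderiv)
  have "(\<lambda>x. c * weak_pderiv \<Omega> i u x + d * weak_pderiv \<Omega> i v x) \<in> sq_int (lebesgue_on \<Omega>)"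
    if "i \<in> Basis" for i
    using assms that by (intro sq_int_add sq_int_scale H1_weak_pderiv_sq_int)
  moreover have "(\<lambda>x. c * u x + d * v x) \<in> sq_int (lebesgue_on \<Omega>)"
    using assms by (intro sq_int_add sq_int_scale H1_sq_int)
  ultimately show "(\<lambda>x. c * u x + d * v x) \<in> H1 \<Omega>"
    unfolding H1_def L2_eq_sq_int using lin by blast
  show "AE x in lebesgue_on \<Omega>. weak_pderiv \<Omega> i (\<lambda>x. c * u x + d * v x) x =
       c * weak_pderiv \<Omega> i u x + d * weak_pderiv \<Omega> i v x" if "i \<in> Basis"
    using weak_pderiv_eq_AE[OF assms(1) lin[OF that]] .
qed

lemma H1_diff:
  assumes "open \<Omega>" "u \<in> H1 \<Omega>" "v \<in> H1 \<Omega>"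
  shows "(\<lambda>x. u x - v x) \<in> H1 \<Omega>"
    and "i \<in> Basis \<Longrightarrow> AE x in lebesgue_on \<Omega>. weak_pderiv \<Omega> i (\<lambda>x. u x - v x) x =
       weak_pderiv \<Omega> i u x - weak_pderiv \<Omega> i v x"
  using H1_linear[OF assms, where c = 1 and d = "-1"] by simp_all

lemma test_function_H1:
  assumes "open \<Omega>" "\<phi> \<in> test_functions \<Omega>"
  shows "\<phi> \<in> H1 \<Omega>"
    and "i \<in> Basis \<Longrightarrow> AE x in lebesgue_on \<Omega>. weak_pderiv \<Omega> i \<phi> x = frechet_derivative \<phi> (at x) i"
proof -
  show "\<phi> \<in> H1 \<Omega>"
    unfolding H1_def L2_eq_sq_int
    using test_function_sq_int[OF _ assms(1)] assms(2) test_function_has_weak_pderiv[OF assms]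
      test_function_frechet_derivative[OF assms(2)] by blast
  show "i \<in> Basis \<Longrightarrow> AE x in lebesgue_on \<Omega>. weak_pderiv \<Omega> i \<phi> x = frechet_derivative \<phi> (at x) i"
    by (rule weak_pderiv_eq_AE[OF assms(1) test_function_has_weak_pderiv[OF assms]])
qed

lemma inner_weak_grad:
  "weak_grad \<Omega> u x \<bullet> weak_grad \<Omega> v x = (\<Sum>i\<in>Basis. weak_pderiv \<Omega> i u x * weak_pderiv \<Omega> i v x)"
  unfolding weak_grad_def by (subst euclidean_inner) (simp add: inner_sum_left_Basis)

lemma integral_inner_weak_grad:
  assumes "open \<Omega>" "u \<in> H1 \<Omega>" "v \<in> H1 \<Omega>"
  shows "(LINT x|lebesgue_on \<Omega>. weak_grad \<Omega> u x \<bullet> weak_grad \<Omega> v x) = dirichlet_form \<Omega> u v"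
  using assms by (simp add: inner_weak_grad dirichlet_form_def l2_inner_def
      sq_int_mult_integrable H1_weak_pderiv_sq_int)

lemma Lnorm_2_weak_grad:
  assumes "open \<Omega>" "u \<in> H1 \<Omega>"
  shows "(Lnorm 2 \<Omega> (weak_grad \<Omega> u))\<^sup>2 = dirichlet_form \<Omega> u u"
proof -
  have "(Lnorm 2 \<Omega> (weak_grad \<Omega> u))\<^sup>2 = (LINT x|lebesgue_on \<Omega>. norm (weak_grad \<Omega> u x) ^ 2)"
    by (simp add: Lnorm_def flip: sqrt_def)
  then show ?thesis
    using integral_inner_weak_grad[OF assms assms(2)] by (simp add: power2_norm_eq_inner)
qed

lemma dirichlet_form_nonneg: "0 \<le> dirichlet_form \<Omega> u u"
  by (simp add: dirichlet_form_def sum_nonneg l2_inner_self_nonneg)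

lemma dirichlet_form_commute: "dirichlet_form \<Omega> u v = dirichlet_form \<Omega> v u"
  by (simp add: dirichlet_form_def l2_inner_commute)

lemma H1_norm_power2:
  assumes "open \<Omega>" "u \<in> H1 \<Omega>"
  shows "(H1_norm \<Omega> u)\<^sup>2 = (l2_norm (lebesgue_on \<Omega>) u)\<^sup>2 +
    (\<Sum>i\<in>Basis. (l2_norm (lebesgue_on \<Omega>) (weak_pderiv \<Omega> i u))\<^sup>2)"
  using Lnorm_2_weak_grad[OF assms]
  by (simp add: H1_norm_def Lnorm_2_eq_l2_norm dirichlet_form_def l2_norm_power2
      l2_inner_self_nonneg sum_nonneg add_nonneg_nonneg)

lemma H1_norm_nonneg: "0 \<le> H1_norm \<Omega> u"
  by (simp add: H1_norm_def)

lemma H1_norm_ge: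
  assumes "open \<Omega>" "u \<in> H1 \<Omega>"
  shows "l2_norm (lebesgue_on \<Omega>) u \<le> H1_norm \<Omega> u"
    and "i \<in> Basis \<Longrightarrow> l2_norm (lebesgue_on \<Omega>) (weak_pderiv \<Omega> i u) \<le> H1_norm \<Omega> u"
proof -
  show "l2_norm (lebesgue_on \<Omega>) u \<le> H1_norm \<Omega> u"
    by (rule power2_le_imp_le) (simp_all add: H1_norm_power2[OF assms] H1_norm_nonneg sum_nonneg)
  assume i: "i \<in> Basis"
  have "(l2_norm (lebesgue_on \<Omega>) (weak_pderiv \<Omega> i u))\<^sup>2 \<le>
      (\<Sum>i\<in>Basis. (l2_norm (lebesgue_on \<Omega>) (weak_pderiv \<Omega> i u))\<^sup>2)"
    using i by (intro member_le_sum) auto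
  then have "(l2_norm (lebesgue_on \<Omega>) (weak_pderiv \<Omega> i u))\<^sup>2 \<le> (H1_norm \<Omega> u)\<^sup>2"
    using zero_le_power2[of "l2_norm (lebesgue_on \<Omega>) u"]
    unfolding H1_norm_power2[OF assms] by linarith
  then show "l2_norm (lebesgue_on \<Omega>) (weak_pderiv \<Omega> i u) \<le> H1_norm \<Omega> u"
    by (rule power2_le_imp_le) (rule H1_norm_nonneg)
qed

lemma H1_norm_le:
  assumes "open \<Omega>" "u \<in> H1 \<Omega>"
  shows "H1_norm \<Omega> u \<le> l2_norm (lebesgue_on \<Omega>) u +
    (\<Sum>i\<in>Basis. l2_norm (lebesgue_on \<Omega>) (weak_pderiv \<Omega> i u))"
proof -
  have "H1_norm \<Omega> u = sqrt ((H1_norm \<Omega> u)\<^sup>2)" by (simp add: H1_norm_nonneg)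
  also have "\<dots> \<le> sqrt ((l2_norm (lebesgue_on \<Omega>) u)\<^sup>2) +
      sqrt (\<Sum>i\<in>Basis. (l2_norm (lebesgue_on \<Omega>) (weak_pderiv \<Omega> i u))\<^sup>2)"
    unfolding H1_norm_power2[OF assms] by (rule sqrt_add_le_add_sqrt) (auto intro: sum_nonneg)
  also have "\<dots> \<le> l2_norm (lebesgue_on \<Omega>) u + (\<Sum>i\<in>Basis. l2_norm (lebesgue_on \<Omega>) (weak_pderiv \<Omega> i u))"
    using L2_set_le_sum[of Basis "\<lambda>i. l2_norm (lebesgue_on \<Omega>) (weak_pderiv \<Omega> i u)"]
    by (simp add: L2_set_def)
  finally show ?thesis .
qed

section \<open>Approximation by test functions in H10\<close>

lemma H10_H1: "u \<in> H10 \<Omega> \<Longrightarrow> u \<in> H1 \<Omega>"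
  by (simp add: H10_def)

lemma H10_sq_int: "u \<in> H10 \<Omega> \<Longrightarrow> u \<in> sq_int (lebesgue_on \<Omega>)"
  by (simp add: H10_H1 H1_sq_int)

lemma l2_norm_weak_pderiv_diff:
  assumes "open \<Omega>" "u \<in> H1 \<Omega>" "\<phi> \<in> test_functions \<Omega>" "i \<in> Basis"
  shows "l2_norm (lebesgue_on \<Omega>) (weak_pderiv \<Omega> i (\<lambda>x. u x - \<phi> x)) =
    l2_norm (lebesgue_on \<Omega>) (\<lambda>x. frechet_derivative \<phi> (at x) i - weak_pderiv \<Omega> i u x)"
proof -
  have \<phi>: "\<phi> \<in> H1 \<Omega>" using assms by (simp add: test_function_H1)
  have d: "(\<lambda>x. frechet_derivative \<phi> (at x) i) \<in> sq_int (lebesgue_on \<Omega>)"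
    using assms by (intro test_function_sq_int test_function_frechet_derivative)
  have du: "weak_pderiv \<Omega> i u \<in> sq_int (lebesgue_on \<Omega>)"
    "weak_pderiv \<Omega> i (\<lambda>x. u x - \<phi> x) \<in> sq_int (lebesgue_on \<Omega>)"
    using assms \<phi> by (auto intro: H1_weak_pderiv_sq_int H1_diff)
  have "AE x in lebesgue_on \<Omega>. weak_pderiv \<Omega> i (\<lambda>x. u x - \<phi> x) x =
      weak_pderiv \<Omega> i u x - frechet_derivative \<phi> (at x) i"
    using H1_diff(2)[OF assms(1,2) \<phi> assms(4)] test_function_H1(2)[OF assms(1,3,4)]
    by eventually_elim simp
  then have "l2_norm (lebesgue_on \<Omega>) (weak_pderiv \<Omega> i (\<lambda>x. u x - \<phi> x)) =
      l2_norm (lebesgue_on \<Omega>) (\<lambda>x. weak_pderiv \<Omega> i u x - frechet_derivative \<phi> (at x) i)"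
    using du sq_int_diff[OF du(1) d] by (intro l2_norm_cong_AE) (auto dest: sq_int_measurable)
  then show ?thesis by (simp add: l2_norm_minus_commute)
qed

text \<open>Taking errors \<open>1 / (n + 1)\<close> turns the definition into a sequence. The
  classical derivatives of the approximants converge in L2 to the weak ones, so integral identities
  for test functions pass to the limit term by term.\<close>

lemma H10_approx:
  assumes "open \<Omega>" "u \<in> H10 \<Omega>"
  obtains \<phi> :: "nat \<Rightarrow> 'a::euclidean_space \<Rightarrow> real" where "\<And>n. \<phi> n \<in> test_functions \<Omega>"
    "l2_tendsto (lebesgue_on \<Omega>) \<phi> u sequentially"
    "\<And>i. i \<in> Basis \<Longrightarrow> l2_tendsto (lebesgue_on \<Omega>) (\<lambda>n x. frechet_derivative (\<phi> n) (at x) i)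
       (weak_pderiv \<Omega> i u) sequentially"
proof -
  have u: "u \<in> H1 \<Omega>" using assms(2) by (rule H10_H1)
  have "\<exists>\<phi>\<in>test_functions \<Omega>. H1_norm \<Omega> (\<lambda>x. u x - \<phi> x) < 1 / real (Suc n)" for n
    using assms(2) by (simp add: H10_def)
  then obtain \<phi> where \<phi>: "\<And>n. \<phi> n \<in> test_functions \<Omega>"
    "\<And>n. H1_norm \<Omega> (\<lambda>x. u x - \<phi> n x) < 1 / real (Suc n)" by metis
  have diff: "(\<lambda>x. u x - \<phi> n x) \<in> H1 \<Omega>" for n
    using H1_diff(1)[OF assms(1) u test_function_H1(1)[OF assms(1) \<phi>(1)]] .
  have lim: "(\<lambda>n. 1 / real (Suc n)) \<longlonglongrightarrow> 0" by (rule LIMSEQ_Suc[OF lim_1_over_n])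
  show ?thesis
  proof
    show "l2_tendsto (lebesgue_on \<Omega>) \<phi> u sequentially"
    proof (rule l2_tendstoI[OF _ _ lim])
      show "\<forall>\<^sub>F n in sequentially. l2_norm (lebesgue_on \<Omega>) (\<lambda>x. \<phi> n x - u x) \<le> 1 / real (Suc n)"
        using H1_norm_ge(1)[OF assms(1) diff] \<phi>(2)
        by (subst l2_norm_minus_commute) (meson always_eventually le_less_trans less_imp_le)
    qed (use \<phi>(1) assms(1) u in \<open>auto intro!: always_eventually test_function_sq_int H1_sq_int[OF u]\<close>)
    fix i :: 'a assume i: "i \<in> Basis"
    show "l2_tendsto (lebesgue_on \<Omega>) (\<lambda>n x. frechet_derivative (\<phi> n) (at x) i)
       (weak_pderiv \<Omega> i u) sequentially"
    proof (rule l2_tendstoI[OF _ _ lim])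
      show "\<forall>\<^sub>F n in sequentially. l2_norm (lebesgue_on \<Omega>)
          (\<lambda>x. frechet_derivative (\<phi> n) (at x) i - weak_pderiv \<Omega> i u x) \<le> 1 / real (Suc n)"
        using H1_norm_ge(2)[OF assms(1) diff i] \<phi>(2)
        unfolding l2_norm_weak_pderiv_diff[OF assms(1) u \<phi>(1) i, symmetric]
        by (meson always_eventually le_less_trans less_imp_le)
      show "\<forall>\<^sub>F n in sequentially. (\<lambda>x. frechet_derivative (\<phi> n) (at x) i) \<in> sq_int (lebesgue_on \<Omega>)"
        by (intro always_eventually allI test_function_sq_int test_function_frechet_derivative \<phi>(1) i assms(1))
    qed (rule H1_weak_pderiv_sq_int[OF assms(1) u i])
  qed (rule \<phi>(1))
qed

text \<open>The H1 norm is at most the sum of the norms of the function and of its partial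
  derivatives, so componentwise convergence suffices.\<close>

lemma H10_approxI:
  fixes \<Omega> :: "'a::euclidean_space set"
  assumes "open \<Omega>" and u: "u \<in> H1 \<Omega>" and \<phi>: "\<And>n. \<phi> n \<in> test_functions \<Omega>"
    and lim: "l2_tendsto (lebesgue_on \<Omega>) \<phi> u sequentially"
    and limd: "\<And>i. i \<in> Basis \<Longrightarrow> l2_tendsto (lebesgue_on \<Omega>) (\<lambda>n x. frechet_derivative (\<phi> n) (at x) i)
       (weak_pderiv \<Omega> i u) sequentially"
  shows "u \<in> H10 \<Omega>"
  unfolding H10_def
proof (intro CollectI conjI allI impI u)
  fix \<epsilon> :: real assume "\<epsilon> > 0"
  let ?b = "\<lambda>n. l2_norm (lebesgue_on \<Omega>) (\<lambda>x. \<phi> n x - u x) + (\<Sum>i\<in>Basis. l2_norm (lebesgue_on \<Omega>)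
    (\<lambda>x. frechet_derivative (\<phi> n) (at x) i - weak_pderiv \<Omega> i u x))"
  have "?b \<longlonglongrightarrow> 0 + (\<Sum>i\<in>(Basis::'a set). 0)"
    using lim limd by (intro tendsto_add tendsto_sum) (auto simp: l2_tendsto_def)
  then have "\<forall>\<^sub>F n in sequentially. ?b n < \<epsilon>" using \<open>\<epsilon> > 0\<close> by (simp add: order_tendstoD)
  then obtain n where n: "?b n < \<epsilon>" by (meson eventually_happens sequentially_bot)
  have "H1_norm \<Omega> (\<lambda>x. u x - \<phi> n x) \<le> ?b n"
    using H1_norm_le[OF assms(1) H1_diff(1)[OF assms(1) u test_function_H1(1)[OF assms(1) \<phi>]], of n]
    by (simp add: l2_norm_weak_pderiv_diff[OF assms(1) u \<phi>] l2_norm_minus_commute[of _ u])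
  then show "\<exists>\<phi>\<in>test_functions \<Omega>. H1_norm \<Omega> (\<lambda>x. u x - \<phi> x) < \<epsilon>"
    using n \<phi> by (meson le_less_trans)
qed

lemma H10_linear:
  fixes \<Omega> :: "'a::euclidean_space set"
  assumes "open \<Omega>" "u \<in> H10 \<Omega>" "v \<in> H10 \<Omega>"
  shows "(\<lambda>x. c * u x + d * v x) \<in> H10 \<Omega>"
proof -
  obtain \<phi> where \<phi>: "\<And>n. \<phi> n \<in> test_functions \<Omega>" "l2_tendsto (lebesgue_on \<Omega>) \<phi> u sequentially"
    "\<And>i. i \<in> Basis \<Longrightarrow> l2_tendsto (lebesgue_on \<Omega>) (\<lambda>n x. frechet_derivative (\<phi> n) (at x) i)
       (weak_pderiv \<Omega> i u) sequentially"
    using H10_approx[OF assms(1,2)] by blast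
  obtain \<eta> where \<eta>: "\<And>n. \<eta> n \<in> test_functions \<Omega>" "l2_tendsto (lebesgue_on \<Omega>) \<eta> v sequentially"
    "\<And>i. i \<in> Basis \<Longrightarrow> l2_tendsto (lebesgue_on \<Omega>) (\<lambda>n x. frechet_derivative (\<eta> n) (at x) i)
       (weak_pderiv \<Omega> i v) sequentially"
    using H10_approx[OF assms(1,3)] by blast
  have u: "u \<in> H1 \<Omega>" and v: "v \<in> H1 \<Omega>" using assms by (auto intro: H10_H1)
  show ?thesis
  proof (rule H10_approxI[OF assms(1) H1_linear(1)[OF assms(1) u v]])
    show "(\<lambda>x. c * \<phi> n x + d * \<eta> n x) \<in> test_functions \<Omega>" for n
      using \<phi>(1) \<eta>(1) by (intro test_function_add test_function_scale)
    show "l2_tendsto (lebesgue_on \<Omega>) (\<lambda>n x. c * \<phi> n x + d * \<eta> n x) (\<lambda>x. c * u x + d * v x) sequentially"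
      using \<phi>(2) \<eta>(2) by (intro l2_tendsto_add l2_tendsto_scale)
    fix i :: 'a assume i: "i \<in> Basis"
    have fd: "frechet_derivative (\<lambda>x. c * \<phi> n x + d * \<eta> n x) (at x) i =
        c * frechet_derivative (\<phi> n) (at x) i + d * frechet_derivative (\<eta> n) (at x) i" for n x
      using frechet_derivative_at[OF has_derivative_add[OF
            has_derivative_mult_right[OF test_function_has_derivative[OF \<phi>(1)]]
            has_derivative_mult_right[OF test_function_has_derivative[OF \<eta>(1)]]], symmetric]
      by simp
    have "l2_tendsto (lebesgue_on \<Omega>)
        (\<lambda>n x. frechet_derivative (\<lambda>x. c * \<phi> n x + d * \<eta> n x) (at x) i)
        (\<lambda>x. c * weak_pderiv \<Omega> i u x + d * weak_pderiv \<Omega> i v x) sequentially"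
      unfolding fd using \<phi>(3)[OF i] \<eta>(3)[OF i] by (intro l2_tendsto_add l2_tendsto_scale)
    then show "l2_tendsto (lebesgue_on \<Omega>)
        (\<lambda>n x. frechet_derivative (\<lambda>x. c * \<phi> n x + d * \<eta> n x) (at x) i)
        (weak_pderiv \<Omega> i (\<lambda>x. c * u x + d * v x)) sequentially"
    proof (rule l2_tendsto_cong_AE)
      show "AE x in lebesgue_on \<Omega>. weak_pderiv \<Omega> i (\<lambda>x. c * u x + d * v x) x =
          c * weak_pderiv \<Omega> i u x + d * weak_pderiv \<Omega> i v x"
        using H1_linear(2)[OF assms(1) u v i] .
      show "weak_pderiv \<Omega> i (\<lambda>x. c * u x + d * v x) \<in> borel_measurable (lebesgue_on \<Omega>)"
        using H1_weak_pderiv_sq_int[OF assms(1) H1_linear(1)[OF assms(1) u v] i]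
        by (rule sq_int_measurable)
    qed
  qed
qed

lemma H10_scale: "open \<Omega> \<Longrightarrow> u \<in> H10 \<Omega> \<Longrightarrow> (\<lambda>x. c * u x) \<in> H10 \<Omega>"
  using H10_linear[of \<Omega> u u c 0] by simp

lemma dirichlet_form_linear_left:
  assumes "open \<Omega>" "u \<in> H1 \<Omega>" "v \<in> H1 \<Omega>" "w \<in> H1 \<Omega>"
  shows "dirichlet_form \<Omega> (\<lambda>x. c * u x + d * v x) w = c * dirichlet_form \<Omega> u w + d * dirichlet_form \<Omega> v w"
proof -
  have "l2_inner (lebesgue_on \<Omega>) (weak_pderiv \<Omega> i (\<lambda>x. c * u x + d * v x)) (weak_pderiv \<Omega> i w) =
      c * l2_inner (lebesgue_on \<Omega>) (weak_pderiv \<Omega> i u) (weak_pderiv \<Omega> i w) +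
      d * l2_inner (lebesgue_on \<Omega>) (weak_pderiv \<Omega> i v) (weak_pderiv \<Omega> i w)" if i: "i \<in> Basis" for i
  proof -
    note sq = H1_weak_pderiv_sq_int[OF assms(1,2) i] H1_weak_pderiv_sq_int[OF assms(1,3) i]
      H1_weak_pderiv_sq_int[OF assms(1,4) i]
      H1_weak_pderiv_sq_int[OF assms(1) H1_linear(1)[OF assms(1-3)] i, of c d]
    have "l2_inner (lebesgue_on \<Omega>) (weak_pderiv \<Omega> i (\<lambda>x. c * u x + d * v x)) (weak_pderiv \<Omega> i w) =
        l2_inner (lebesgue_on \<Omega>) (\<lambda>x. c * weak_pderiv \<Omega> i u x + d * weak_pderiv \<Omega> i v x) (weak_pderiv \<Omega> i w)"
      using sq H1_linear(2)[OF assms(1-3) i, of c d]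
      by (intro l2_inner_cong_AE) (auto dest: sq_int_measurable)
    then show ?thesis
      using sq by (simp add: l2_inner_add_left sq_int_scale l2_inner_scale_left)
  qed
  then show ?thesis by (simp add: dirichlet_form_def sum.distrib sum_distrib_left)
qed

section \<open>The weak Laplacian and Green's formula\<close>

lemma weak_laplacian_sq_int:
  assumes "open \<Omega>" "u \<in> H2 \<Omega>"
  shows "weak_laplacian \<Omega> u \<in> sq_int (lebesgue_on \<Omega>)"
  unfolding weak_laplacian_def[abs_def]
  using assms by (intro sq_int_sum H1_weak_pderiv_sq_int) (auto simp: H2_def)

text \<open>For a test function in place of \<open>v\<close> this is the definition of the second
  weak derivatives; both sides are continuous along the approximation of \<open>v\<close>.\<close>

proposition Green_formula:
  assumes "open \<Omega>" and u: "u \<in> H2 \<Omega>" and v: "v \<in> H10 \<Omega>"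
  shows "dirichlet_form \<Omega> u v = - l2_inner (lebesgue_on \<Omega>) (weak_laplacian \<Omega> u) v"
proof -
  obtain \<phi> where \<phi>: "\<And>n. \<phi> n \<in> test_functions \<Omega>" "l2_tendsto (lebesgue_on \<Omega>) \<phi> v sequentially"
    "\<And>i. i \<in> Basis \<Longrightarrow> l2_tendsto (lebesgue_on \<Omega>) (\<lambda>n x. frechet_derivative (\<phi> n) (at x) i)
       (weak_pderiv \<Omega> i v) sequentially"
    using H10_approx[OF assms(1) v] by blast
  have "l2_inner (lebesgue_on \<Omega>) (weak_pderiv \<Omega> i u) (weak_pderiv \<Omega> i v) =
      - l2_inner (lebesgue_on \<Omega>) (weak_pderiv \<Omega> i (weak_pderiv \<Omega> i u)) v" if i: "i \<in> Basis" for i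
  proof -
    have du: "weak_pderiv \<Omega> i u \<in> H1 \<Omega>" using u i by (simp add: H2_def)
    have "(\<lambda>n. l2_inner (lebesgue_on \<Omega>) (weak_pderiv \<Omega> i u) (\<lambda>x. frechet_derivative (\<phi> n) (at x) i))
        \<longlonglongrightarrow> l2_inner (lebesgue_on \<Omega>) (weak_pderiv \<Omega> i u) (weak_pderiv \<Omega> i v)"
      using du \<phi>(3)[OF i] by (intro l2_tendsto_inner l2_tendsto_const H1_sq_int)
    moreover have "(\<lambda>n. - l2_inner (lebesgue_on \<Omega>) (weak_pderiv \<Omega> i (weak_pderiv \<Omega> i u)) (\<phi> n))
        \<longlonglongrightarrow> - l2_inner (lebesgue_on \<Omega>) (weak_pderiv \<Omega> i (weak_pderiv \<Omega> i u)) v"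
      using assms(1) du i \<phi>(2)
      by (intro tendsto_minus l2_tendsto_inner l2_tendsto_const H1_weak_pderiv_sq_int)
    moreover have "l2_inner (lebesgue_on \<Omega>) (weak_pderiv \<Omega> i u) (\<lambda>x. frechet_derivative (\<phi> n) (at x) i) =
        - l2_inner (lebesgue_on \<Omega>) (weak_pderiv \<Omega> i (weak_pderiv \<Omega> i u)) (\<phi> n)" for n
      unfolding l2_inner_def by (rule has_weak_pderivD[OF H1_has_weak_pderiv[OF du i] \<phi>(1)])
    ultimately show ?thesis using LIMSEQ_unique by auto
  qed
  moreover have "l2_inner (lebesgue_on \<Omega>) (weak_laplacian \<Omega> u) v =
      (\<Sum>i\<in>Basis. l2_inner (lebesgue_on \<Omega>) (weak_pderiv \<Omega> i (weak_pderiv \<Omega> i u)) v)"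
    unfolding weak_laplacian_def[abs_def]
    using assms by (intro l2_inner_sum_left H1_weak_pderiv_sq_int H10_sq_int) (auto simp: H2_def)
  ultimately show ?thesis by (simp add: dirichlet_form_def sum_negf)
qed

text \<open>The H2 norm dominates every pure second derivative, and the Laplacian is a finite sum of
  these.\<close>

lemma weak_laplacian_tendsto:
  fixes \<Omega> :: "'a::euclidean_space set"
  assumes "open \<Omega>" and f: "\<forall>\<^sub>F s in F. f s \<in> H2 \<Omega>" and g: "g \<in> H2 \<Omega>"
    and lim: "((\<lambda>s. H2_norm \<Omega> (\<lambda>x. f s x - g x)) \<longlongrightarrow> 0) F"
  shows "l2_tendsto (lebesgue_on \<Omega>) (\<lambda>s. weak_laplacian \<Omega> (f s)) (weak_laplacian \<Omega> g) F"
  unfolding weak_laplacian_def[abs_def]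
proof (rule l2_tendsto_sum)
  fix i :: 'a assume i: "i \<in> Basis"
  let ?d2 = "\<lambda>u. weak_pderiv \<Omega> i (weak_pderiv \<Omega> i u)"
  show "l2_tendsto (lebesgue_on \<Omega>) (\<lambda>s. ?d2 (f s)) (?d2 g) F"
  proof (rule l2_tendstoI[OF _ _ lim])
    show "\<forall>\<^sub>F s in F. ?d2 (f s) \<in> sq_int (lebesgue_on \<Omega>)"
      using f by eventually_elim (use i in \<open>auto simp: H2_def intro!: H1_weak_pderiv_sq_int[OF assms(1)]\<close>)
    show "?d2 g \<in> sq_int (lebesgue_on \<Omega>)"
      using g i by (auto simp: H2_def intro!: H1_weak_pderiv_sq_int[OF assms(1)])
    show "\<forall>\<^sub>F s in F. l2_norm (lebesgue_on \<Omega>) (\<lambda>x. ?d2 (f s) x - ?d2 g x) \<le> H2_norm \<Omega> (\<lambda>x. f s x - g x)"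
      using f
    proof eventually_elim
      case (elim s)
      have fg: "f s \<in> H1 \<Omega>" "g \<in> H1 \<Omega>" using elim g by (auto simp: H2_def)
      have dfg: "weak_pderiv \<Omega> i (f s) \<in> H1 \<Omega>" "weak_pderiv \<Omega> i g \<in> H1 \<Omega>"
        using elim g i by (auto simp: H2_def)
      have sq: "?d2 (f s) \<in> sq_int (lebesgue_on \<Omega>)" "?d2 g \<in> sq_int (lebesgue_on \<Omega>)"
        using dfg i by (auto intro: H1_weak_pderiv_sq_int[OF assms(1)])
      \<comment> \<open>The inner derivative of the difference is known only a.e.; this is enough,
        since the outer weak derivative depends only on the class.\<close>
      have eq: "?d2 (\<lambda>x. f s x - g x) =
          weak_pderiv \<Omega> i (\<lambda>x. weak_pderiv \<Omega> i (f s) x - weak_pderiv \<Omega> i g x)"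
        using assms(1) by (intro weak_pderiv_cong_AE H1_diff(2) fg i) auto
      have "?d2 (\<lambda>x. f s x - g x) \<in> sq_int (lebesgue_on \<Omega>)"
        unfolding eq by (intro H1_weak_pderiv_sq_int[OF assms(1)] H1_diff(1) dfg i assms(1))
      moreover have "AE x in lebesgue_on \<Omega>. ?d2 (\<lambda>x. f s x - g x) x = ?d2 (f s) x - ?d2 g x"
        unfolding eq by (rule H1_diff(2)[OF assms(1) dfg i])
      ultimately have "l2_norm (lebesgue_on \<Omega>) (\<lambda>x. ?d2 (f s) x - ?d2 g x) =
          l2_norm (lebesgue_on \<Omega>) (?d2 (\<lambda>x. f s x - g x))"
        using sq_int_diff[OF sq] by (intro l2_norm_cong_AE[symmetric]) (auto dest: sq_int_measurable)
      also have "\<dots> = sqrt ((l2_norm (lebesgue_on \<Omega>) (?d2 (\<lambda>x. f s x - g x)))\<^sup>2)" by simp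
      also have "\<dots> \<le> H2_norm \<Omega> (\<lambda>x. f s x - g x)"
      proof -
        let ?a = "\<lambda>i j. (l2_norm (lebesgue_on \<Omega>) (weak_pderiv \<Omega> j (weak_pderiv \<Omega> i (\<lambda>x. f s x - g x))))\<^sup>2"
        have "?a i i \<le> (\<Sum>j\<in>Basis. ?a i j)" using i by (intro member_le_sum) auto
        also have "\<dots> \<le> (\<Sum>i\<in>Basis. \<Sum>j\<in>Basis. ?a i j)"
          using i by (intro member_le_sum[of i Basis "\<lambda>i. \<Sum>j\<in>Basis. ?a i j"]) (auto intro: sum_nonneg)
        finally show ?thesis
          unfolding H2_norm_def Lnorm_2_eq_l2_norm
          by (intro real_sqrt_le_mono) (meson add_increasing zero_le_power2)
      qed
      finally show ?case .
    qed
  qed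
qed

section \<open>Ladyzhenskaya's inequality in dimension three\<close>

lemma ennreal_two_mult_le_add_power2: "2 * (x * y) \<le> x\<^sup>2 + (y::ennreal)\<^sup>2"
proof -
  have *: "2 * (x * y) \<le> x\<^sup>2 + (y::ennreal)\<^sup>2" if le: "x \<le> y" for x y :: ennreal
  proof -
    obtain c where c: "y = x + c" using le by (auto simp: le_iff_add)
    have "x\<^sup>2 + y\<^sup>2 = 2 * (x * y) + c\<^sup>2"
      by (simp add: c power2_eq_square algebra_simps flip: mult_2)
    then show ?thesis by simp
  qed
  show ?thesis
    using *[of x y] *[of y x] by (cases "x \<le> y") (auto simp: ac_simps)
qed

text \<open>Here \<open>d\<close> and \<open>e\<close> stand for the absolute values of the partial
  derivatives. One factor of \<open>u^4 = u\<^sup>2 * u\<^sup>2\<close> is bounded by a function of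
  \<open>y\<close> alone and the other by a function of \<open>x\<close> alone, so the double
  integral factorises.\<close>

lemma Ladyzhenskaya_2d:
  fixes u d e :: "real \<times> real \<Rightarrow> ennreal"
  assumes [measurable]: "u \<in> borel_measurable borel" "d \<in> borel_measurable borel" "e \<in> borel_measurable borel"
    and d: "\<And>x y. (u (x, y))\<^sup>2 \<le> (\<integral>\<^sup>+s. 2 * (u (s, y) * d (s, y)) \<partial>lborel)"
    and e: "\<And>x y. (u (x, y))\<^sup>2 \<le> (\<integral>\<^sup>+s. 2 * (u (x, s) * e (x, s)) \<partial>lborel)"
  shows "(\<integral>\<^sup>+p. (u p)^4 \<partial>lborel) \<le>
    2 * (\<integral>\<^sup>+p. (u p)\<^sup>2 \<partial>lborel) * ((\<integral>\<^sup>+p. (d p)\<^sup>2 \<partial>lborel) + (\<integral>\<^sup>+p. (e p)\<^sup>2 \<partial>lborel))"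
proof -
  have [measurable_cong]: "sets (lborel \<Otimes>\<^sub>M lborel :: (real \<times> real) measure) = sets borel"
    by (subst lborel_prod) simp
  have fst: "(\<integral>\<^sup>+x. \<integral>\<^sup>+y. f (x, y) \<partial>lborel \<partial>lborel) = (\<integral>\<^sup>+p. f p \<partial>lborel)"
    if [measurable]: "f \<in> borel_measurable borel" for f :: "real \<times> real \<Rightarrow> ennreal"
    using lborel.nn_integral_fst[of f lborel] by (simp add: lborel_prod)
  have snd: "(\<integral>\<^sup>+y. \<integral>\<^sup>+x. f (x, y) \<partial>lborel \<partial>lborel) = (\<integral>\<^sup>+p. f p \<partial>lborel)"
    if [measurable]: "f \<in> borel_measurable borel" for f :: "real \<times> real \<Rightarrow> ennreal"
    using lborel_pair.Fubini[of f] fst[of f] by simp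
  define R where "R = (\<integral>\<^sup>+p. u p * d p \<partial>lborel)"
  define S where "S = (\<integral>\<^sup>+p. u p * e p \<partial>lborel)"
  let ?a = "\<lambda>y. \<integral>\<^sup>+s. 2 * (u (s, y) * d (s, y)) \<partial>lborel"
  let ?b = "\<lambda>x. \<integral>\<^sup>+s. 2 * (u (x, s) * e (x, s)) \<partial>lborel"
  have "(\<integral>\<^sup>+p. (u p)^4 \<partial>lborel) = (\<integral>\<^sup>+x. \<integral>\<^sup>+y. (u (x, y))^4 \<partial>lborel \<partial>lborel)"
    by (rule fst[symmetric]) measurable
  also have "\<dots> \<le> (\<integral>\<^sup>+x. \<integral>\<^sup>+y. ?b x * ?a y \<partial>lborel \<partial>lborel)"
  proof (intro nn_integral_mono)
    fix x y :: real
    have "(u (x, y))^4 = (u (x, y))\<^sup>2 * (u (x, y))\<^sup>2" by (simp flip: power_add)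
    also have "\<dots> \<le> ?b x * ?a y" by (intro mult_mono d e) auto
    finally show "(u (x, y))^4 \<le> ?b x * ?a y" .
  qed
  also have "\<dots> = (\<integral>\<^sup>+x. ?b x \<partial>lborel) * (\<integral>\<^sup>+y. ?a y \<partial>lborel)"
    by (simp add: nn_integral_cmult nn_integral_multc)
  also have "(\<integral>\<^sup>+x. ?b x \<partial>lborel) = 2 * S"
    by (subst fst[of "\<lambda>p. 2 * (u p * e p)"]) (simp_all add: S_def nn_integral_cmult)
  also have "(\<integral>\<^sup>+y. ?a y \<partial>lborel) = 2 * R"
    by (subst snd[of "\<lambda>p. 2 * (u p * d p)"]) (simp_all add: R_def nn_integral_cmult)
  also have "2 * S * (2 * R) = 2 * (2 * (R * S))" by (simp add: ac_simps)
  also have "\<dots> \<le> 2 * (R\<^sup>2 + S\<^sup>2)" by (intro mult_left_mono ennreal_two_mult_le_add_power2) auto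
  also have "\<dots> \<le> 2 * ((\<integral>\<^sup>+p. (u p)\<^sup>2 \<partial>lborel) * (\<integral>\<^sup>+p. (d p)\<^sup>2 \<partial>lborel) +
      (\<integral>\<^sup>+p. (u p)\<^sup>2 \<partial>lborel) * (\<integral>\<^sup>+p. (e p)\<^sup>2 \<partial>lborel))"
    unfolding R_def S_def by (intro mult_left_mono add_mono Cauchy_Schwarz_nn_integral) auto
  finally show ?thesis by (simp add: distrib_left mult.assoc)
qed

text \<open>The planar inequality is applied on each slice with \<open>z\<close> fixed. The factor
  that would depend on \<open>z\<close>, the integral of \<open>u\<^sup>2\<close> over the slice, is
  bounded uniformly in \<open>z\<close> by integrating the derivative \<open>c\<close> across the
  slices.\<close>

lemma Ladyzhenskaya_3d:
  fixes u c d e :: "real \<times> (real \<times> real) \<Rightarrow> ennreal"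
  assumes [measurable]: "u \<in> borel_measurable borel" "c \<in> borel_measurable borel"
      "d \<in> borel_measurable borel" "e \<in> borel_measurable borel"
    and c: "\<And>z p. (u (z, p))\<^sup>2 \<le> (\<integral>\<^sup>+s. 2 * (u (s, p) * c (s, p)) \<partial>lborel)"
    and d: "\<And>z x y. (u (z, x, y))\<^sup>2 \<le> (\<integral>\<^sup>+s. 2 * (u (z, s, y) * d (z, s, y)) \<partial>lborel)"
    and e: "\<And>z x y. (u (z, x, y))\<^sup>2 \<le> (\<integral>\<^sup>+s. 2 * (u (z, x, s) * e (z, x, s)) \<partial>lborel)"
  shows "(\<integral>\<^sup>+p. (u p)^4 \<partial>lborel) \<le> 2 * ((\<integral>\<^sup>+p. (u p)\<^sup>2 \<partial>lborel) + (\<integral>\<^sup>+p. (c p)\<^sup>2 \<partial>lborel)) *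
    ((\<integral>\<^sup>+p. (d p)\<^sup>2 \<partial>lborel) + (\<integral>\<^sup>+p. (e p)\<^sup>2 \<partial>lborel))"
proof -
  have [measurable_cong]: "sets (lborel \<Otimes>\<^sub>M lborel :: (real \<times> (real \<times> real)) measure) = sets borel"
    by (subst lborel_prod) simp
  have [measurable_cong]: "sets (borel \<Otimes>\<^sub>M borel :: (real \<times> (real \<times> real)) measure) = sets borel"
    by (subst borel_prod) simp
  have fst: "(\<integral>\<^sup>+z. \<integral>\<^sup>+p. f (z, p) \<partial>lborel \<partial>lborel) = (\<integral>\<^sup>+p. f p \<partial>lborel)"
    if [measurable]: "f \<in> borel_measurable borel" for f :: "real \<times> (real \<times> real) \<Rightarrow> ennreal"
    using lborel.nn_integral_fst[of f lborel] by (simp add: lborel_prod)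
  have snd: "(\<integral>\<^sup>+p. \<integral>\<^sup>+z. f (z, p) \<partial>lborel \<partial>lborel) = (\<integral>\<^sup>+p. f p \<partial>lborel)"
    if [measurable]: "f \<in> borel_measurable borel" for f :: "real \<times> (real \<times> real) \<Rightarrow> ennreal"
    using lborel_pair.Fubini[of f] fst[of f] by simp
  have slice [measurable]: "(\<lambda>p. f (z, p)) \<in> borel_measurable borel"
    if [measurable]: "f \<in> borel_measurable borel" for f :: "real \<times> (real \<times> real) \<Rightarrow> ennreal" and z
    by measurable
  define R where "R = (\<integral>\<^sup>+p. (u p)\<^sup>2 \<partial>lborel) + (\<integral>\<^sup>+p. (c p)\<^sup>2 \<partial>lborel)"
  have P: "(\<integral>\<^sup>+p. (u (z, p))\<^sup>2 \<partial>lborel) \<le> R" for z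
  proof -
    have "(\<integral>\<^sup>+p. (u (z, p))\<^sup>2 \<partial>lborel) \<le> (\<integral>\<^sup>+p. \<integral>\<^sup>+s. 2 * (u (s, p) * c (s, p)) \<partial>lborel \<partial>lborel)"
      by (intro nn_integral_mono c)
    also have "\<dots> = (\<integral>\<^sup>+p. 2 * (u p * c p) \<partial>lborel)" by (rule snd) measurable
    also have "\<dots> \<le> (\<integral>\<^sup>+p. (u p)\<^sup>2 + (c p)\<^sup>2 \<partial>lborel)"
      by (intro nn_integral_mono ennreal_two_mult_le_add_power2)
    also have "\<dots> = R" unfolding R_def by (rule nn_integral_add) auto
    finally show ?thesis .
  qed
  have "(\<integral>\<^sup>+p. (u p)^4 \<partial>lborel) = (\<integral>\<^sup>+z. \<integral>\<^sup>+p. (u (z, p))^4 \<partial>lborel \<partial>lborel)"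
    by (rule fst[symmetric]) measurable
  also have "\<dots> \<le> (\<integral>\<^sup>+z. 2 * R * ((\<integral>\<^sup>+p. (d (z, p))\<^sup>2 \<partial>lborel) + (\<integral>\<^sup>+p. (e (z, p))\<^sup>2 \<partial>lborel)) \<partial>lborel)"
  proof (intro nn_integral_mono)
    fix z
    have "(\<integral>\<^sup>+p. (u (z, p))^4 \<partial>lborel) \<le> 2 * (\<integral>\<^sup>+p. (u (z, p))\<^sup>2 \<partial>lborel) *
        ((\<integral>\<^sup>+p. (d (z, p))\<^sup>2 \<partial>lborel) + (\<integral>\<^sup>+p. (e (z, p))\<^sup>2 \<partial>lborel))"
      by (rule Ladyzhenskaya_2d[of "\<lambda>p. u (z, p)" "\<lambda>p. d (z, p)" "\<lambda>p. e (z, p)"])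
        (use d e in \<open>auto intro!: slice\<close>)
    also have "\<dots> \<le> 2 * R * ((\<integral>\<^sup>+p. (d (z, p))\<^sup>2 \<partial>lborel) + (\<integral>\<^sup>+p. (e (z, p))\<^sup>2 \<partial>lborel))"
      by (intro mult_right_mono mult_left_mono P) auto
    finally show "(\<integral>\<^sup>+p. (u (z, p))^4 \<partial>lborel) \<le>
      2 * R * ((\<integral>\<^sup>+p. (d (z, p))\<^sup>2 \<partial>lborel) + (\<integral>\<^sup>+p. (e (z, p))\<^sup>2 \<partial>lborel))" .
  qed
  also have "\<dots> = 2 * R * ((\<integral>\<^sup>+z. \<integral>\<^sup>+p. (d (z, p))\<^sup>2 \<partial>lborel \<partial>lborel) +
      (\<integral>\<^sup>+z. \<integral>\<^sup>+p. (e (z, p))\<^sup>2 \<partial>lborel \<partial>lborel))"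
    by (subst nn_integral_cmult) (simp_all add: nn_integral_add)
  also have "\<dots> = 2 * R * ((\<integral>\<^sup>+p. (d p)\<^sup>2 \<partial>lborel) + (\<integral>\<^sup>+p. (e p)\<^sup>2 \<partial>lborel))"
    by (simp add: fst[of "\<lambda>p. (d p)\<^sup>2"] fst[of "\<lambda>p. (e p)\<^sup>2"])
  finally show ?thesis unfolding R_def .
qed

text \<open>The third coordinate comes first, as in the inner integral of \<open>Ladyzhenskaya_3d\<close> it is
  held fixed.\<close>

definition vec3 :: "real \<times> real \<times> real \<Rightarrow> real ^ 3" where
  "vec3 = (\<lambda>(z, x, y). x *\<^sub>R axis 1 1 + y *\<^sub>R axis 2 1 + z *\<^sub>R axis 3 1)"

lemma vec3_nth [simp]: "vec3 (z, x, y) $ 1 = x" "vec3 (z, x, y) $ 2 = y" "vec3 (z, x, y) $ 3 = z"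
  by (simp_all add: vec3_def axis_def)

lemma vec3_measurable [measurable]: "vec3 \<in> borel_measurable borel"
  unfolding vec3_def
  by (intro borel_measurable_continuous_onI) (auto simp: case_prod_beta intro!: continuous_intros)

lemma emeasure_lborel_Times:
  fixes A :: "'a::euclidean_space set" and B :: "'b::euclidean_space set"
  assumes "A \<in> sets borel" "B \<in> sets borel"
  shows "emeasure lborel (A \<times> B) = emeasure lborel A * emeasure lborel B"
  using lborel.emeasure_pair_measure_Times[of A lborel B] assms by (simp add: lborel_prod)

text \<open>Lebesgue measure is determined by the volumes of boxes, and the preimage of a box is a
  product of three intervals.\<close>

lemma lborel_eq_distr_vec3: "(lborel :: (real ^ 3) measure) = distr lborel borel vec3"
proof (rule lborel_eqI)
  fix l u :: "real ^ 3"
  assume le: "\<And>b. b \<in> Basis \<Longrightarrow> l \<bullet> b \<le> u \<bullet> b"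
  have le': "l $ i \<le> u $ i" for i using le[of "axis i 1"] by (simp add: inner_axis)
  have basis: "(Basis :: (real ^ 3) set) = {axis 1 1, axis 2 1, axis 3 1}"
    by (auto simp: Basis_vec_def UNIV_3)
  have "vec3 -` box l u = {l $ 3<..<u $ 3} \<times> ({l $ 1<..<u $ 1} \<times> {l $ 2<..<u $ 2})"
    by (auto simp: mem_box_cart forall_3)
  then have "emeasure (distr lborel borel vec3) (box l u) =
      emeasure lborel ({l $ 3<..<u $ 3} \<times> ({l $ 1<..<u $ 1} \<times> {l $ 2<..<u $ 2}))"
    by (simp add: emeasure_distr)
  also have "\<dots> = ennreal (u $ 3 - l $ 3) * (ennreal (u $ 1 - l $ 1) * ennreal (u $ 2 - l $ 2))"
    using le' by (simp add: emeasure_lborel_Times borel_open open_Times)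
  also have "\<dots> = ennreal (\<Prod>b\<in>Basis. (u - l) \<bullet> b)"
    using le' by (simp add: basis axis_eq_axis inner_axis ac_simps flip: ennreal_mult)
  finally show "emeasure (distr lborel borel vec3) (box l u) = ennreal (\<Prod>b\<in>Basis. (u - l) \<bullet> b)" .
qed simp

lemma nn_integral_vec3:
  assumes "f \<in> borel_measurable borel"
  shows "(\<integral>\<^sup>+p. f (vec3 p) \<partial>lborel) = (\<integral>\<^sup>+x. f x \<partial>lborel)"
proof -
  have "(\<integral>\<^sup>+x. f x \<partial>distr lborel borel vec3) = (\<integral>\<^sup>+p. f (vec3 p) \<partial>lborel)"
    using assms by (intro nn_integral_distr) auto
  then show ?thesis by (simp flip: lborel_eq_distr_vec3)
qed

text \<open>This provides the pointwise hypotheses of Ladyzhenskaya's inequality: integrate the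
  derivative of the square along the line, starting outside the support.\<close>

lemma test_function_power2_le:
  assumes \<phi>: "\<phi> \<in> test_functions \<Omega>" and i: "i \<in> Basis"
  shows "ennreal ((\<phi> (x + t *\<^sub>R i))\<^sup>2) \<le>
    (\<integral>\<^sup>+s. ennreal (2 * (\<bar>\<phi> (x + s *\<^sub>R i)\<bar> * \<bar>frechet_derivative \<phi> (at (x + s *\<^sub>R i)) i\<bar>)) \<partial>lborel)"
proof -
  let ?g = "\<lambda>s. \<phi> (x + s *\<^sub>R i)" and ?g' = "\<lambda>s. frechet_derivative \<phi> (at (x + s *\<^sub>R i)) i"
  obtain K where K: "compact K" "\<And>x. x \<notin> K \<Longrightarrow> \<phi> x = 0" using \<phi> by (auto simp: test_functions_def)
  obtain R where R: "\<And>x. x \<in> K \<Longrightarrow> norm x \<le> R"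
    using compact_imp_bounded[OF K(1)] bounded_iff by metis
  \<comment> \<open>The starting point lies to the left of \<open>t\<close> and so far out that
    \<open>x + A *\<^sub>R i\<close> has norm larger than \<open>R\<close>.\<close>
  define A where "A = min t (- (\<bar>R\<bar> + norm x + 1))"
  have "norm (x + A *\<^sub>R i) \<ge> norm (A *\<^sub>R i) - norm x"
    using norm_triangle_ineq2[of "A *\<^sub>R i" "- x"] by (simp add: add.commute)
  then have "norm (x + A *\<^sub>R i) > R" using i by (simp add: A_def)
  then have gA: "?g A = 0" using R K(2) by force
  have cont: "continuous_on UNIV (\<lambda>s. 2 * (?g s * ?g' s))"
    by (intro continuous_intros continuous_on_compose2[OF test_function_continuous[OF \<phi>]]
        continuous_on_compose2[OF test_function_continuous[OF test_function_frechet_derivative[OF \<phi> i]]]) auto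
  have deriv: "((\<lambda>s. (?g s)\<^sup>2) has_real_derivative 2 * (?g s * ?g' s)) (at s)" for s
    using test_function_line_derivative[OF \<phi> i] by (auto intro!: derivative_eq_intros)
  have int: "integrable lborel (\<lambda>s. 2 * (?g s * ?g' s) * indicator {A..t} s)"
    using borel_integrable_atLeastAtMost'[OF continuous_on_subset[OF cont], of A t]
    by (simp add: set_integrable_def mult.commute)
  have "(LBINT s. 2 * (?g s * ?g' s) * indicator {A..t} s) = (?g t)\<^sup>2 - (?g A)\<^sup>2"
    by (rule integral_FTC_Icc_real[of A t "\<lambda>s. (?g s)\<^sup>2"])
      (use deriv cont in \<open>auto simp: A_def continuous_on_eq_continuous_at
        intro: has_field_derivative_at_within\<close>)
  then have "ennreal ((?g t)\<^sup>2) = ennreal (norm (LBINT s. 2 * (?g s * ?g' s) * indicator {A..t} s))"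
    by (simp add: gA)
  also have "\<dots> \<le> (\<integral>\<^sup>+s. ennreal (norm (2 * (?g s * ?g' s) * indicator {A..t} s)) \<partial>lborel)"
    by (rule integral_norm_bound_ennreal[OF int])
  also have "\<dots> \<le> (\<integral>\<^sup>+s. ennreal (2 * (\<bar>?g s\<bar> * \<bar>?g' s\<bar>)) \<partial>lborel)"
    by (intro nn_integral_mono ennreal_leI) (auto simp: abs_mult indicator_def)
  finally show ?thesis .
qed

text \<open>Coordinate 3 is the slicing variable, which explains why its derivative enters the first
  factor and the other two the second.\<close>

lemma test_function_nn_integral_power4:
  fixes \<phi> :: "real ^ 3 \<Rightarrow> real"
  assumes \<phi>: "\<phi> \<in> test_functions \<Omega>"
  shows "(\<integral>\<^sup>+x. ennreal ((\<phi> x)^4) \<partial>lborel) \<le>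
    2 * ((\<integral>\<^sup>+x. ennreal ((\<phi> x)\<^sup>2) \<partial>lborel) +
      (\<integral>\<^sup>+x. ennreal ((frechet_derivative \<phi> (at x) (axis 3 1))\<^sup>2) \<partial>lborel)) *
    ((\<integral>\<^sup>+x. ennreal ((frechet_derivative \<phi> (at x) (axis 1 1))\<^sup>2) \<partial>lborel) +
      (\<integral>\<^sup>+x. ennreal ((frechet_derivative \<phi> (at x) (axis 2 1))\<^sup>2) \<partial>lborel))"
proof -
  let ?D = "\<lambda>i x. ennreal \<bar>frechet_derivative \<phi> (at x) (axis i 1)\<bar>"
  have ax: "axis i 1 \<in> (Basis :: (real ^ 3) set)" for i by simp
  have \<phi>_meas [measurable]: "\<phi> \<in> borel_measurable borel" by (rule test_function_borel[OF \<phi>])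
  have D_meas [measurable]: "(\<lambda>x. frechet_derivative \<phi> (at x) (axis i 1)) \<in> borel_measurable borel" for i
    by (rule test_function_borel[OF test_function_frechet_derivative[OF \<phi> ax]])
  have pw: "(ennreal \<bar>\<phi> (x + t *\<^sub>R axis i 1)\<bar>)\<^sup>2 \<le>
      (\<integral>\<^sup>+s. 2 * (ennreal \<bar>\<phi> (x + s *\<^sub>R axis i 1)\<bar> * ?D i (x + s *\<^sub>R axis i 1)) \<partial>lborel)" for x t i
    using test_function_power2_le[OF \<phi> ax[of i], of x t]
    by (simp add: ennreal_power ennreal_mult)
  have "(\<integral>\<^sup>+p. (ennreal \<bar>\<phi> (vec3 p)\<bar>)^4 \<partial>lborel) \<le>
      2 * ((\<integral>\<^sup>+p. (ennreal \<bar>\<phi> (vec3 p)\<bar>)\<^sup>2 \<partial>lborel) + (\<integral>\<^sup>+p. (?D 3 (vec3 p))\<^sup>2 \<partial>lborel)) *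
      ((\<integral>\<^sup>+p. (?D 1 (vec3 p))\<^sup>2 \<partial>lborel) + (\<integral>\<^sup>+p. (?D 2 (vec3 p))\<^sup>2 \<partial>lborel))"
  proof (rule Ladyzhenskaya_3d)
    fix z x y :: real and p :: "real \<times> real"
    show "(ennreal \<bar>\<phi> (vec3 (z, p))\<bar>)\<^sup>2 \<le> (\<integral>\<^sup>+s. 2 * (ennreal \<bar>\<phi> (vec3 (s, p))\<bar> * ?D 3 (vec3 (s, p))) \<partial>lborel)"
      using pw[of "fst p *\<^sub>R axis 1 1 + snd p *\<^sub>R axis 2 1" z 3] by (simp add: vec3_def case_prod_beta)
    show "(ennreal \<bar>\<phi> (vec3 (z, x, y))\<bar>)\<^sup>2 \<le>
        (\<integral>\<^sup>+s. 2 * (ennreal \<bar>\<phi> (vec3 (z, s, y))\<bar> * ?D 1 (vec3 (z, s, y))) \<partial>lborel)"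
      using pw[of "y *\<^sub>R axis 2 1 + z *\<^sub>R axis 3 1" x 1] by (simp add: vec3_def ac_simps)
    show "(ennreal \<bar>\<phi> (vec3 (z, x, y))\<bar>)\<^sup>2 \<le>
        (\<integral>\<^sup>+s. 2 * (ennreal \<bar>\<phi> (vec3 (z, x, s))\<bar> * ?D 2 (vec3 (z, x, s))) \<partial>lborel)"
      using pw[of "x *\<^sub>R axis 1 1 + z *\<^sub>R axis 3 1" y 2] by (simp add: vec3_def ac_simps)
  qed measurable
  then show ?thesis
    by (simp add: ennreal_power nn_integral_vec3[of "\<lambda>x. ennreal ((\<phi> x)^4)"]
        nn_integral_vec3[of "\<lambda>x. ennreal ((\<phi> x)\<^sup>2)"]
        nn_integral_vec3[of "\<lambda>x. ennreal ((frechet_derivative \<phi> (at x) (axis 1 1))\<^sup>2)"]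
        nn_integral_vec3[of "\<lambda>x. ennreal ((frechet_derivative \<phi> (at x) (axis 2 1))\<^sup>2)"]
        nn_integral_vec3[of "\<lambda>x. ennreal ((frechet_derivative \<phi> (at x) (axis 3 1))\<^sup>2)"])
qed

lemma test_function_nn_integral_power2:
  assumes "open \<Omega>" "\<phi> \<in> test_functions \<Omega>"
  shows "(\<integral>\<^sup>+x. ennreal ((\<phi> x)\<^sup>2) \<partial>lborel) = ennreal ((l2_norm (lebesgue_on \<Omega>) \<phi>)\<^sup>2)"
proof -
  have sq: "(\<lambda>x. \<phi> x * \<phi> x) \<in> test_functions \<Omega>" using assms by (intro test_function_mult)
  have "(\<integral>\<^sup>+x. ennreal ((\<phi> x)\<^sup>2) \<partial>lborel) = ennreal (LINT x|lborel. \<phi> x * \<phi> x)"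
    using test_function_integrable_lborel[OF sq]
    by (subst nn_integral_eq_integral[symmetric]) (auto simp: power2_eq_square)
  then show ?thesis
    using test_function_integral[OF sq assms(1)] by (simp add: l2_norm_power2 l2_inner_def)
qed

text \<open>Ladyzhenskaya's bound involves only L2 norms of the approximants and of their
  derivatives, which converge and are therefore bounded. Fatou's lemma along an a.e. convergent
  subsequence transfers the bound to the limit.\<close>

theorem H10_power4_integrable:
  fixes \<Omega> :: "(real ^ 3) set"
  assumes "open \<Omega>" "\<psi> \<in> H10 \<Omega>"
  shows "integrable (lebesgue_on \<Omega>) (\<lambda>x. (\<psi> x)^4)"
proof -
  let ?M = "lebesgue_on \<Omega>"
  have \<Omega>: "\<Omega> \<in> sets lebesgue" using assms by auto
  obtain \<phi> where \<phi>: "\<And>n. \<phi> n \<in> test_functions \<Omega>" "l2_tendsto ?M \<phi> \<psi> sequentially"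
    "\<And>i. i \<in> Basis \<Longrightarrow> l2_tendsto ?M (\<lambda>n x. frechet_derivative (\<phi> n) (at x) i)
       (weak_pderiv \<Omega> i \<psi>) sequentially"
    using H10_approx[OF assms] by blast
  let ?D = "\<lambda>i n x. frechet_derivative (\<phi> n) (at x) (axis i 1)"
  define S where "S n = 2 * ((l2_norm ?M (\<phi> n))\<^sup>2 + (l2_norm ?M (?D 3 n))\<^sup>2) *
    ((l2_norm ?M (?D 1 n))\<^sup>2 + (l2_norm ?M (?D 2 n))\<^sup>2)" for n
  have "S \<longlonglongrightarrow> 2 * ((l2_norm ?M \<psi>)\<^sup>2 + (l2_norm ?M (weak_pderiv \<Omega> (axis 3 1) \<psi>))\<^sup>2) *
      ((l2_norm ?M (weak_pderiv \<Omega> (axis 1 1) \<psi>))\<^sup>2 + (l2_norm ?M (weak_pderiv \<Omega> (axis 2 1) \<psi>))\<^sup>2)"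
    unfolding S_def l2_norm_power2 by (intro tendsto_intros l2_tendsto_inner \<phi>) auto
  then have "Bseq S" by (intro convergent_imp_Bseq convergentI)
  then obtain C where C: "\<And>n. S n \<le> C" unfolding Bseq_def by (auto dest: abs_le_D1)
  have bound: "(\<integral>\<^sup>+x. ennreal ((\<phi> n x)^4) \<partial>?M) \<le> ennreal C" for n
  proof -
    have "(\<integral>\<^sup>+x. ennreal ((\<phi> n x)^4) \<partial>?M) \<le> (\<integral>\<^sup>+x. ennreal ((\<phi> n x)^4) \<partial>lebesgue)"
      using \<Omega> by (subst nn_integral_restrict_space) (auto intro!: nn_integral_mono simp: indicator_def)
    also have "\<dots> = (\<integral>\<^sup>+x. ennreal ((\<phi> n x)^4) \<partial>lborel)"
      by (rule nn_integral_completion)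
    also have "\<dots> \<le> ennreal (S n)"
      using test_function_nn_integral_power4[OF \<phi>(1), of n]
        test_function_nn_integral_power2[OF assms(1) \<phi>(1)]
        test_function_nn_integral_power2[OF assms(1) test_function_frechet_derivative[OF \<phi>(1)]]
      by (simp add: S_def ennreal_mult)
    also have "\<dots> \<le> ennreal C" using C by (intro ennreal_leI)
    finally show ?thesis .
  qed
  obtain r where r: "strict_mono r" "AE x in ?M. (\<lambda>n. \<phi> (r n) x) \<longlonglongrightarrow> \<psi> x"
    using l2_tendsto_AE_subseq[OF \<phi>(2)] by blast
  have meas [measurable]: "\<psi> \<in> borel_measurable ?M"
    using H10_sq_int[OF assms(2)] by (rule sq_int_measurable)
  have [measurable]: "\<phi> n \<in> borel_measurable ?M" for n by (rule test_function_measurable[OF \<phi>(1)])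
  have "(\<integral>\<^sup>+x. ennreal ((\<psi> x)^4) \<partial>?M) = (\<integral>\<^sup>+x. liminf (\<lambda>n. ennreal ((\<phi> (r n) x)^4)) \<partial>?M)"
    using r(2)
  proof (intro nn_integral_cong_AE, eventually_elim)
    case (elim x)
    then have "(\<lambda>n. ennreal ((\<phi> (r n) x)^4)) \<longlonglongrightarrow> ennreal ((\<psi> x)^4)"
      by (intro tendsto_ennrealI tendsto_power)
    then show ?case using lim_imp_Liminf[OF sequentially_bot] by metis
  qed
  also have "\<dots> \<le> liminf (\<lambda>n. \<integral>\<^sup>+x. ennreal ((\<phi> (r n) x)^4) \<partial>?M)"
    by (rule nn_integral_liminf) auto
  also have "\<dots> \<le> liminf (\<lambda>n. ennreal C)" by (intro Liminf_mono always_eventually allI bound)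
  also have "\<dots> = ennreal C" by (simp add: Liminf_const)
  finally have "(\<integral>\<^sup>+x. ennreal ((\<psi> x)^4) \<partial>?M) \<le> ennreal C" .
  then have "(\<integral>\<^sup>+x. ennreal ((\<psi> x)^4) \<partial>?M) < \<infinity>" by (rule le_less_trans) simp
  then show ?thesis by (intro integrableI_nonneg) auto
qed

section \<open>The energy functionals along a solution\<close>

lemma Lnorm_4_power4: "Lnorm 4 \<Omega> f ^ 4 = (LINT x|lebesgue_on \<Omega>. (f x)^4)" for f :: "'a::euclidean_space \<Rightarrow> real"
proof -
  have "\<bar>f x\<bar>^4 = (f x)^4" for x by (simp add: power_even_abs)
  then show ?thesis by (simp add: Lnorm_def)
qed

lemma Lnorm_2_weak_grad_power4:
  assumes "open \<Omega>" "u \<in> H1 \<Omega>"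
  shows "Lnorm 2 \<Omega> (weak_grad \<Omega> u) ^ 4 = (dirichlet_form \<Omega> u u)\<^sup>2"
  by (simp flip: Lnorm_2_weak_grad[OF assms] power_mult)

lemma I_eq:
  assumes "open \<Omega>" "u \<in> H1 \<Omega>"
  shows "I \<Omega> a b l u = a * (dirichlet_form \<Omega> u u)\<^sup>2 + b * dirichlet_form \<Omega> u u -
    l * l2_inner (lebesgue_on \<Omega>) u u - (LINT x|lebesgue_on \<Omega>. (u x)^4)"
  by (simp add: I_def Lnorm_4_power4 Lnorm_2_weak_grad_power4[OF assms] Lnorm_2_weak_grad[OF assms]
      Lnorm_2_eq_l2_norm l2_norm_power2)

lemma J_eq:
  assumes "open \<Omega>" "u \<in> H1 \<Omega>"
  shows "J \<Omega> a b l u = a / 4 * (dirichlet_form \<Omega> u u)\<^sup>2 + b / 2 * dirichlet_form \<Omega> u u -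
    l / 2 * l2_inner (lebesgue_on \<Omega>) u u - 1 / 4 * (LINT x|lebesgue_on \<Omega>. (u x)^4)"
  by (simp add: J_def Lnorm_4_power4 Lnorm_2_weak_grad_power4[OF assms] Lnorm_2_weak_grad[OF assms]
      Lnorm_2_eq_l2_norm l2_norm_power2)

text \<open>A difference of squares in which both gradients are moved onto the Laplacians, leaving
  only the L2 difference \<open>f - g\<close>.\<close>

lemma dirichlet_form_diff:
  assumes "open \<Omega>" "f \<in> H10 \<Omega> \<inter> H2 \<Omega>" "g \<in> H10 \<Omega> \<inter> H2 \<Omega>"
  shows "dirichlet_form \<Omega> f f - dirichlet_form \<Omega> g g =
    - l2_inner (lebesgue_on \<Omega>) (\<lambda>x. weak_laplacian \<Omega> f x + weak_laplacian \<Omega> g x) (\<lambda>x. f x - g x)"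
proof -
  have sq: "f \<in> sq_int (lebesgue_on \<Omega>)" "g \<in> sq_int (lebesgue_on \<Omega>)"
    "weak_laplacian \<Omega> f \<in> sq_int (lebesgue_on \<Omega>)" "weak_laplacian \<Omega> g \<in> sq_int (lebesgue_on \<Omega>)"
    using assms by (auto intro: H10_sq_int weak_laplacian_sq_int)
  have "dirichlet_form \<Omega> f f - dirichlet_form \<Omega> g g =
      dirichlet_form \<Omega> f f - dirichlet_form \<Omega> f g + dirichlet_form \<Omega> g f - dirichlet_form \<Omega> g g"
    by (simp add: dirichlet_form_commute[of \<Omega> f g])
  also have "\<dots> = - l2_inner (lebesgue_on \<Omega>) (weak_laplacian \<Omega> f) f + l2_inner (lebesgue_on \<Omega>) (weak_laplacian \<Omega> f) g
      - l2_inner (lebesgue_on \<Omega>) (weak_laplacian \<Omega> g) f + l2_inner (lebesgue_on \<Omega>) (weak_laplacian \<Omega> g) g"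
    using assms Green_formula[OF assms(1)] by simp
  finally show ?thesis
    using sq by (simp add: l2_inner_add_left l2_inner_diff_right sq_int_diff)
qed

text \<open>No gradient of the time derivative appears: after the previous rewriting, an L2
  derivative of \<open>u\<close> and L2 continuity of the Laplacian yield the limit of the
  difference quotient.\<close>

lemma dirichlet_form_deriv:
  assumes "open \<Omega>" and u: "\<And>s. s \<in> S \<Longrightarrow> u s \<in> H10 \<Omega> \<inter> H2 \<Omega>" and t: "t \<in> S"
    and v: "l2_deriv (lebesgue_on \<Omega>) u v t S"
    and lap: "l2_tendsto (lebesgue_on \<Omega>) (\<lambda>s. weak_laplacian \<Omega> (u s)) (weak_laplacian \<Omega> (u t)) (at t within S)"
  shows "((\<lambda>s. dirichlet_form \<Omega> (u s) (u s)) has_real_derivative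
    - 2 * l2_inner (lebesgue_on \<Omega>) (weak_laplacian \<Omega> (u t)) v) (at t within S)"
proof -
  let ?M = "lebesgue_on \<Omega>"
  have lt: "weak_laplacian \<Omega> (u t) \<in> sq_int ?M" using lap by (simp add: l2_tendsto_def)
  have v_sq: "v \<in> sq_int ?M" using v by (simp add: l2_deriv_def l2_tendsto_def)
  have lim: "((\<lambda>s. - l2_inner ?M (\<lambda>x. weak_laplacian \<Omega> (u s) x + weak_laplacian \<Omega> (u t) x)
      (\<lambda>x. (u s x - u t x) / (s - t))) \<longlongrightarrow>
      - l2_inner ?M (\<lambda>x. weak_laplacian \<Omega> (u t) x + weak_laplacian \<Omega> (u t) x) v) (at t within S)"
    using v by (intro tendsto_minus l2_tendsto_inner l2_tendsto_add lap l2_tendsto_const lt)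
      (simp add: l2_deriv_def)
  have eq: "- l2_inner ?M (\<lambda>x. weak_laplacian \<Omega> (u t) x + weak_laplacian \<Omega> (u t) x) v =
      - 2 * l2_inner ?M (weak_laplacian \<Omega> (u t)) v"
    using lt v_sq by (simp add: l2_inner_add_left l2_inner_scale_left)
  have ev: "\<forall>\<^sub>F s in at t within S. - l2_inner ?M (\<lambda>x. weak_laplacian \<Omega> (u s) x + weak_laplacian \<Omega> (u t) x)
      (\<lambda>x. (u s x - u t x) / (s - t)) =
      (dirichlet_form \<Omega> (u s) (u s) - dirichlet_form \<Omega> (u t) (u t)) / (s - t)"
    unfolding eventually_at_filter
  proof (intro always_eventually allI impI)
    fix s assume "s \<noteq> t" "s \<in> S"
    then show "- l2_inner ?M (\<lambda>x. weak_laplacian \<Omega> (u s) x + weak_laplacian \<Omega> (u t) x)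
      (\<lambda>x. (u s x - u t x) / (s - t)) =
      (dirichlet_form \<Omega> (u s) (u s) - dirichlet_form \<Omega> (u t) (u t)) / (s - t)"
      using dirichlet_form_diff[OF assms(1) u[of s] u[OF t]]
        l2_inner_scale_right[of ?M _ "1 / (s - t)" "\<lambda>x. u s x - u t x"] by simp
  qed
  show ?thesis
    using lim unfolding has_field_derivative_iff eq by (rule Lim_transform_eventually[OF _ ev])
qed

text \<open>The gap between \<open>p^4\<close> and its tangent at \<open>q\<close> factors as a
  square times a sum of squares. The upper bound is the lower bound with \<open>p\<close> and
  \<open>q\<close> exchanged.\<close>

lemma power4_tangent_bounds:
  fixes p q :: real
  shows "0 \<le> p^4 - q^4 - 4 * (q^3 * (p - q))"
    and "p^4 - q^4 - 4 * (q^3 * (p - q)) \<le> 4 * ((p^3 - q^3) * (p - q))"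
proof -
  have *: "p^4 - q^4 - 4 * (q^3 * (p - q)) = (p - q)\<^sup>2 * ((p + q)\<^sup>2 + 2 * q\<^sup>2)" for p q :: real
    by algebra
  show "0 \<le> p^4 - q^4 - 4 * (q^3 * (p - q))" unfolding * by simp
  have "0 \<le> q^4 - p^4 - 4 * (p^3 * (q - p))" unfolding * by simp
  then show "p^4 - q^4 - 4 * (q^3 * (p - q)) \<le> 4 * ((p^3 - q^3) * (p - q))"
    by (simp add: algebra_simps)
qed

text \<open>Convexity of \<open>p\<^sup>4\<close> bounds the error of the linearisation by the oscillation of the cubes, so
  that \<open>L\<^sup>2\<close>-continuity of the cubes replaces a Sobolev embedding.\<close>

lemma integral_power4_deriv:
  assumes u: "\<And>s. s \<in> S \<Longrightarrow> u s \<in> sq_int M" and c: "\<And>s. s \<in> S \<Longrightarrow> (\<lambda>x. (u s x)^3) \<in> sq_int M"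
    and t: "t \<in> S" and v: "l2_deriv M u v t S"
    and lim: "l2_tendsto M (\<lambda>s x. (u s x)^3) (\<lambda>x. (u t x)^3) (at t within S)"
  shows "((\<lambda>s. LINT x|M. (u s x)^4) has_real_derivative 4 * l2_inner M (\<lambda>x. (u t x)^3) v) (at t within S)"
proof -
  let ?Q = "\<lambda>s x. (u s x - u t x) / (s - t)"
  let ?F = "\<lambda>s. LINT x|M. (u s x)^4"
  let ?err = "\<lambda>s. (?F s - ?F t) / (s - t) - 4 * l2_inner M (\<lambda>x. (u t x)^3) (?Q s)"
  have Q: "l2_tendsto M ?Q v (at t within S)" using v by (simp add: l2_deriv_def)
  have "l2_tendsto M (\<lambda>s x. (u s x)^3 - (u t x)^3) (\<lambda>x. (u t x)^3 - (u t x)^3) (at t within S)"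
    by (intro l2_tendsto_diff lim l2_tendsto_const c t)
  from l2_tendsto_inner[OF this Q]
  have "((\<lambda>s. l2_inner M (\<lambda>x. (u s x)^3 - (u t x)^3) (?Q s)) \<longlongrightarrow> 0) (at t within S)"
    by (simp add: l2_inner_def)
  then have "((\<lambda>s. 4 * \<bar>l2_inner M (\<lambda>x. (u s x)^3 - (u t x)^3) (?Q s)\<bar>) \<longlongrightarrow> 4 * \<bar>0\<bar>) (at t within S)"
    by (intro tendsto_intros)
  then have lim0: "((\<lambda>s. 4 * \<bar>l2_inner M (\<lambda>x. (u s x)^3 - (u t x)^3) (?Q s)\<bar>) \<longlongrightarrow> 0) (at t within S)"
    by simp
  have "(?err \<longlongrightarrow> 0) (at t within S)"
  proof (rule Lim_null_comparison[OF _ lim0])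
    show "\<forall>\<^sub>F s in at t within S. norm (?err s) \<le> 4 * \<bar>l2_inner M (\<lambda>x. (u s x)^3 - (u t x)^3) (?Q s)\<bar>"
      unfolding eventually_at_filter
    proof (intro always_eventually allI impI)
      fix s assume s: "s \<noteq> t" "s \<in> S"
      have int4: "integrable M (\<lambda>x. (u r x)^4)" if "r \<in> S" for r
        using sq_int_mult_integrable[OF c[OF that] u[OF that]]
        by (simp add: numeral_eq_Suc mult.commute mult.left_commute)
      have diff: "(\<lambda>x. u s x - u t x) \<in> sq_int M" using u s(2) t by (intro sq_int_diff)
      \<comment> \<open>\<open>e\<close> is the integrated error of the linearisation, squeezed
        between 0 and \<open>4 * d\<close>. Since \<open>s - t\<close> can have either sign, the
        comparison after division is made between absolute values.\<close>
      define e where "e = (LINT x|M. (u s x)^4 - (u t x)^4 - 4 * ((u t x)^3 * (u s x - u t x)))"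
      define d where "d = (LINT x|M. ((u s x)^3 - (u t x)^3) * (u s x - u t x))"
      have int1: "integrable M (\<lambda>x. (u t x)^3 * (u s x - u t x))"
        using c t diff by (intro sq_int_mult_integrable)
      have int2: "integrable M (\<lambda>x. ((u s x)^3 - (u t x)^3) * (u s x - u t x))"
        by (rule sq_int_mult_integrable[OF sq_int_diff[OF c[OF s(2)] c[OF t]] diff])
      have int3: "integrable M (\<lambda>x. (u s x)^4 - (u t x)^4 - 4 * ((u t x)^3 * (u s x - u t x)))"
        using int4 s(2) t int1 by (intro Bochner_Integration.integrable_diff integrable_mult_right)
      have "0 \<le> e" unfolding e_def by (intro integral_nonneg_AE AE_I2 power4_tangent_bounds)
      moreover have "e \<le> 4 * d"
        unfolding e_def d_def
        using integral_mono[OF int3 integrable_mult_right[OF int2, of 4] power4_tangent_bounds(2)] by simp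
      moreover have "?err s = e / (s - t)"
      proof -
        have "e = ?F s - ?F t - 4 * (LINT x|M. (u t x)^3 * (u s x - u t x))"
          unfolding e_def using int4[OF s(2)] int4[OF t] int1 by simp
        moreover have "l2_inner M (\<lambda>x. (u t x)^3) (?Q s) = (LINT x|M. (u t x)^3 * (u s x - u t x)) / (s - t)"
          by (simp add: l2_inner_def)
        ultimately show ?thesis by (simp add: diff_divide_distrib)
      qed
      moreover have "l2_inner M (\<lambda>x. (u s x)^3 - (u t x)^3) (?Q s) = d / (s - t)"
        by (simp add: l2_inner_def d_def)
      ultimately show "norm (?err s) \<le> 4 * \<bar>l2_inner M (\<lambda>x. (u s x)^3 - (u t x)^3) (?Q s)\<bar>"
        by (simp add: divide_right_mono)
    qed
  qed
  moreover have "((\<lambda>s. 4 * l2_inner M (\<lambda>x. (u t x)^3) (?Q s)) \<longlongrightarrow> 4 * l2_inner M (\<lambda>x. (u t x)^3) v) (at t within S)"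
    by (intro tendsto_mult_left l2_tendsto_inner l2_tendsto_const c t Q)
  ultimately have "((\<lambda>s. ?err s + 4 * l2_inner M (\<lambda>x. (u t x)^3) (?Q s)) \<longlongrightarrow>
      0 + 4 * l2_inner M (\<lambda>x. (u t x)^3) v) (at t within S)"
    by (rule tendsto_add)
  then show ?thesis unfolding has_field_derivative_iff by simp
qed

section \<open>Global solutions\<close>

text \<open>What the blow-up argument needs from a solution on the whole half-line: \<open>v\<close>
  and \<open>w\<close> are its first and second time derivatives in L2, and continuity in H2 is kept
  only through the Laplacian.\<close>

locale global_kirchhoff_solution =
  fixes \<Omega> :: "'a::euclidean_space set" and a b l :: real and u v w :: "real \<Rightarrow> 'a \<Rightarrow> real"
  assumes open_domain: "open \<Omega>"
    and u_space: "0 \<le> t \<Longrightarrow> u t \<in> H10 \<Omega> \<inter> H2 \<Omega>"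
    and v_deriv: "0 \<le> t \<Longrightarrow> l2_deriv (lebesgue_on \<Omega>) u (v t) t {0..}"
    and w_deriv: "0 \<le> t \<Longrightarrow> l2_deriv (lebesgue_on \<Omega>) v (w t) t {0..}"
    and w_cont: "0 \<le> t \<Longrightarrow> l2_tendsto (lebesgue_on \<Omega>) w (w t) (at t within {0..})"
    and lap_cont: "0 \<le> t \<Longrightarrow> l2_tendsto (lebesgue_on \<Omega>) (\<lambda>s. weak_laplacian \<Omega> (u s))
      (weak_laplacian \<Omega> (u t)) (at t within {0..})"
    and equation_pos: "0 < t \<Longrightarrow> AE x in lebesgue_on \<Omega>. w t x =
      (a * dirichlet_form \<Omega> (u t) (u t) + b) * weak_laplacian \<Omega> (u t) x + l * u t x + (u t x)^3"
begin

abbreviation "\<mu> \<equiv> lebesgue_on \<Omega>"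
abbreviation "D t \<equiv> dirichlet_form \<Omega> (u t) (u t)"
abbreviation "lap t \<equiv> weak_laplacian \<Omega> (u t)"

lemma u_sq [simp]: "0 \<le> t \<Longrightarrow> u t \<in> sq_int \<mu>"
  using u_space[of t] by (auto intro: H10_sq_int)

lemma u_H1: "0 \<le> t \<Longrightarrow> u t \<in> H1 \<Omega>"
  using u_space[of t] by (auto intro: H10_H1)

lemma v_sq [simp]: "0 \<le> t \<Longrightarrow> v t \<in> sq_int \<mu>"
  using w_deriv[of t] by (simp add: l2_deriv_def)

lemma w_sq [simp]: "0 \<le> t \<Longrightarrow> w t \<in> sq_int \<mu>"
  using w_cont[of t] by (simp add: l2_tendsto_def)

lemma lap_sq [simp]: "0 \<le> t \<Longrightarrow> lap t \<in> sq_int \<mu>"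
  using lap_cont[of t] by (simp add: l2_tendsto_def)

lemma D_deriv:
  "0 \<le> t \<Longrightarrow> (D has_real_derivative - 2 * l2_inner \<mu> (lap t) (v t)) (at t within {0..})"
  using dirichlet_form_deriv[OF open_domain, of "{0..}" u t "v t"] u_space v_deriv lap_cont by simp

text \<open>The equation solved for its nonlinear term. Each summand is square integrable and
  continuous in time with values in L2, and \<open>u^3\<close> inherits both properties without a
  Sobolev embedding.\<close>

definition cube :: "real \<Rightarrow> 'a \<Rightarrow> real" where
  "cube t x = w t x - (a * D t + b) * lap t x - l * u t x"

lemma u_cont: "0 \<le> t \<Longrightarrow> l2_tendsto \<mu> u (u t) (at t within {0..})"
  by (rule l2_deriv_tendsto[OF v_deriv]) auto

lemma cube_cont: "0 \<le> t \<Longrightarrow> l2_tendsto \<mu> cube (cube t) (at t within {0..})"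
proof -
  assume t: "0 \<le> t"
  have "(D \<longlongrightarrow> D t) (at t within {0..})"
    using DERIV_continuous[OF D_deriv[OF t]] by (simp add: continuous_within)
  then show ?thesis
    unfolding cube_def[abs_def] using t
    by (intro l2_tendsto_diff l2_tendsto_scale l2_tendsto_scale_fun w_cont lap_cont u_cont tendsto_intros)
qed

text \<open>The equation is only given at positive times; at time zero it follows by passing to the limit
  along a sequence of times that converges almost everywhere.\<close>

lemma cube_eq: "0 \<le> t \<Longrightarrow> AE x in \<mu>. (u t x)^3 = cube t x"
proof -
  have pos: "AE x in \<mu>. (u t x)^3 = cube t x" if "0 < t" for t
    using equation_pos[OF that] by eventually_elim (simp add: cube_def)
  have "AE x in \<mu>. (u 0 x)^3 = cube 0 x"
  proof -
    define h where "h n = 1 / real (Suc n)" for n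
    have h: "0 < h n" for n by (simp add: h_def)
    have "h \<longlonglongrightarrow> 0" unfolding h_def by (rule LIMSEQ_Suc[OF lim_1_over_n])
    then have lim: "filterlim h (at 0 within {0..}) sequentially"
      unfolding filterlim_at using h
      by (auto intro!: always_eventually simp: less_imp_le less_imp_neq[symmetric])
    obtain r where r: "strict_mono r" "AE x in \<mu>. (\<lambda>n. u (h (r n)) x) \<longlonglongrightarrow> u 0 x"
      using l2_tendsto_AE_subseq[OF l2_tendsto_compose[OF u_cont lim]] by auto
    have lim_r: "filterlim (\<lambda>n. h (r n)) (at 0 within {0..}) sequentially"
      using lim filterlim_subseq[OF r(1)] by (rule filterlim_compose)
    \<comment> \<open>The second subsequence is extracted from the first, so that along it both
      \<open>u\<close> and \<open>cube\<close> converge a.e.\<close>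
    obtain q where q: "strict_mono q" "AE x in \<mu>. (\<lambda>n. cube (h (r (q n))) x) \<longlonglongrightarrow> cube 0 x"
      using l2_tendsto_AE_subseq[OF l2_tendsto_compose[OF cube_cont lim_r]] by auto
    have "AE x in \<mu>. \<forall>n. (u (h n) x)^3 = cube (h n) x"
      using pos[OF h] by (simp add: AE_all_countable)
    then show ?thesis
      using r(2) q(2)
    proof eventually_elim
      case (elim x)
      have "(\<lambda>n. (u (h (r (q n))) x)^3) \<longlonglongrightarrow> (u 0 x)^3"
        using LIMSEQ_subseq_LIMSEQ[OF elim(2) q(1)] by (intro tendsto_power) (simp add: o_def)
      then show ?case using elim(1,3) LIMSEQ_unique by simp
    qed
  qed
  then show "0 \<le> t \<Longrightarrow> AE x in \<mu>. (u t x)^3 = cube t x"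
    using pos by (cases "t = 0") auto
qed

lemma cube_sq [simp]: "0 \<le> t \<Longrightarrow> cube t \<in> sq_int \<mu>"
  using cube_cont[of t] by (simp add: l2_tendsto_def)

lemma u_cubed_sq [simp]:
  assumes "0 \<le> t"
  shows "(\<lambda>x. (u t x)^3) \<in> sq_int \<mu>"
  by (rule sq_int_cong_AE[OF cube_sq[OF assms] _ cube_eq[OF assms]])
    (intro borel_measurable_power sq_int_measurable u_sq assms)

lemma u_power4_integrable: "0 \<le> t \<Longrightarrow> integrable \<mu> (\<lambda>x. (u t x)^4)"
  using sq_int_mult_integrable[OF u_cubed_sq u_sq]
  by (simp add: numeral_eq_Suc mult.commute mult.left_commute)

lemma u_cubed_cont:
  assumes "0 \<le> t"
  shows "l2_tendsto \<mu> (\<lambda>s x. (u s x)^3) (\<lambda>x. (u t x)^3) (at t within {0..})"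
proof (rule l2_tendsto_cong_AE)
  show "l2_tendsto \<mu> (\<lambda>s x. (u s x)^3) (cube t) (at t within {0..})"
  proof (rule l2_tendsto_cong_AE_eventually[OF cube_cont[OF assms]])
    have "(\<lambda>x. (u s x)^3) \<in> sq_int \<mu> \<and> (AE x in \<mu>. cube s x = (u s x)^3)" if "0 \<le> s" for s
      using u_cubed_sq[OF that] cube_eq[OF that] by auto
    then show "\<forall>\<^sub>F s in at t within {0..}. (\<lambda>x. (u s x)^3) \<in> sq_int \<mu> \<and> (AE x in \<mu>. cube s x = (u s x)^3)"
      unfolding eventually_at_filter by (intro always_eventually) auto
  qed
qed (rule sq_int_measurable[OF u_cubed_sq[OF assms]], rule cube_eq[OF assms])

lemma power4_deriv:
  assumes "0 \<le> t"
  shows "((\<lambda>s. LINT x|\<mu>. (u s x)^4) has_real_derivative 4 * l2_inner \<mu> (\<lambda>x. (u t x)^3) (v t))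
    (at t within {0..})"
  using assms by (intro integral_power4_deriv v_deriv u_cubed_cont) auto

lemma inner_w:
  assumes "0 \<le> t" "f \<in> sq_int \<mu>"
  shows "l2_inner \<mu> (w t) f = (a * D t + b) * l2_inner \<mu> (lap t) f + l * l2_inner \<mu> (u t) f +
    l2_inner \<mu> (\<lambda>x. (u t x)^3) f"
proof -
  have "AE x in \<mu>. w t x = ((a * D t + b) * lap t x + l * u t x) + (u t x)^3"
    using cube_eq[OF assms(1)] by eventually_elim (simp add: cube_def)
  then have "l2_inner \<mu> (w t) f = l2_inner \<mu> (\<lambda>x. ((a * D t + b) * lap t x + l * u t x) + (u t x)^3) f"
    using assms
    by (intro l2_inner_cong_AE sq_int_measurable[OF w_sq] sq_int_measurable[OF assms(2)]
        borel_measurable_add borel_measurable_times borel_measurable_const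
        sq_int_measurable[OF lap_sq] sq_int_measurable[OF u_sq] sq_int_measurable[OF u_cubed_sq]) auto
  then show ?thesis
    using assms by (simp add: l2_inner_add_left sq_int_add sq_int_scale l2_inner_scale_left)
qed

text \<open>Each potential term has a derivative that pairs one term of the equation with
  \<open>v\<close>. Testing the equation with \<open>v\<close> makes their sum cancel against the
  derivative of the kinetic energy.\<close>

lemma energy_conservation:
  assumes "0 \<le> t"
  shows "J \<Omega> a b l (u t) + l2_inner \<mu> (v t) (v t) / 2 = J \<Omega> a b l (u 0) + l2_inner \<mu> (v 0) (v 0) / 2"
proof -
  define E where "E s = (a / 4 * (D s)\<^sup>2 + b / 2 * D s - l / 2 * l2_inner \<mu> (u s) (u s) -
    1 / 4 * (LINT x|\<mu>. (u s x)^4)) + 1 / 2 * l2_inner \<mu> (v s) (v s)" for s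
  have "(E has_field_derivative 0) (at s within {0..})" if s: "s \<in> {0..}" for s
  proof -
    have s0: "0 \<le> s" using s by simp
    have Mu: "((\<lambda>s. l2_inner \<mu> (u s) (u s)) has_real_derivative 2 * l2_inner \<mu> (u s) (v s)) (at s within {0..})"
      using l2_deriv_inner[OF v_deriv[OF s0] v_deriv[OF s0]] by (simp add: l2_inner_commute[of _ "v s"])
    have K: "((\<lambda>s. l2_inner \<mu> (v s) (v s)) has_real_derivative 2 * l2_inner \<mu> (w s) (v s)) (at s within {0..})"
      using l2_deriv_inner[OF w_deriv[OF s0] w_deriv[OF s0]] by (simp add: l2_inner_commute[of _ "v s"])
    show ?thesis
      unfolding E_def[abs_def]
      by (rule derivative_eq_intros D_deriv[OF s0] Mu K power4_deriv[OF s0] refl)+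
        (use inner_w[OF s0 v_sq[OF s0]] in \<open>simp add: field_simps\<close>)
  qed
  then obtain c where "\<And>s. s \<in> {0..} \<Longrightarrow> E s = c"
    using has_field_derivative_zero_constant[of "{0..}" E] by auto
  then have "E t = E 0" using assms by simp
  then show ?thesis using assms by (simp add: E_def J_eq[OF open_domain u_H1])
qed

lemma mass_deriv:
  assumes "0 \<le> t"
  shows "((\<lambda>s. l2_inner \<mu> (u s) (u s)) has_real_derivative 2 * l2_inner \<mu> (u t) (v t)) (at t within {0..})"
  using l2_deriv_inner[OF v_deriv[OF assms] v_deriv[OF assms]] by (simp add: l2_inner_commute[of _ "v t"])

text \<open>The equation tested with \<open>u\<close> itself: Green's formula turns the Laplacian
  term into the Dirichlet form, and the four terms make up \<open>- I\<close>.\<close>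

lemma virial_identity:
  assumes "0 \<le> t"
  shows "((\<lambda>s. l2_inner \<mu> (u s) (v s)) has_real_derivative
    l2_inner \<mu> (v t) (v t) - I \<Omega> a b l (u t)) (at t within {0..})"
proof -
  have "((\<lambda>s. l2_inner \<mu> (u s) (v s)) has_real_derivative
      l2_inner \<mu> (v t) (v t) + l2_inner \<mu> (w t) (u t)) (at t within {0..})"
    using l2_deriv_inner[OF v_deriv[OF assms] w_deriv[OF assms]] by (simp add: l2_inner_commute[of _ "u t"])
  moreover have "l2_inner \<mu> (w t) (u t) = - I \<Omega> a b l (u t)"
  proof -
    have "l2_inner \<mu> (\<lambda>x. (u t x)^3) (u t) = (LINT x|\<mu>. (u t x)^4)"
      by (simp add: l2_inner_def numeral_eq_Suc mult.commute mult.left_commute)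
    moreover have "l2_inner \<mu> (lap t) (u t) = - D t"
      using Green_formula[OF open_domain, of "u t" "u t"] u_space[OF assms] by simp
    ultimately show ?thesis
      using inner_w[OF assms u_sq[OF assms]]
      by (simp add: I_eq[OF open_domain u_H1[OF assms]] algebra_simps power2_eq_square)
  qed
  ultimately show ?thesis by simp
qed

lemma I_continuous: "continuous_on {0..} (\<lambda>t. I \<Omega> a b l (u t))"
proof -
  have "continuous_on {0..} D"
    by (rule DERIV_continuous_on[OF D_deriv]) simp
  moreover have "continuous_on {0..} (\<lambda>s. l2_inner \<mu> (u s) (u s))"
    by (rule DERIV_continuous_on[OF mass_deriv]) simp
  moreover have "continuous_on {0..} (\<lambda>s. LINT x|\<mu>. (u s x)^4)"
    by (rule DERIV_continuous_on[OF power4_deriv]) simp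
  ultimately have "continuous_on {0..} (\<lambda>t. a * (D t)\<^sup>2 + b * D t - l * l2_inner \<mu> (u t) (u t) -
      (LINT x|\<mu>. (u t x)^4))"
    by (intro continuous_intros)
  then show ?thesis
    by (rule continuous_on_eq) (simp add: I_eq[OF open_domain u_H1])
qed

end

section \<open>From the definition of a solution with infinite life span to the locale\<close>

lemma time_interval_infinity: "time_interval \<infinity> = {0..}"
  by (auto simp: time_interval_def)

lemma has_time_derivative_l2_deriv:
  assumes "has_time_derivative \<infinity> (L2 \<Omega>) (Lnorm 2 \<Omega>) f g" "0 \<le> t"
  shows "l2_deriv (lebesgue_on \<Omega>) f (g t) t {0..}"
proof -
  have sq: "f s \<in> sq_int (lebesgue_on \<Omega>)" "g s \<in> sq_int (lebesgue_on \<Omega>)" if "0 \<le> s" for s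
    using assms(1) that by (auto simp: has_time_derivative_def time_interval_infinity L2_eq_sq_int)
  have "(\<lambda>x. (f s x - f t x) / (s - t)) \<in> sq_int (lebesgue_on \<Omega>)" if "0 \<le> s" for s
    using sq_int_scale[OF sq_int_diff[OF sq(1)[OF that] sq(1)[OF assms(2)]], of "1 / (s - t)"] by simp
  then show ?thesis
    using assms sq unfolding l2_deriv_def l2_tendsto_def
    by (auto simp: has_time_derivative_def time_interval_infinity Lnorm_2_eq_l2_norm
        intro!: eventually_at_withinI)
qed

text \<open>The function space supplies derivatives \<open>v\<close> and \<open>w\<close> with
  \<open>w\<close> continuous, whereas the equation and the initial velocity are stated for
  \<open>ut\<close> and \<open>utt\<close>. Uniqueness of L2 derivatives transfers both statements
  to \<open>v\<close> and \<open>w\<close>.\<close>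

lemma kirchhoff_solution_global:
  fixes \<Omega> :: "'a::euclidean_space set"
  assumes "open \<Omega>" and sol: "kirchhoff_solution \<Omega> a b l u0 u1 \<infinity> u"
  obtains v w where "global_kirchhoff_solution \<Omega> a b l u v w"
    "AE x in lebesgue_on \<Omega>. u 0 x = u0 x" "AE x in lebesgue_on \<Omega>. v 0 x = u1 x"
proof -
  let ?M = "lebesgue_on \<Omega>"
  obtain ut utt where
    ut: "has_time_derivative \<infinity> (L2 \<Omega>) (Lnorm 2 \<Omega>) u ut" and
    utt: "has_time_derivative \<infinity> (L2 \<Omega>) (Lnorm 2 \<Omega>) ut utt" and
    eq: "\<And>t. 0 < t \<Longrightarrow> AE x in ?M. utt t x - (a * (Lnorm 2 \<Omega> (weak_grad \<Omega> (u t)))\<^sup>2 + b) *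
        weak_laplacian \<Omega> (u t) x = l * u t x + \<bar>u t x\<bar>\<^sup>2 * u t x" and
    init: "AE x in ?M. u 0 x = u0 x" "AE x in ?M. ut 0 x = u1 x"
    using sol by (auto simp: kirchhoff_solution_def time_interval_infinity)
  have H: "time_continuous \<infinity> (H10 \<Omega> \<inter> H2 \<Omega>) (H2_norm \<Omega>) u" "time_Ck 2 \<infinity> (L2 \<Omega>) (Lnorm 2 \<Omega>) u"
    using sol by (auto simp: kirchhoff_solution_def Hspace_def)
  obtain v w where
    v: "has_time_derivative \<infinity> (L2 \<Omega>) (Lnorm 2 \<Omega>) u v" and
    w: "has_time_derivative \<infinity> (L2 \<Omega>) (Lnorm 2 \<Omega>) v w" and
    w_cont: "time_continuous \<infinity> (L2 \<Omega>) (Lnorm 2 \<Omega>) w"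
    using H(2) by (auto simp: numeral_2_eq_2)
  have u_mem: "u t \<in> H10 \<Omega> \<inter> H2 \<Omega>" if "0 \<le> t" for t
    using H(1) that by (auto simp: time_continuous_def time_interval_infinity)
  have w_sq: "w t \<in> sq_int ?M" if "0 \<le> t" for t
    using w_cont that by (auto simp: time_continuous_def time_interval_infinity L2_eq_sq_int)
  have sq: "u t \<in> sq_int ?M" "v t \<in> sq_int ?M" "ut t \<in> sq_int ?M" if "0 \<le> t" for t
    using v w utt that
    by (auto simp: has_time_derivative_def time_interval_infinity L2_eq_sq_int)
  have nb: "at t within {0..} \<noteq> bot" if "0 \<le> t" for t :: real
  proof -
    have "at_right t \<le> at t within {0..}" using that by (intro at_le) auto
    then show ?thesis using trivial_limit_at_right_real[of t] le_bot by metis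
  qed
  have uv: "AE x in ?M. ut t x = v t x" if t: "0 \<le> t" for t
    using has_time_derivative_l2_deriv[OF ut t] has_time_derivative_l2_deriv[OF v t] nb[OF t]
    by (rule l2_deriv_unique_AE) (use t sq in auto)
  have uw: "AE x in ?M. utt t x = w t x" if t: "0 \<le> t" for t
    using has_time_derivative_l2_deriv[OF utt t] has_time_derivative_l2_deriv[OF w t] nb[OF t]
    by (rule l2_deriv_unique_AE) (use t sq uv in auto)
  have "global_kirchhoff_solution \<Omega> a b l u v w"
  proof
    fix t :: real
    show "open \<Omega>" by fact
    show "u t \<in> H10 \<Omega> \<inter> H2 \<Omega>" if "0 \<le> t" using u_mem that .
    show "l2_deriv ?M u (v t) t {0..}" "l2_deriv ?M v (w t) t {0..}" if "0 \<le> t"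
      using has_time_derivative_l2_deriv v w that by auto
    show "l2_tendsto ?M w (w t) (at t within {0..})" if "0 \<le> t"
      using w_cont w_sq that unfolding l2_tendsto_def
      by (auto simp: time_continuous_def time_interval_infinity Lnorm_2_eq_l2_norm
          intro!: eventually_at_withinI)
    show "l2_tendsto ?M (\<lambda>s. weak_laplacian \<Omega> (u s)) (weak_laplacian \<Omega> (u t)) (at t within {0..})"
      if "0 \<le> t"
      using H(1) u_mem that
      by (intro weak_laplacian_tendsto[OF assms(1)] eventually_at_withinI)
        (auto simp: time_continuous_def time_interval_infinity)
    show "AE x in ?M. w t x = (a * dirichlet_form \<Omega> (u t) (u t) + b) * weak_laplacian \<Omega> (u t) x +
        l * u t x + (u t x)^3" if "0 < t"
    proof -
      have "(Lnorm 2 \<Omega> (weak_grad \<Omega> (u t)))\<^sup>2 = dirichlet_form \<Omega> (u t) (u t)"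
        using u_mem[of t] that by (intro Lnorm_2_weak_grad[OF assms(1)]) (auto intro: H10_H1)
      with eq[OF that] uw[of t] that show ?thesis
        by (auto elim!: eventually_elim2 simp: power3_eq_cube power2_eq_square)
    qed
  qed
  moreover have "AE x in ?M. v 0 x = u1 x" using uv[of 0] init(2) by auto
  ultimately show ?thesis using that init(1) by blast
qed

section \<open>The variational characterisation of \<open>d\<^sub>3\<^sup>-\<close>\<close>

text \<open>The mixed coefficients stay anonymous: only the fact that the quartic integral is a
  polynomial in \<open>c\<close> and \<open>d\<close>, hence continuous, is used. The mixed terms
  are integrable because the squares of \<open>f\<close> and \<open>g\<close> and the product
  \<open>f * g\<close> lie in L2.\<close>

lemma power4_linear_combination:
  fixes f g :: "'a \<Rightarrow> real"
  assumes meas: "f \<in> borel_measurable M" "g \<in> borel_measurable M"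
    and int: "integrable M (\<lambda>x. (f x)^4)" "integrable M (\<lambda>x. (g x)^4)"
  obtains p q r where
    "\<And>c d. integrable M (\<lambda>x. (c * f x + d * g x)^4)"
    "\<And>c d. (LINT x|M. (c * f x + d * g x)^4) = c^4 * (LINT x|M. (f x)^4) + c^3 * d * p + c\<^sup>2 * d\<^sup>2 * q +
       c * d^3 * r + d^4 * (LINT x|M. (g x)^4)"
proof -
  have f2: "(\<lambda>x. (f x)\<^sup>2) \<in> sq_int M" and g2: "(\<lambda>x. (g x)\<^sup>2) \<in> sq_int M"
    using meas int by (auto simp: sq_int_def simp flip: power_mult)
  have fg: "(\<lambda>x. f x * g x) \<in> sq_int M"
    using meas sq_int_mult_integrable[OF f2 g2] by (auto simp: sq_int_def power_mult_distrib)
  have i1: "integrable M (\<lambda>x. (f x)^3 * g x)" and i2: "integrable M (\<lambda>x. (f x)\<^sup>2 * (g x)\<^sup>2)"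
    and i3: "integrable M (\<lambda>x. f x * (g x)^3)"
    using sq_int_mult_integrable[OF f2 fg] sq_int_mult_integrable[OF f2 g2] sq_int_mult_integrable[OF g2 fg]
    by (simp_all add: power3_eq_cube power2_eq_square ac_simps)
  have expand: "(\<lambda>x. (c * f x + d * g x)^4) = (\<lambda>x. c^4 * (f x)^4 + c^3 * d * 4 * ((f x)^3 * g x) +
      c\<^sup>2 * d\<^sup>2 * 6 * ((f x)\<^sup>2 * (g x)\<^sup>2) + c * d^3 * 4 * (f x * (g x)^3) + d^4 * (g x)^4)" for c d
  proof
    fix x show "(c * f x + d * g x)^4 = c^4 * (f x)^4 + c^3 * d * 4 * ((f x)^3 * g x) +
      c\<^sup>2 * d\<^sup>2 * 6 * ((f x)\<^sup>2 * (g x)\<^sup>2) + c * d^3 * 4 * (f x * (g x)^3) + d^4 * (g x)^4"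
      by algebra
  qed
  show ?thesis
  proof
    show "integrable M (\<lambda>x. (c * f x + d * g x)^4)" for c d
      unfolding expand using int i1 i2 i3 by (intro Bochner_Integration.integrable_add integrable_mult_right)
    show "(LINT x|M. (c * f x + d * g x)^4) = c^4 * (LINT x|M. (f x)^4) +
        c^3 * d * (4 * (LINT x|M. (f x)^3 * g x)) + c\<^sup>2 * d\<^sup>2 * (6 * (LINT x|M. (f x)\<^sup>2 * (g x)\<^sup>2)) +
        c * d^3 * (4 * (LINT x|M. f x * (g x)^3)) + d^4 * (LINT x|M. (g x)^4)" for c d
      unfolding expand using int i1 i2 i3 by simp
  qed
qed

lemma dirichlet_form_linear_combination:
  assumes "open \<Omega>" "u \<in> H1 \<Omega>" "v \<in> H1 \<Omega>"
  shows "dirichlet_form \<Omega> (\<lambda>x. c * u x + d * v x) (\<lambda>x. c * u x + d * v x) =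
    c\<^sup>2 * dirichlet_form \<Omega> u u + 2 * c * d * dirichlet_form \<Omega> u v + d\<^sup>2 * dirichlet_form \<Omega> v v"
proof -
  let ?w = "\<lambda>x. c * u x + d * v x"
  have w: "?w \<in> H1 \<Omega>" using assms by (rule H1_linear)
  have "dirichlet_form \<Omega> ?w ?w = c * dirichlet_form \<Omega> ?w u + d * dirichlet_form \<Omega> ?w v"
    using dirichlet_form_linear_left[OF assms w] by (simp add: dirichlet_form_commute[of \<Omega> u ?w]
        dirichlet_form_commute[of \<Omega> v ?w])
  also have "\<dots> = c * (c * dirichlet_form \<Omega> u u + d * dirichlet_form \<Omega> v u) +
      d * (c * dirichlet_form \<Omega> u v + d * dirichlet_form \<Omega> v v)"
    using dirichlet_form_linear_left[OF assms] assms by simp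
  finally show ?thesis
    by (simp add: dirichlet_form_commute[of \<Omega> v u] power2_eq_square algebra_simps)
qed

lemma l2_inner_linear_combination:
  assumes "u \<in> sq_int M" "v \<in> sq_int M"
  shows "l2_inner M (\<lambda>x. c * u x + d * v x) (\<lambda>x. c * u x + d * v x) =
    c\<^sup>2 * l2_inner M u u + 2 * c * d * l2_inner M u v + d\<^sup>2 * l2_inner M v v"
  using assms
  by (simp add: l2_inner_add_left l2_inner_add_right sq_int_add sq_int_scale l2_inner_scale_left
      l2_inner_scale_right l2_inner_commute[of M v u] power2_eq_square algebra_simps)

text \<open>\<open>B(u)\<close> of the overview; inside H10 its sign separates
  \<open>L_minus\<close> from \<open>L_plus\<close>.\<close>

definition quad_part :: "'a::euclidean_space set \<Rightarrow> real \<Rightarrow> real \<Rightarrow> ('a \<Rightarrow> real) \<Rightarrow> real" where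
  "quad_part \<Omega> b l u = b * dirichlet_form \<Omega> u u - l * l2_inner (lebesgue_on \<Omega>) u u"

text \<open>\<open>P(u)\<close> of the overview. It is homogeneous of degree 4 against 2 for
  \<open>quad_part\<close>, so a ray on which the two have opposite signs meets the Nehari
  set.\<close>

definition quart_part :: "'a::euclidean_space set \<Rightarrow> real \<Rightarrow> ('a \<Rightarrow> real) \<Rightarrow> real" where
  "quart_part \<Omega> a u = a * (dirichlet_form \<Omega> u u)\<^sup>2 - (LINT x|lebesgue_on \<Omega>. (u x)^4)"

lemma I_eq_parts:
  "open \<Omega> \<Longrightarrow> u \<in> H1 \<Omega> \<Longrightarrow> I \<Omega> a b l u = quart_part \<Omega> a u + quad_part \<Omega> b l u"
  by (simp add: I_eq quad_part_def quart_part_def)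

lemma J_eq_parts:
  "open \<Omega> \<Longrightarrow> u \<in> H1 \<Omega> \<Longrightarrow> J \<Omega> a b l u = quart_part \<Omega> a u / 4 + quad_part \<Omega> b l u / 2"
  by (simp add: J_eq quad_part_def quart_part_def diff_divide_distrib)

lemma L_minus_iff:
  "open \<Omega> \<Longrightarrow> u \<in> L_minus \<Omega> b l \<longleftrightarrow> u \<in> H10 \<Omega> \<and> quad_part \<Omega> b l u < 0"
  by (auto simp: L_minus_def quad_part_def Lnorm_2_weak_grad H10_H1 Lnorm_2_eq_l2_norm l2_norm_power2)

lemma parts_scale:
  assumes "open \<Omega>" "u \<in> H1 \<Omega>"
  shows "quad_part \<Omega> b l (\<lambda>x. s * u x) = s\<^sup>2 * quad_part \<Omega> b l u"
    and "quart_part \<Omega> a (\<lambda>x. s * u x) = s^4 * quart_part \<Omega> a u"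
proof -
  have "dirichlet_form \<Omega> (\<lambda>x. s * u x) (\<lambda>x. s * u x) = s\<^sup>2 * dirichlet_form \<Omega> u u"
    using dirichlet_form_linear_combination[OF assms assms(2), of s 0] by simp
  then show "quad_part \<Omega> b l (\<lambda>x. s * u x) = s\<^sup>2 * quad_part \<Omega> b l u"
    and "quart_part \<Omega> a (\<lambda>x. s * u x) = s^4 * quart_part \<Omega> a u"
    by (simp_all add: quad_part_def quart_part_def l2_inner_scale_left l2_inner_scale_right
        power_mult_distrib power2_eq_square algebra_simps power4_eq_xxxx)
qed

text \<open>This supplies the nontriviality that \<open>N3\<close> demands: on the zero class the
  quadratic part cannot be negative.\<close>

lemma quad_part_neg_not_AE_0:
  assumes "0 \<le> b" "u \<in> sq_int (lebesgue_on \<Omega>)" "quad_part \<Omega> b l u < 0"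
  shows "\<not> (AE x in lebesgue_on \<Omega>. u x = 0)"
proof
  assume "AE x in lebesgue_on \<Omega>. u x = 0"
  then have "l2_inner (lebesgue_on \<Omega>) u u = 0"
    using l2_norm_eq_0_iff[OF assms(2)] by (simp flip: l2_norm_power2)
  then have "quad_part \<Omega> b l u \<ge> 0"
    using assms(1) by (simp add: quad_part_def dirichlet_form_nonneg)
  then show False using assms(3) by simp
qed

text \<open>The ray through \<open>u\<close> meets \<^const>\<open>N3\<close> at the multiple \<open>s u\<close> with
  \<open>s\<^sup>2 = - quad_part u / quart_part u\<close>.\<close>

lemma d3_minus_le:
  assumes "open \<Omega>" "0 \<le> b" "u \<in> H10 \<Omega>" "quad_part \<Omega> b l u < 0" "0 < quart_part \<Omega> a u"
  shows "d3_minus \<Omega> a b l \<le> ereal (- (quad_part \<Omega> b l u)\<^sup>2 / (4 * quart_part \<Omega> a u))"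
proof -
  let ?B = "quad_part \<Omega> b l u" and ?P = "quart_part \<Omega> a u"
  define s where "s = sqrt (- ?B / ?P)"
  have s2: "s\<^sup>2 = - ?B / ?P" using assms(4,5) by (simp add: s_def divide_nonpos_nonneg)
  have "s^4 = (s\<^sup>2)\<^sup>2" by (simp flip: power_mult)
  then have s4: "s^4 = (- ?B / ?P)\<^sup>2" unfolding s2 .
  have u: "u \<in> H1 \<Omega>" using assms(3) by (rule H10_H1)
  define v where "v x = s * u x" for x
  have v: "v \<in> H10 \<Omega>" unfolding v_def[abs_def] using assms(1,3) by (rule H10_scale)
  have Bv: "quad_part \<Omega> b l v = s\<^sup>2 * ?B" and Pv: "quart_part \<Omega> a v = s^4 * ?P"
    unfolding v_def[abs_def] using parts_scale[OF assms(1) u] by auto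
  have "s\<^sup>2 > 0" unfolding s2 using assms(4,5) by (simp add: divide_neg_pos)
  then have Bv_neg: "quad_part \<Omega> b l v < 0" unfolding Bv using assms(4) by (simp add: mult_pos_neg)
  have "I \<Omega> a b l v = 0"
    unfolding I_eq_parts[OF assms(1) H10_H1[OF v]] Bv Pv s2 s4
    using assms(5) by (simp add: field_simps power2_eq_square)
  then have "v \<in> N3 \<Omega> a b l \<inter> L_minus \<Omega> b l"
    using v Bv_neg quad_part_neg_not_AE_0[OF assms(2) H10_sq_int[OF v] Bv_neg]
    by (simp add: N3_def L_minus_iff[OF assms(1)])
  then have "d3_minus \<Omega> a b l \<le> ereal (J \<Omega> a b l v)"
    unfolding d3_minus_def by (rule INF_lower)
  \<comment> \<open>On \<open>N3\<close> the value of \<open>J\<close> is a quarter of the quadratic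
    part, here \<open>s\<^sup>2 * ?B / 4\<close>.\<close>
  also have "J \<Omega> a b l v = - ?B\<^sup>2 / (4 * ?P)"
    unfolding J_eq_parts[OF assms(1) H10_H1[OF v]] Bv Pv s2 s4
    using assms(5) by (simp add: field_simps power2_eq_square)
  finally show ?thesis .
qed

text \<open>If the quartic part were nonpositive at \<open>u\<close>, it would take arbitrarily small positive values on
  the segment from \<open>u\<close> to \<open>\<psi>\<close> or to \<open>- \<psi>\<close>, whichever avoids the region where the quadratic part is
  nonnegative; by the previous bound the infimum would then be \<open>-\<infinity>\<close>.\<close>

lemma quart_part_pos:
  assumes "open \<Omega>" "0 \<le> b" and E: "ereal E < d3_minus \<Omega> a b l"
    and \<psi>: "\<psi> \<in> H10 \<Omega>" "integrable (lebesgue_on \<Omega>) (\<lambda>x. (\<psi> x)^4)"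
      "quad_part \<Omega> b l \<psi> < 0" "0 < quart_part \<Omega> a \<psi>"
    and u: "u \<in> H10 \<Omega>" "integrable (lebesgue_on \<Omega>) (\<lambda>x. (u x)^4)" "quad_part \<Omega> b l u < 0"
  shows "0 < quart_part \<Omega> a u"
proof (rule ccontr)
  let ?M = "lebesgue_on \<Omega>"
  assume neg: "\<not> 0 < quart_part \<Omega> a u"
  \<comment> \<open>The bound on the infimum, cleared of denominators: where the quartic part is
    positive, it cannot be small compared with the square of the quadratic part.\<close>
  have below: "(quad_part \<Omega> b l v)\<^sup>2 < - 4 * E * quart_part \<Omega> a v"
    if "v \<in> H10 \<Omega>" "quad_part \<Omega> b l v < 0" "0 < quart_part \<Omega> a v" for v
  proof -
    have "E < - (quad_part \<Omega> b l v)\<^sup>2 / (4 * quart_part \<Omega> a v)"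
      using E d3_minus_le[OF assms(1,2) that] by (metis less_ereal.simps(1) order_less_le_trans)
    then show ?thesis using that(3) by (simp add: field_simps)
  qed
  obtain p q r where
    F: "\<And>c d. (LINT x|?M. (c * u x + d * \<psi> x)^4) = c^4 * (LINT x|?M. (u x)^4) + c^3 * d * p +
       c\<^sup>2 * d\<^sup>2 * q + c * d^3 * r + d^4 * (LINT x|?M. (\<psi> x)^4)"
    by (rule power4_linear_combination[OF sq_int_measurable[OF H10_sq_int[OF u(1)]]
        sq_int_measurable[OF H10_sq_int[OF \<psi>(1)]] u(2) \<psi>(2)]) (rule that, assumption)
  define B1 where "B1 = b * dirichlet_form \<Omega> u \<psi> - l * l2_inner ?M u \<psi>"
  \<comment> \<open>The sign makes the mixed term of the quadratic part nonpositive, so the whole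
    segment stays in the region where that part is negative.\<close>
  define \<sigma> :: real where "\<sigma> = (if B1 \<le> 0 then 1 else - 1)"
  have \<sigma>: "\<sigma>\<^sup>2 = 1" "\<sigma>^4 = 1" "\<sigma> * B1 \<le> 0" by (auto simp: \<sigma>_def)
  define v where "v \<theta> x = (1 - \<theta>) * u x + (\<theta> * \<sigma>) * \<psi> x" for \<theta> x
  have v: "v \<theta> \<in> H10 \<Omega>" for \<theta>
    unfolding v_def[abs_def] using assms(1) u(1) \<psi>(1) by (rule H10_linear)
  note D = dirichlet_form_linear_combination[OF assms(1) H10_H1[OF u(1)] H10_H1[OF \<psi>(1)]]
  note L = l2_inner_linear_combination[OF H10_sq_int[OF u(1)] H10_sq_int[OF \<psi>(1)]]
  have B: "quad_part \<Omega> b l (v \<theta>) = (1 - \<theta>)\<^sup>2 * quad_part \<Omega> b l u + 2 * (1 - \<theta>) * \<theta> * (\<sigma> * B1) +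
      \<theta>\<^sup>2 * quad_part \<Omega> b l \<psi>" for \<theta>
    unfolding quad_part_def v_def[abs_def] D L B1_def
    using \<sigma>(1) by (simp add: power_mult_distrib algebra_simps)
  have P: "quart_part \<Omega> a (v \<theta>) = a * ((1 - \<theta>)\<^sup>2 * dirichlet_form \<Omega> u u +
      2 * (1 - \<theta>) * (\<theta> * \<sigma>) * dirichlet_form \<Omega> u \<psi> + (\<theta> * \<sigma>)\<^sup>2 * dirichlet_form \<Omega> \<psi> \<psi>)\<^sup>2 -
      ((1 - \<theta>)^4 * (LINT x|?M. (u x)^4) + (1 - \<theta>)^3 * (\<theta> * \<sigma>) * p + (1 - \<theta>)\<^sup>2 * (\<theta> * \<sigma>)\<^sup>2 * q +
       (1 - \<theta>) * (\<theta> * \<sigma>)^3 * r + (\<theta> * \<sigma>)^4 * (LINT x|?M. (\<psi> x)^4))" for \<theta>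
    unfolding quart_part_def v_def[abs_def] D F ..
  have contB: "continuous_on {0..1} (\<lambda>\<theta>. (quad_part \<Omega> b l (v \<theta>))\<^sup>2)"
    unfolding B by (intro continuous_intros)
  have contP: "continuous_on {0..1} (\<lambda>\<theta>. quart_part \<Omega> a (v \<theta>))"
    unfolding P by (intro continuous_intros)
  have P0: "quart_part \<Omega> a (v 0) = quart_part \<Omega> a u" by (simp add: v_def[abs_def])
  have P1: "quart_part \<Omega> a (v 1) = quart_part \<Omega> a \<psi>"
    unfolding P by (simp add: quart_part_def \<sigma>)
  have B_neg: "quad_part \<Omega> b l (v \<theta>) < 0" if "0 \<le> \<theta>" "\<theta> \<le> 1" for \<theta>
  proof -
    have "2 * (1 - \<theta>) * \<theta> * (\<sigma> * B1) \<le> 0"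
      using that by (intro mult_nonneg_nonpos[OF _ \<sigma>(3)]) auto
    moreover have "(1 - \<theta>)\<^sup>2 * quad_part \<Omega> b l u \<le> 0" "\<theta>\<^sup>2 * quad_part \<Omega> b l \<psi> \<le> 0"
      using u(3) \<psi>(3) by (auto intro!: mult_nonneg_nonpos)
    moreover have "(1 - \<theta>)\<^sup>2 * quad_part \<Omega> b l u < 0 \<or> \<theta>\<^sup>2 * quad_part \<Omega> b l \<psi> < 0"
      using u(3) \<psi>(3) by (cases "\<theta> = 0") (auto intro!: mult_pos_neg)
    ultimately show ?thesis unfolding B by linarith
  qed
  obtain \<theta>0 where \<theta>0: "\<theta>0 \<in> {0..1}"
    "\<And>\<theta>. \<theta> \<in> {0..1} \<Longrightarrow> (quad_part \<Omega> b l (v \<theta>0))\<^sup>2 \<le> (quad_part \<Omega> b l (v \<theta>))\<^sup>2"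
    using continuous_attains_inf[OF compact_Icc _ contB] by auto
  \<comment> \<open>The minimum of the squared quadratic part over the compact segment, positive
    since that part vanishes nowhere on it.\<close>
  define \<beta> where "\<beta> = (quad_part \<Omega> b l (v \<theta>0))\<^sup>2"
  have \<beta>: "0 < \<beta>" using B_neg[of \<theta>0] \<theta>0(1) by (auto simp: \<beta>_def)
  have small: "\<beta> < - 4 * E * quart_part \<Omega> a (v \<theta>)"
    if "\<theta> \<in> {0..1}" "0 < quart_part \<Omega> a (v \<theta>)" for \<theta>
    using below[OF v B_neg[of \<theta>] that(2)] \<theta>0(2)[OF that(1)] that(1) by (auto simp: \<beta>_def)
  have P1_big: "\<beta> < - 4 * E * quart_part \<Omega> a (v 1)" using small[of 1] P1 \<psi>(4) by simp
  then have "0 < - 4 * E * quart_part \<Omega> a (v 1)" using \<beta> by linarith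
  then have E_neg: "E < 0" using P1 \<psi>(4) by (simp add: zero_less_mult_iff mult_less_0_iff)
  \<comment> \<open>By \<open>small\<close>, positive values of the quartic part on the segment
    exceed \<open>\<beta> / (- 4 * E)\<close>. The number \<open>c\<close> is half of that, a
    forbidden value that continuity nevertheless forces between the two ends.\<close>
  define c where "c = \<beta> / (- 8 * E)"
  have c: "0 < c" "- 4 * E * c = \<beta> / 2" using \<beta> E_neg by (auto simp: c_def field_simps)
  have "- 4 * E * c < - 4 * E * quart_part \<Omega> a (v 1)" unfolding c(2) using P1_big \<beta> by linarith
  then have "c \<le> quart_part \<Omega> a (v 1)" using E_neg by (simp add: mult_less_cancel_left)
  moreover have "quart_part \<Omega> a (v 0) \<le> c" using P0 neg c(1) by simp
  ultimately obtain \<theta> where "0 \<le> \<theta>" "\<theta> \<le> 1" "quart_part \<Omega> a (v \<theta>) = c"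
    using IVT'[OF _ _ _ contP, of c] by auto
  then show False using small[of \<theta>] c \<beta> by simp
qed

text \<open>For negative \<open>B\<close>, the assumption \<open>I < 0\<close> means
  \<open>0 < P < - B\<close>, and then the value \<open>- B\<^sup>2 / (4 * P)\<close> reached on the
  ray lies below \<open>B / 4\<close>. For nonnegative \<open>B\<close> it is enough that the ray
  through \<psi> makes the infimum nonpositive.\<close>

lemma quad_part_ge_d3_minus:
  assumes "open \<Omega>" "0 \<le> b" and E: "ereal E < d3_minus \<Omega> a b l"
    and \<psi>: "\<psi> \<in> H10 \<Omega>" "integrable (lebesgue_on \<Omega>) (\<lambda>x. (\<psi> x)^4)"
      "quad_part \<Omega> b l \<psi> < 0" "0 < quart_part \<Omega> a \<psi>"
    and u: "u \<in> H10 \<Omega>" "integrable (lebesgue_on \<Omega>) (\<lambda>x. (u x)^4)" "I \<Omega> a b l u < 0"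
  shows "d3_minus \<Omega> a b l \<le> ereal (quad_part \<Omega> b l u / 4)"
proof (cases "quad_part \<Omega> b l u < 0")
  case True
  have P: "0 < quart_part \<Omega> a u" using quart_part_pos[OF assms(1-3) \<psi> u(1,2) True] .
  have "quart_part \<Omega> a u < - quad_part \<Omega> b l u"
    using u(3) by (simp add: I_eq_parts[OF assms(1) H10_H1[OF u(1)]])
  then have "quad_part \<Omega> b l u * - quad_part \<Omega> b l u \<le> quad_part \<Omega> b l u * quart_part \<Omega> a u"
    using True by (intro mult_left_mono_neg) auto
  then have "- (quad_part \<Omega> b l u)\<^sup>2 / (4 * quart_part \<Omega> a u) \<le> quad_part \<Omega> b l u / 4"
    using P by (simp add: field_simps power2_eq_square)
  then show ?thesis
    using d3_minus_le[OF assms(1,2) u(1) True P] by (metis ereal_less_eq(3) order_trans)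
next
  case False
  have "- (quad_part \<Omega> b l \<psi>)\<^sup>2 / (4 * quart_part \<Omega> a \<psi>) \<le> 0"
    using \<psi>(4) by (simp add: divide_nonpos_nonneg)
  also have "0 \<le> quad_part \<Omega> b l u / 4" using False by simp
  finally show ?thesis
    using d3_minus_le[OF assms(1,2) \<psi>(1,3,4)] by (metis ereal_less_eq(3) order_trans)
qed

section \<open>Blow-up\<close>

text \<open>Think of \<open>M\<close> as the squared L2 norm, \<open>m\<close> as half its
  derivative and \<open>K\<close> as the squared norm of the velocity. The function
  \<open>1 / sqrt (M t)\<close> becomes decreasing and concave, so it would reach 0 in finite time,
  although it is positive.\<close>

lemma no_global_concavity:
  fixes M m K k :: "real \<Rightarrow> real"
  assumes M: "\<And>t. 0 \<le> t \<Longrightarrow> (M has_real_derivative 2 * m t) (at t within {0..})"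
    and m: "\<And>t. 0 \<le> t \<Longrightarrow> (m has_real_derivative k t) (at t within {0..})"
    and k: "\<And>t. 0 \<le> t \<Longrightarrow> 3 * K t + c \<le> k t" and "0 < c"
    and K: "\<And>t. 0 \<le> t \<Longrightarrow> 0 \<le> K t" and M0: "\<And>t. 0 \<le> t \<Longrightarrow> 0 \<le> M t"
    and CS: "\<And>t. 0 \<le> t \<Longrightarrow> (m t)\<^sup>2 \<le> M t * K t"
  shows False
proof -
  have at_pos: "at t within {0..} = at t" if "0 < t" for t :: real
    using that by (intro at_within_interior) simp
  have M': "(M has_real_derivative 2 * m t) (at t)" and m': "(m has_real_derivative k t) (at t)"
    if "0 < t" for t using M[of t] m[of t] that at_pos[OF that] by auto
  have m_cont: "continuous_on {0..t} m" for t
    using DERIV_continuous_on[of "{0..}" m k] m by (auto intro: continuous_on_subset)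
  have m_grow: "m 0 + c / 2 * t \<le> m t" if "0 \<le> t" for t
  proof (cases "t = 0")
    case False
    then have "0 < t" using that by simp
    then have "m 0 - c / 2 * 0 < m t - c / 2 * t"
    proof (rule DERIV_pos_imp_increasing_open[where f = "\<lambda>t. m t - c / 2 * t"])
      fix s assume "0 < s" "s < t"
      then show "\<exists>y. ((\<lambda>t. m t - c / 2 * t) has_real_derivative y) (at s) \<and> 0 < y"
        using m'[of s] k[of s] K[of s] \<open>0 < c\<close>
        by (intro exI[of _ "k s - c / 2"]) (auto intro!: derivative_eq_intros)
    qed (intro continuous_intros m_cont)
    then show ?thesis by simp
  qed simp
  \<comment> \<open>The time after which the linear lower bound \<open>m 0 + c / 2 * t\<close> is at
    least 1, whatever the sign of \<open>m 0\<close>.\<close>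
  define t0 where "t0 = 2 * (\<bar>m 0\<bar> + 1) / c"
  have t0: "0 < t0" using \<open>0 < c\<close> by (simp add: t0_def)
  have m_pos: "1 \<le> m t" if "t0 \<le> t" for t
  proof -
    have "c / 2 * t0 \<le> c / 2 * t" using that \<open>0 < c\<close> by simp
    then have "\<bar>m 0\<bar> + 1 \<le> c / 2 * t" using \<open>0 < c\<close> by (simp add: t0_def)
    then show ?thesis using m_grow[of t] that t0 by simp
  qed
  have M_pos: "0 < M t" if "t0 \<le> t" for t
  proof -
    have "0 < (m t)\<^sup>2" using m_pos[OF that] by simp
    then have "M t \<noteq> 0" using CS[of t] that t0 by auto
    then show ?thesis using M0[of t] that t0 by simp
  qed
  define s where "s t = sqrt (M t)" for t
  have s_pos: "0 < s t" and s2: "(s t)\<^sup>2 = M t" if "t0 \<le> t" for t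
    using M_pos[OF that] by (auto simp: s_def)
  have s': "(s has_real_derivative m t / s t) (at t)" if "t0 \<le> t" for t
  proof -
    have *: "((\<lambda>t. sqrt (M t)) has_real_derivative inverse (sqrt (M t)) / 2 * (2 * m t)) (at t)"
      using DERIV_chain2[OF DERIV_real_sqrt[OF M_pos[OF that]] M'] that t0 by simp
    show ?thesis unfolding s_def[abs_def]
      by (rule DERIV_cong[OF *]) (simp add: field_simps)
  qed
  \<comment> \<open>Minus the derivative of \<open>1 / s\<close>; its monotonicity is the concavity
    of \<open>1 / s\<close>.\<close>
  define q where "q t = m t / (s t)^3" for t
  have q': "\<exists>y. (q has_real_derivative y) (at t) \<and> 0 \<le> y" if "t0 \<le> t" for t
  proof (intro exI conjI)
    have sp: "0 < s t" and t: "0 < t" using s_pos[OF that] that t0 by auto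
    have "(q has_real_derivative (k t * (s t)^3 - m t * (3 * (m t / s t) * (s t)\<^sup>2)) / ((s t)^3 * (s t)^3)) (at t)"
      unfolding q_def[abs_def] using sp
      by (auto intro!: derivative_eq_intros m'[OF t] s'[OF that])
    moreover have "k t * (s t)^3 - m t * (3 * (m t / s t) * (s t)\<^sup>2) = s t * (k t * M t - 3 * (m t)\<^sup>2)"
      using sp by (simp add: s2[OF that, symmetric] field_simps power2_eq_square power3_eq_cube)
    ultimately show "(q has_real_derivative s t * (k t * M t - 3 * (m t)\<^sup>2) / ((s t)^3 * (s t)^3)) (at t)"
      by simp
    \<comment> \<open>The coefficient 3 is used here in full: by \<open>CS\<close>,
      \<open>3 * K t * M t\<close> compensates \<open>3 * (m t)\<^sup>2\<close>.\<close>
    have "(3 * K t + c) * M t \<le> k t * M t" using k[of t] t M_pos[OF that] by (intro mult_right_mono) auto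
    moreover have "0 < c * M t" using \<open>0 < c\<close> M_pos[OF that] by simp
    ultimately have "0 \<le> k t * M t - 3 * (m t)\<^sup>2" using CS[of t] t by (simp add: algebra_simps)
    then show "0 \<le> s t * (k t * M t - 3 * (m t)\<^sup>2) / ((s t)^3 * (s t)^3)"
      using sp by simp
  qed
  have q_mono: "q t0 \<le> q t" if "t0 \<le> t" for t
    by (rule DERIV_nonneg_imp_nondecreasing[OF that q'])
  have q0: "0 < q t0" using m_pos[of t0] s_pos[of t0] by (simp add: q_def)
  \<comment> \<open>The zero of the tangent to \<open>1 / s\<close> at \<open>t0\<close>, which has
    slope \<open>- q t0\<close>.\<close>
  define t1 where "t1 = t0 + 1 / (s t0 * q t0)"
  have t1: "t0 < t1" using q0 s_pos[of t0] by (simp add: t1_def)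
  have "1 / s t1 + q t0 * t1 \<le> 1 / s t0 + q t0 * t0"
  proof (rule DERIV_nonpos_imp_nonincreasing[where f = "\<lambda>t. 1 / s t + q t0 * t"])
    show "t0 \<le> t1" using t1 by simp
    fix t assume t: "t0 \<le> t" "t \<le> t1"
    have sp: "0 < s t" using s_pos[OF t(1)] .
    have "((\<lambda>t. 1 / s t) has_real_derivative - q t) (at t)"
      using sp s'[OF t(1)]
      by (auto intro!: derivative_eq_intros simp: q_def field_simps power2_eq_square power3_eq_cube)
    from DERIV_add[OF this DERIV_cmult[OF DERIV_ident, of "q t0"]]
    have "((\<lambda>t. 1 / s t + q t0 * t) has_real_derivative - q t + q t0) (at t)" by simp
    then show "\<exists>y. ((\<lambda>t. 1 / s t + q t0 * t) has_real_derivative y) (at t) \<and> y \<le> 0"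
      using q_mono[OF t(1)] by (intro exI[of _ "- q t + q t0"]) simp
  qed
  then have "1 / s t1 \<le> 1 / s t0 - q t0 * (t1 - t0)" by (simp add: algebra_simps)
  also have "\<dots> = 0" using q0 s_pos[of t0] by (simp add: t1_def)
  finally show False using s_pos[of t1] t1 by simp
qed

context global_kirchhoff_solution
begin

theorem no_global_solution:
  assumes b: "0 \<le> b" and \<psi>: "\<psi> \<in> H10 \<Omega>" "integrable \<mu> (\<lambda>x. (\<psi> x)^4)"
      "quad_part \<Omega> b l \<psi> < 0" "0 < quart_part \<Omega> a \<psi>"
    and I0: "I \<Omega> a b l (u 0) < 0"
    and E: "ereal (J \<Omega> a b l (u 0) + l2_inner \<mu> (v 0) (v 0) / 2) < d3_minus \<Omega> a b l"
  shows False
proof -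
  define E where "E = J \<Omega> a b l (u 0) + l2_inner \<mu> (v 0) (v 0) / 2"
  have E_less: "ereal E < d3_minus \<Omega> a b l" using E by (simp add: E_def)
  have d_le: "d3_minus \<Omega> a b l \<le> ereal (- (quad_part \<Omega> b l \<psi>)\<^sup>2 / (4 * quart_part \<Omega> a \<psi>))"
    using d3_minus_le[OF open_domain b \<psi>(1,3,4)] .
  \<comment> \<open>The level is finite: the energy bounds it from below and the ray through \<psi>
    from above.\<close>
  obtain d where d: "d3_minus \<Omega> a b l = ereal d"
    using E_less d_le by (cases "d3_minus \<Omega> a b l") auto
  have "- (quad_part \<Omega> b l \<psi>)\<^sup>2 / (4 * quart_part \<Omega> a \<psi>) \<le> 0"
    using \<psi>(4) by (simp add: divide_nonpos_nonneg)
  then have d_nonpos: "d \<le> 0" using d_le by (simp add: d)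
  have E_d: "E < d" using E_less by (simp add: d)
  have H10: "u t \<in> H10 \<Omega>" and H1: "u t \<in> H1 \<Omega>" if "0 \<le> t" for t
    using u_space[OF that] u_H1[OF that] by auto
  have J: "J \<Omega> a b l (u t) = E - l2_inner \<mu> (v t) (v t) / 2" if "0 \<le> t" for t
    using energy_conservation[OF that] by (simp add: E_def)
  have I_nz: "I \<Omega> a b l (u t) \<noteq> 0" if t: "0 \<le> t" for t
  proof
    assume I: "I \<Omega> a b l (u t) = 0"
    \<comment> \<open>On the Nehari set a negative value of \<open>J\<close> forces a negative
      quadratic part. Since \<open>J < d \<le> 0\<close>, the point \<open>u t\<close> would lie in
      the very set whose infimum is \<open>d\<close>.\<close>
    then have J_B: "J \<Omega> a b l (u t) = quad_part \<Omega> b l (u t) / 4"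
      unfolding I_eq_parts[OF open_domain H1[OF t]] J_eq_parts[OF open_domain H1[OF t]] by simp
    have J_less: "J \<Omega> a b l (u t) < d"
      using J[OF t] E_d l2_inner_self_nonneg[of \<mu> "v t"] by simp
    then have "quad_part \<Omega> b l (u t) < 0" using J_B d_nonpos by simp
    then have "u t \<in> N3 \<Omega> a b l \<inter> L_minus \<Omega> b l"
      using I H10[OF t] quad_part_neg_not_AE_0[OF b u_sq[OF t]]
      by (simp add: N3_def L_minus_iff[OF open_domain])
    then have "d3_minus \<Omega> a b l \<le> ereal (J \<Omega> a b l (u t))"
      unfolding d3_minus_def by (rule INF_lower)
    then show False using J_less by (simp add: d)
  qed
  have I_neg: "I \<Omega> a b l (u t) < 0" if t: "0 \<le> t" for t
  proof (rule ccontr)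
    assume "\<not> I \<Omega> a b l (u t) < 0"
    then obtain s where "0 \<le> s" "I \<Omega> a b l (u s) = 0"
      using IVT'[of "\<lambda>t. I \<Omega> a b l (u t)" 0 0 t] t I0
        continuous_on_subset[OF I_continuous, of "{0..t}"] by auto
    then show False using I_nz by blast
  qed
  show False
  proof (rule no_global_concavity[OF mass_deriv virial_identity])
    \<comment> \<open>The strict gap between energy and level is the positive constant that drives
      the linear growth of \<open>m\<close>.\<close>
    show "0 < 4 * (d - E)" using E_d by simp
    fix t :: real assume t: "0 \<le> t"
    have "d3_minus \<Omega> a b l \<le> ereal (quad_part \<Omega> b l (u t) / 4)"
      using quad_part_ge_d3_minus[OF open_domain b E_less \<psi> H10[OF t] u_power4_integrable[OF t] I_neg[OF t]] .
    then have "4 * d \<le> quad_part \<Omega> b l (u t)" by (simp add: d)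
    moreover have "I \<Omega> a b l (u t) = 4 * J \<Omega> a b l (u t) - quad_part \<Omega> b l (u t)"
      unfolding I_eq_parts[OF open_domain H1[OF t]] J_eq_parts[OF open_domain H1[OF t]] by simp
    ultimately show "3 * l2_inner \<mu> (v t) (v t) + 4 * (d - E) \<le> l2_inner \<mu> (v t) (v t) - I \<Omega> a b l (u t)"
      using J[OF t] by simp
    show "(l2_inner \<mu> (u t) (v t))\<^sup>2 \<le> l2_inner \<mu> (u t) (u t) * l2_inner \<mu> (v t) (v t)"
      using t by (intro l2_Cauchy_Schwarz_power2) auto
  qed (auto intro: l2_inner_self_nonneg)
qed

end

text \<open>The initial condition identifies \<open>u 0\<close> with \<open>u0\<close> only as
  classes, so the hypotheses on the data have to be carried over to the curve.\<close>

lemma IJ_cong_AE: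
  assumes "open \<Omega>" "u \<in> H1 \<Omega>" "v \<in> H1 \<Omega>" "AE x in lebesgue_on \<Omega>. u x = v x"
  shows "I \<Omega> a b l u = I \<Omega> a b l v" and "J \<Omega> a b l u = J \<Omega> a b l v"
proof -
  have meas: "u \<in> borel_measurable (lebesgue_on \<Omega>)" "v \<in> borel_measurable (lebesgue_on \<Omega>)"
    using assms(2,3) by (auto dest: H1_sq_int sq_int_measurable)
  have "dirichlet_form \<Omega> u u = dirichlet_form \<Omega> v v"
    using weak_pderiv_cong_AE[OF _ assms(4)] assms(1) by (simp add: dirichlet_form_def)
  moreover have "l2_inner (lebesgue_on \<Omega>) u u = l2_inner (lebesgue_on \<Omega>) v v"
    using meas assms(4) by (intro l2_inner_cong_AE)
  moreover have "(LINT x|lebesgue_on \<Omega>. (u x)^4) = (LINT x|lebesgue_on \<Omega>. (v x)^4)"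
    using meas assms(4) by (intro integral_cong_AE) auto
  ultimately show "I \<Omega> a b l u = I \<Omega> a b l v" and "J \<Omega> a b l u = J \<Omega> a b l v"
    using assms by (simp_all add: I_eq J_eq)
qed

theorem theorem2p8:
  fixes \<Omega> :: "(real ^ 3) set" and a b :: real and \<psi>1 :: "real ^ 3 \<Rightarrow> real"
  assumes "open \<Omega>" and "bounded \<Omega>" and "smooth_boundary \<Omega>"
    and "b > 0"
    and "0 < a" and "a < 1 / Lambda \<Omega>"
    and "dirichlet_eigenfunction \<Omega> (principal_eigenvalue \<Omega>) \<psi>1"
    and "AE x in lebesgue_on \<Omega>. \<psi>1 x > 0"
    and "Lnorm 4 \<Omega> \<psi>1 ^ 4 - a * Lnorm 2 \<Omega> (weak_grad \<Omega> \<psi>1) ^ 4 < 0"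
  shows "\<exists>\<delta>>0. \<forall>l. b * principal_eigenvalue \<Omega> < l \<and> l < b * principal_eigenvalue \<Omega> + \<delta> \<longrightarrow>
    (L_plus \<Omega> b l \<inter> N3 \<Omega> a b l) \<inter> H2 \<Omega> \<noteq> {} \<longrightarrow>
    (\<forall>u0 u1 u. u0 \<in> H2 \<Omega> \<inter> H10 \<Omega> \<longrightarrow> u1 \<in> H10 \<Omega> \<longrightarrow>
       kirchhoff_solution \<Omega> a b l u0 u1 (max_existence_time \<Omega> a b l u0 u1) u \<longrightarrow>
       u0 \<in> N3_minus \<Omega> a b l \<longrightarrow> ereal (E0 \<Omega> a b l u0 u1) < d3_minus \<Omega> a b l \<longrightarrow>
       max_existence_time \<Omega> a b l u0 u1 < \<infinity>)"
proof (intro exI[of _ 1] conjI allI impI)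
  fix l u0 u1 u
  assume l: "b * principal_eigenvalue \<Omega> < l \<and> l < b * principal_eigenvalue \<Omega> + 1"
    and u0: "u0 \<in> H2 \<Omega> \<inter> H10 \<Omega>" and u1: "u1 \<in> H10 \<Omega>"
    and sol: "kirchhoff_solution \<Omega> a b l u0 u1 (max_existence_time \<Omega> a b l u0 u1) u"
    and u0_neg: "u0 \<in> N3_minus \<Omega> a b l" and E0: "ereal (E0 \<Omega> a b l u0 u1) < d3_minus \<Omega> a b l"
  let ?M = "lebesgue_on \<Omega>"
  have \<psi>: "\<psi>1 \<in> H10 \<Omega>" and \<psi>_nz: "\<not> (AE x in ?M. \<psi>1 x = 0)"
    using assms(7) by (auto simp: dirichlet_eigenfunction_def)
  have \<psi>_H1: "\<psi>1 \<in> H1 \<Omega>" using \<psi> by (rule H10_H1)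
  \<comment> \<open>The eigenvalue equation tested with the eigenfunction itself turns
    \<open>l > b * principal_eigenvalue \<Omega>\<close> into negativity of its quadratic
    part.\<close>
  have "(LINT x|?M. weak_grad \<Omega> \<psi>1 x \<bullet> weak_grad \<Omega> \<psi>1 x) =
      principal_eigenvalue \<Omega> * (LINT x|?M. \<psi>1 x * \<psi>1 x)"
    using assms(7) \<psi> by (auto simp: dirichlet_eigenfunction_def)
  then have "dirichlet_form \<Omega> \<psi>1 \<psi>1 = principal_eigenvalue \<Omega> * l2_inner ?M \<psi>1 \<psi>1"
    by (simp add: integral_inner_weak_grad[OF assms(1) \<psi>_H1 \<psi>_H1] l2_inner_def)
  then have "quad_part \<Omega> b l \<psi>1 = (b * principal_eigenvalue \<Omega> - l) * l2_inner ?M \<psi>1 \<psi>1"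
    by (simp add: quad_part_def algebra_simps)
  moreover have "0 < l2_inner ?M \<psi>1 \<psi>1"
    using l2_norm_eq_0_iff[OF H10_sq_int[OF \<psi>]] \<psi>_nz l2_inner_self_nonneg[of ?M \<psi>1]
    by (simp add: l2_norm_def order_less_le)
  ultimately have B: "quad_part \<Omega> b l \<psi>1 < 0" using l by (simp add: mult_neg_pos)
  have P: "0 < quart_part \<Omega> a \<psi>1"
    using assms(9) by (simp add: quart_part_def Lnorm_4_power4 Lnorm_2_weak_grad_power4[OF assms(1) \<psi>_H1])
  show "max_existence_time \<Omega> a b l u0 u1 < \<infinity>"
  proof (rule ccontr)
    assume "\<not> max_existence_time \<Omega> a b l u0 u1 < \<infinity>"
    \<comment> \<open>The given \<open>u\<close> lives up to the maximal time, so an infinite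
      maximal time makes it a global solution.\<close>
    then have "kirchhoff_solution \<Omega> a b l u0 u1 \<infinity> u" using sol by simp
    then obtain v w where G: "global_kirchhoff_solution \<Omega> a b l u v w"
      and init: "AE x in ?M. u 0 x = u0 x" "AE x in ?M. v 0 x = u1 x"
      using kirchhoff_solution_global[OF assms(1)] by blast
    interpret global_kirchhoff_solution \<Omega> a b l u v w by (rule G)
    have u0_H1: "u0 \<in> H1 \<Omega>" using u0 by (auto intro: H10_H1)
    have "I \<Omega> a b l (u 0) < 0"
      using u0_neg IJ_cong_AE(1)[OF assms(1) u_H1[OF order_refl] u0_H1 init(1)] by (simp add: N3_minus_def)
    moreover have "l2_inner ?M (v 0) (v 0) = l2_inner ?M u1 u1"
      using init(2)
      by (intro l2_inner_cong_AE sq_int_measurable[OF v_sq] sq_int_measurable[OF H10_sq_int[OF u1]]) auto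
    then have "J \<Omega> a b l (u 0) + l2_inner ?M (v 0) (v 0) / 2 = E0 \<Omega> a b l u0 u1"
      using IJ_cong_AE(2)[OF assms(1) u_H1[OF order_refl] u0_H1 init(1)]
      by (simp add: E0_def Lnorm_2_eq_l2_norm l2_norm_power2)
    ultimately show False
      using no_global_solution[OF _ \<psi> H10_power4_integrable[OF assms(1) \<psi>] B P] assms(4) E0 by simp
  qed
qed simp

end
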